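(* Let $n\ge2$. Suppose that for every $p\in\mathbb{N}$, every $K\in\mathcal{K}(\mathbb{R}^n)$ with $\dim(K)=n$, and every $\bm t\in\Theta_p$, there exists $x\in K$ such that $$\frac{|R_{p,\bm t,K-x}|}{|K|^p}\leq\frac{|R_{p,\bm t,S_n}|}{|S_n|^p},$$ where $S_n\in\mathcal{K}(\mathbb{R}^n)$ is a centered $n$-simplex. Then for every $p\in\mathbb{N}$, every $(j_0,\dots,j_p)\in\mathbb{N}_0^{p+1}$ with $j_0+\dots+j_p=n$, and every $K\in\mathcal{K}(\mathbb{R}^n)$ one has $$V\big(-\Delta_pK[n-j_0],\iota_1K[n-j_1],\dots,\iota_pK[n-j_p]\big)\leq\frac{(n!)^p}{(np)!}\binom{n}{j_0,\dots,j_p}|K|^p.$$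
   Context: $\mathcal{K}(\mathbb{R}^n)$ denotes the set of convex bodies, i.e. nonempty compact convex subsets of $\mathbb{R}^n$; $|\cdot|$ is Lebesgue measure (in the dimension of the ambient space); $\dim K$ is the dimension of the affine span of $K$; $K-x$ is the translate $K+\{-x\}$. An $n$-simplex is the convex hull of $n+1$ affinely independent points $v_0,\dots,v_n\in\mathbb{R}^n$; it is centered if $v_0+\dots+v_n=0$. The mixed volume of $K_1,\dots,K_N\in\mathcal{K}(\mathbb{R}^N)$ is $V(K_1,\dots,K_N)=\frac1{N!}\frac{\partial^N}{\partial s_1\cdots\partial s_N}\big|_{s_1=\dots=s_N=0}|s_1K_1+\dots+s_NK_N|$ (Minkowski sums; the volume is a homogeneous polynomial of degree $N$ in $s_1,\dots,s_N\ge0$). $L[k]$ means that $L$ is repeated $k$ times. Identify $\mathbb{R}^{pn}=(\mathbb{R}^n)^p$; $\Delta_p(x)=(x,\dots,x)$ is the diagonal embedding $\mathbb{R}^n\to\mathbb{R}^{pn}$ and $\iota_i:\mathbb{R}^n\to\mathbb{R}^{pn}$, $1\le i\le p$, the inclusion into the $i$-th factor. $\binom{n}{j_0,\dots,j_p}=\frac{n!}{j_0!\cdots j_p!}$. $\Theta_p=\{(t_0,\dots,t_p)\in\mathbb{R}^{p+1}:t_l\ge0,\ t_0+\dots+t_p=1\}$. For $\bm t\in\Theta_p$ and $L\in\mathcal{K}(\mathbb{R}^n)$, $R_{p,\bm t,L}=\mathrm{conv}\big(-t_0\Delta_pL\cup t_1\iota_1L\cup\dots\cup t_p\iota_pL\big)\subset\mathbb{R}^{np}$.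 (The right-hand side of the hypothesis does not depend on the choice of the centered $n$-simplex, by linear invariance.) *)

theory Defs
  imports "HOL-Analysis.Analysis" "HOL-Analysis.Finite_Function_Topology"
begin

text \<open>
  Since \<open>p\<close> is quantified inside formulas, the spaces \<open>(\<real>^n)^p\<close> are all realised inside one real
  vector space: \<open>(\<real>^n)^p\<close> is the subspace of those finitely supported families
  \<open>nat \<Rightarrow>\<^sub>0 real ^ 'n\<close> whose support is contained in \<open>{1..p}\<close>.  Sums, scalar multiples and
  convex hulls are the library ones of the ambient space, and agree with those of the subspace.
  Sums of sets are Minkowski sums (theory \<open>Set_Algebras\<close>).
\<close>

definition convex_body :: "'a::euclidean_space set \<Rightarrow> bool" where
  "convex_body K \<longleftrightarrow> K \<noteq> {} \<and> compact K \<and> convex K"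

definition centered_simplex :: "(real ^ 'n) set \<Rightarrow> bool" where
  "centered_simplex S \<longleftrightarrow>
     (\<exists>V. \<not> affine_dependent V \<and> card V = CARD('n) + 1 \<and> \<Sum>V = 0 \<and> S = convex hull V)"

definition incl :: "nat \<Rightarrow> real ^ 'n \<Rightarrow> (nat \<Rightarrow>\<^sub>0 real ^ 'n)" where
  "incl i x = Poly_Mapping.single i x"

definition diag :: "nat \<Rightarrow> real ^ 'n \<Rightarrow> (nat \<Rightarrow>\<^sub>0 real ^ 'n)" where
  "diag p x = (\<Sum>i=1..p. incl i x)"

text \<open>Lebesgue measure on \<open>(\<real>^n)^p\<close>, for sets of families supported in \<open>{1..p}\<close>.\<close>

definition vol :: "nat \<Rightarrow> (nat \<Rightarrow>\<^sub>0 real ^ 'n) set \<Rightarrow> real" where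
  "vol p A = measure (\<Pi>\<^sub>M i\<in>{1..p}. lborel)
               ((\<lambda>f. restrict (Poly_Mapping.lookup f) {1..p}) ` A)"

text \<open>
  \<open>mixed_partial N F s\<close> is the iterated partial derivative of \<open>F\<close> at \<open>s\<close>, taken once in each of the
  variables with index \<open>0, \<dots>, N - 1\<close>.  The derivatives are relative to the half-line \<open>{0..}\<close>,
  because the volume of \<open>s\<^sub>1 K\<^sub>1 + \<dots> + s\<^sub>N K\<^sub>N\<close> is a polynomial only for nonnegative \<open>s\<^sub>i\<close>.
\<close>

primrec mixed_partial :: "nat \<Rightarrow> ((nat \<Rightarrow> real) \<Rightarrow> real) \<Rightarrow> (nat \<Rightarrow> real) \<Rightarrow> real" where
  "mixed_partial 0 F s = F s"
| "mixed_partial (Suc k) F s =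
     vector_derivative (\<lambda>u. mixed_partial k F (s(k := u))) (at (s k) within {0..})"

text \<open>
  The mixed volume in \<open>(\<real>^n)^p\<close> of a list \<open>Ks\<close> of \<open>n p\<close> convex bodies (indexed from \<open>0\<close>).
\<close>

definition mixed_volume :: "nat \<Rightarrow> (nat \<Rightarrow>\<^sub>0 real ^ 'n) set list \<Rightarrow> real" where
  "mixed_volume p Ks =
     (1 / fact (CARD('n) * p)) *
     mixed_partial (CARD('n) * p)
       (\<lambda>s. vol p (\<Sum>i<CARD('n) * p. (\<lambda>x. s i *\<^sub>R x) ` (Ks ! i))) (\<lambda>_. 0)"

text \<open>Only the values \<open>t 0, \<dots>, t p\<close> are relevant.\<close>

definition Theta :: "nat \<Rightarrow> (nat \<Rightarrow> real) set" where
  "Theta p = {t. (\<forall>l\<le>p. 0 \<le> t l) \<and> (\<Sum>l\<le>p. t l) = 1}"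

definition R_body :: "nat \<Rightarrow> (nat \<Rightarrow> real) \<Rightarrow> (real ^ 'n) set \<Rightarrow> (nat \<Rightarrow>\<^sub>0 real ^ 'n) set" where
  "R_body p t L =
     convex hull ((\<lambda>x. - (t 0 *\<^sub>R diag p x)) ` L \<union> (\<Union>i\<in>{1..p}. (\<lambda>x. t i *\<^sub>R incl i x) ` L))"

text \<open>
  The list \<open>-\<Delta>\<^sub>p K [n - j\<^sub>0], \<iota>\<^sub>1 K [n - j\<^sub>1], \<dots>, \<iota>\<^sub>p K [n - j\<^sub>p]\<close>; it has length \<open>n p\<close> when
  \<open>j\<^sub>0 + \<dots> + j\<^sub>p = n\<close>.
\<close>

definition body_list :: "nat \<Rightarrow> (nat \<Rightarrow> nat) \<Rightarrow> (real ^ 'n) set \<Rightarrow> (nat \<Rightarrow>\<^sub>0 real ^ 'n) set list" where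
  "body_list p j K =
     replicate (CARD('n) - j 0) ((\<lambda>x. - diag p x) ` K) @
     concat (map (\<lambda>i. replicate (CARD('n) - j i) (incl i ` K)) [1..<p + 1])"

definition multinomial :: "nat \<Rightarrow> nat \<Rightarrow> (nat \<Rightarrow> nat) \<Rightarrow> real" where
  "multinomial n p j = fact n / (\<Prod>l\<le>p. fact (j l))"

end

theory Submission
  imports Defs
begin

text \<open>
  Write \<open>N = np\<close>. If the convex set \<open>C\<close> contains the bodies \<open>t\<^sub>i f\<^sub>i(K - x)\<close> for linear maps \<open>f\<^sub>1, \<dots>, f\<^sub>N\<close>,
  then \<open>t\<^sub>1 \<dots> t\<^sub>N V(f\<^sub>1 K, \<dots>, f\<^sub>N K) \<le> V(C, \<dots>, C) = |C|\<close>. Applied to \<open>C = R\<close> of \<open>K - x\<close>, this and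
  the hypothesis reduce the claim to an upper bound for \<open>R\<close> of a simplex \<open>S\<close>, where \<open>t\<close> may be chosen
  freely; the choice \<open>t\<^sub>l = c / (j\<^sub>l + 1 / (p + 1))\<close> works.

  The monotonicity of mixed volumes is proved for polytopes through a fine mixed subdivision: every
  point of \<open>s\<^sub>1 P\<^sub>1 + \<dots> + s\<^sub>N P\<^sub>N\<close> has a lexicographically minimal representation by vertices, the support of
  this representation names its cell, and the cell contributes a monomial in \<open>s\<close> to the volume. If the
  additional vertices of a larger polytope come first in the lexicographic order, the old cells remain
  cells, so the coefficient of \<open>s\<^sub>1 \<dots> s\<^sub>N\<close> increases.

  For the simplex \<open>S\<close> with vertex set \<open>V\<close>, a point of \<open>R\<close> is written with minimal total weight as a
  combination of the vectors \<open>x\<^sub>l\<^sub>v\<close> for \<open>l \<le> p\<close>, \<open>v \<in> V\<close> that span \<open>R\<close>. By the choice of \<open>t\<close>, at least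
  \<open>j\<^sub>l + 1\<close> of the weights with given \<open>l\<close> vanish, hence, up to a null set, exactly \<open>j\<^sub>l + 1\<close>. So \<open>R\<close> is
  covered by simplices whose vertices other than \<open>0\<close> are the \<open>x\<^sub>l\<^sub>v\<close> outside a family of sets
  \<open>B\<^sub>l \<subseteq> V\<close> of size \<open>j\<^sub>l + 1\<close> that is linked, that is, forms a hypertree. Each has at most the volume of a
  standard one because the vectors form a unimodular system, and the number of families is at most
  \<open>(n + 1)\<^sup>p\<close> times the multinomial coefficient, as in the enumeration of spanning trees of a complete
  bipartite graph with prescribed degrees.
\<close>

section \<open>Translation-invariant measures\<close>

text \<open>Origin of t: with a_l = j_l + 1 / (p + 1) the a_l add up to n + 1, and t_l = c / a_l. If
  row l of an optimal weight has d zeros, an exchange of weights shows d >= a_l > j_l; the surplus 1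
  of n + 1 over the sum of the j_l, shared among the p + 1 rows, makes this strict. As the n - j_l
  add up to np, a weight with np nonzero entries has exactly j_l + 1 zeros in each row. Two factors
  cancel in the end: the product of the t_l ^ (n - j_l), which stems on one side from the scaling of
  the np bodies and on the other from the vectors spanning the covering simplices, and the (n + 1) ^
  p of the count, because S splits into n + 1 simplices at its centroid 0 and one of them enters p
  times. Two obstacles shape the form: the ambient space of families has infinite dimension, so
  volumes come from the uniqueness of translation-invariant measures instead of determinants; and
  the volume of a Minkowski sum is polynomial only for nonnegative factors, so identities found for
  positive factors reach the boundary, where the derivative is taken, by continuity.\<close>

lemma PiM_lborel_translation:
  fixes a :: "'i \<Rightarrow> 'a::euclidean_space"
  assumes "finite I"
  shows "distr (\<Pi>\<^sub>M i\<in>I. lborel) (\<Pi>\<^sub>M i\<in>I. lborel) (\<lambda>x. \<lambda>i\<in>I. x i + a i) = (\<Pi>\<^sub>M i\<in>I. lborel)"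
proof -
  interpret product_sigma_finite "\<lambda>_::'i. lborel :: 'a measure" ..
  let ?P = "\<Pi>\<^sub>M i\<in>I. lborel :: 'a measure"
  have m: "(\<lambda>x. \<lambda>i\<in>I. x i + a i) \<in> ?P \<rightarrow>\<^sub>M ?P"
    by measurable
  show ?thesis
  proof (rule PiM_eqI)
    fix A assume A: "\<And>i. i \<in> I \<Longrightarrow> A i \<in> sets (lborel :: 'a measure)"
    define A' where "A' = (\<lambda>i. (\<lambda>x. x + a i) -` A i)"
    have A'm: "A' i \<in> sets lborel" if "i \<in> I" for i
    proof -
      have "(\<lambda>x. x + a i) -` A i \<inter> space lborel \<in> sets lborel"
        using A[OF that] by measurable
      then show ?thesis by (simp add: A'_def)
    qed
    have e: "emeasure lborel (A' i) = emeasure lborel (A i)" if "i \<in> I" for i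
    proof -
      have "emeasure lborel (A i) = emeasure (distr lborel borel ((+) (a i))) (A i)"
        by (simp add: lborel_distr_plus)
      also have "\<dots> = emeasure lborel ((+) (a i) -` A i \<inter> space lborel)"
        using A[OF that] by (intro emeasure_distr) auto
      finally show ?thesis by (simp add: A'_def add.commute vimage_def)
    qed
    have "emeasure (distr ?P ?P (\<lambda>x. \<lambda>i\<in>I. x i + a i)) (Pi\<^sub>E I A) =
      emeasure ?P ((\<lambda>x. \<lambda>i\<in>I. x i + a i) -` Pi\<^sub>E I A \<inter> space ?P)"
      using A assms by (intro emeasure_distr m sets_PiM_I_finite) auto
    also have "(\<lambda>x. \<lambda>i\<in>I. x i + a i) -` Pi\<^sub>E I A \<inter> space ?P = Pi\<^sub>E I A'"
      by (auto simp: A'_def space_PiM PiE_iff)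
    also have "emeasure ?P (Pi\<^sub>E I A') = (\<Prod>i\<in>I. emeasure lborel (A' i))"
      using A'm assms by (intro emeasure_PiM) auto
    also have "\<dots> = (\<Prod>i\<in>I. emeasure lborel (A i))"
      using e by simp
    finally show "emeasure (distr ?P ?P (\<lambda>x. \<lambda>i\<in>I. x i + a i)) (Pi\<^sub>E I A) = (\<Prod>i\<in>I. emeasure lborel (A i))" .
  qed (use assms in auto)
qed

text \<open>Fubini on the product of \<open>\<nu>\<close> with Lebesgue measure \<open>P\<close>
  shows that \<open>\<nu>\<close> of \<open>A\<close> times \<open>P\<close> of \<open>B\<close>
  equals \<open>\<nu>\<close> of \<open>- B\<close> times \<open>P\<close> of \<open>A\<close>. With
  the unit cube for \<open>B\<close>, whose reflection has the same \<open>\<nu>\<close> measure by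
  the case \<open>A = B\<close>, this identifies the constant.\<close>

lemma translation_invariant_unique:
  fixes \<nu> :: "('i \<Rightarrow> real) measure"
  assumes fin: "finite I" and sets: "sets \<nu> = sets (\<Pi>\<^sub>M i\<in>I. lborel)"
    and inv: "\<And>a. distr \<nu> (\<Pi>\<^sub>M i\<in>I. lborel) (\<lambda>x. \<lambda>i\<in>I. x i + a i) = \<nu>"
    and bd: "\<And>r::nat. emeasure \<nu> (Pi\<^sub>E I (\<lambda>_. {- real r..real r})) < \<infinity>"
    and A: "A \<in> sets (\<Pi>\<^sub>M i\<in>I. lborel)"
  shows "emeasure \<nu> A = emeasure \<nu> (Pi\<^sub>E I (\<lambda>_. {0..<1})) * emeasure (\<Pi>\<^sub>M i\<in>I. lborel) A"
proof -
  interpret product_sigma_finite "\<lambda>_::'i. lborel :: real measure" ..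
  define P where "P = (\<Pi>\<^sub>M i\<in>I. lborel :: real measure)"
  have sp: "space P = extensional I" "space \<nu> = extensional I"
    using sets_eq_imp_space_eq[OF sets] by (simp_all add: P_def space_PiM PiE_def)
  interpret P: sigma_finite_measure P
    unfolding P_def using fin by (rule sigma_finite)
  have [measurable_cong]: "sets \<nu> = sets (\<Pi>\<^sub>M i\<in>I. lborel)" "sets P = sets (\<Pi>\<^sub>M i\<in>I. lborel)"
    using sets by (simp_all add: P_def)
  interpret N: sigma_finite_measure \<nu>
  proof
    let ?F = "range (\<lambda>r::nat. Pi\<^sub>E I (\<lambda>_. {- real r..real r}))"
    have "\<exists>r::nat. x \<in> Pi\<^sub>E I (\<lambda>_. {- real r..real r})" if "x \<in> extensional I" for x
    proof -
      obtain r :: nat where r: "(\<Sum>i\<in>I. \<bar>x i\<bar>) \<le> real r" using real_arch_simple by blast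
      have "\<bar>x i\<bar> \<le> real r" if "i \<in> I" for i
        using member_le_sum[of i I "\<lambda>i. \<bar>x i\<bar>"] r that fin by fastforce
      then have "x \<in> Pi\<^sub>E I (\<lambda>_. {- real r..real r})"
        using that by (auto simp: PiE_iff abs_le_iff minus_le_iff)
      then show ?thesis ..
    qed
    then have "\<Union>?F = space \<nu>"
      by (auto simp: sp PiE_def)
    moreover have "?F \<subseteq> sets \<nu>"
      using fin by (auto simp: sets intro!: sets_PiM_I_finite)
    moreover have "\<forall>a\<in>?F. emeasure \<nu> a \<noteq> \<infinity>"
      using bd by (auto simp: less_top)
    ultimately show "\<exists>A. countable A \<and> A \<subseteq> sets \<nu> \<and> \<Union> A = space \<nu> \<and> (\<forall>a\<in>A. emeasure \<nu> a \<noteq> \<infinity>)"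
      by (intro exI[of _ ?F]) auto
  qed
  interpret PN: pair_sigma_finite \<nu> P ..
  have tP: "(\<integral>\<^sup>+y. f (\<lambda>i\<in>I. y i + a i) \<partial>P) = integral\<^sup>N P f" if "f \<in> borel_measurable P" for f a
  proof -
    have "integral\<^sup>N P f = integral\<^sup>N (distr P P (\<lambda>x. \<lambda>i\<in>I. x i + a i)) f"
      unfolding P_def by (simp add: PiM_lborel_translation[OF fin])
    also have "\<dots> = (\<integral>\<^sup>+y. f (\<lambda>i\<in>I. y i + a i) \<partial>P)"
      using that by (intro nn_integral_distr) (auto simp: P_def)
    finally show ?thesis by simp
  qed
  have tN: "(\<integral>\<^sup>+y. f (\<lambda>i\<in>I. y i + a i) \<partial>\<nu>) = integral\<^sup>N \<nu> f" if [measurable]: "f \<in> borel_measurable P" for f a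
  proof -
    have "integral\<^sup>N \<nu> f = integral\<^sup>N (distr \<nu> P (\<lambda>x. \<lambda>i\<in>I. x i + a i)) f"
      unfolding P_def by (simp add: inv)
    also have "\<dots> = (\<integral>\<^sup>+y. f (\<lambda>i\<in>I. y i + a i) \<partial>\<nu>)"
      by (intro nn_integral_distr) (auto simp: P_def)
    finally show ?thesis by simp
  qed
  let ?neg = "\<lambda>B. (\<lambda>x. \<lambda>i\<in>I. - x i) -` B \<inter> space P"
  \<comment> \<open>Both sides equal the double integral over the condition that \<open>x\<close> is
    in \<open>A\<close> and \<open>y - x\<close> in \<open>B\<close>: integrating over
    \<open>y\<close> first gives the left side; shifting \<open>x\<close> by \<open>y\<close> under
    \<open>\<nu>\<close> and then integrating over \<open>y\<close> gives the right side.\<close>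
  have main: "emeasure \<nu> A * emeasure P B = emeasure \<nu> (?neg B) * emeasure P A"
    if [measurable]: "A \<in> sets P" "B \<in> sets P" for A B
  proof -
    have [measurable]: "?neg B \<in> sets P"
      by (intro measurable_sets[where A=P]) (auto simp: P_def intro!: that(2)[unfolded P_def])
    have [simp]: "A \<in> sets \<nu>" "?neg B \<in> sets \<nu>" using that \<open>?neg B \<in> sets P\<close> sets by (simp_all add: P_def)
    have "emeasure \<nu> A * emeasure P B = (\<integral>\<^sup>+x. indicator A x * emeasure P B \<partial>\<nu>)"
      by (simp add: nn_integral_multc)
    also have "\<dots> = (\<integral>\<^sup>+x. \<integral>\<^sup>+y. indicator A x * indicator B (\<lambda>i\<in>I. y i - x i) \<partial>P \<partial>\<nu>)"
    proof (rule nn_integral_cong)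
      fix x
      have "(\<integral>\<^sup>+y. indicator B (\<lambda>i\<in>I. y i - x i) \<partial>P) = emeasure P B"
        using tP[of "indicator B" "\<lambda>i. - x i"] by simp
      then show "indicator A x * emeasure P B = (\<integral>\<^sup>+y. indicator A x * indicator B (\<lambda>i\<in>I. y i - x i) \<partial>P)"
        by (subst nn_integral_cmult) auto
    qed
    also have "\<dots> = (\<integral>\<^sup>+y. \<integral>\<^sup>+x. indicator A x * indicator B (\<lambda>i\<in>I. y i - x i) \<partial>\<nu> \<partial>P)"
      by (rule PN.Fubini'[symmetric]) measurable
    also have "\<dots> = (\<integral>\<^sup>+y. \<integral>\<^sup>+x. indicator A (\<lambda>i\<in>I. x i + y i) * indicator B (\<lambda>i\<in>I. - x i) \<partial>\<nu> \<partial>P)"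
    proof (rule nn_integral_cong)
      fix y
      show "(\<integral>\<^sup>+x. indicator A x * indicator B (\<lambda>i\<in>I. y i - x i) \<partial>\<nu>) =
        (\<integral>\<^sup>+x. indicator A (\<lambda>i\<in>I. x i + y i) * indicator B (\<lambda>i\<in>I. - x i) \<partial>\<nu>)"
        (is "?l = ?r")
      proof -
        let ?g = "\<lambda>x. indicator A x * indicator B (\<lambda>i\<in>I. y i - x i) :: ennreal"
        have "?g \<in> borel_measurable P"
          by measurable
        then have "?l = (\<integral>\<^sup>+x. ?g (\<lambda>i\<in>I. x i + y i) \<partial>\<nu>)"
          using tN[of ?g y] by simp
        also have "\<dots> = ?r"
        proof (rule nn_integral_cong)
          fix x
          have "(\<lambda>i\<in>I. y i - (\<lambda>i\<in>I. x i + y i) i) = (\<lambda>i\<in>I. - x i)" by (rule restrict_ext) simp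
          then show "?g (\<lambda>i\<in>I. x i + y i) = indicator A (\<lambda>i\<in>I. x i + y i) * indicator B (\<lambda>i\<in>I. - x i)"
            by simp
        qed
        finally show ?thesis .
      qed
    qed
    also have "\<dots> = (\<integral>\<^sup>+x. \<integral>\<^sup>+y. indicator A (\<lambda>i\<in>I. x i + y i) * indicator B (\<lambda>i\<in>I. - x i) \<partial>P \<partial>\<nu>)"
      by (rule PN.Fubini') measurable
    also have "\<dots> = (\<integral>\<^sup>+x. emeasure P A * indicator (?neg B) x \<partial>\<nu>)"
    proof (rule nn_integral_cong)
      fix x assume "x \<in> space \<nu>"
      have "(\<integral>\<^sup>+y. indicator A (\<lambda>i\<in>I. x i + y i) \<partial>P) = emeasure P A"
        using tP[of "indicator A" x] by (simp add: add.commute)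
      then show "(\<integral>\<^sup>+y. indicator A (\<lambda>i\<in>I. x i + y i) * indicator B (\<lambda>i\<in>I. - x i) \<partial>P) =
          emeasure P A * indicator (?neg B) x"
        using \<open>x \<in> space \<nu>\<close> by (subst nn_integral_multc) (auto simp: indicator_def sp)
    qed
    also have "\<dots> = emeasure P A * emeasure \<nu> (?neg B)"
      by (subst nn_integral_cmult) auto
    finally show ?thesis by (simp add: mult.commute)
  qed
  let ?C = "Pi\<^sub>E I (\<lambda>_. {0..<1::real})"
  have C: "?C \<in> sets P" "emeasure P ?C = 1"
    using fin by (simp_all add: P_def sets_PiM_I_finite emeasure_PiM)
  have "emeasure \<nu> ?C = emeasure \<nu> (?neg ?C)"
    using main[of ?C ?C] C by simp
  then show ?thesis
    using main[of A ?C] C A by (simp add: P_def)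
qed

section \<open>Coordinates and parallelotopes of an independent set\<close>

definition comb :: "'v::real_vector set \<Rightarrow> ('v \<Rightarrow> real) \<Rightarrow> 'v" where
  "comb B l = (\<Sum>v\<in>B. l v *\<^sub>R v)"

definition para :: "'v::real_vector set \<Rightarrow> 'v set" where
  "para B = comb B ` (Pi\<^sub>E B (\<lambda>_. {0..<1}))"

lemma comb_add: "comb B (\<lambda>v. l v + m v) = comb B l + comb B m"
  by (simp add: comb_def scaleR_left_distrib sum.distrib)

lemma comb_restrict [simp]: "comb B (restrict l B) = comb B l"
  by (simp add: comb_def)

lemma comb_in_span: "comb B l \<in> span B"
  unfolding comb_def by (intro span_sum span_scale span_base)

lemma comb_in_subspace: "subspace W \<Longrightarrow> B \<subseteq> W \<Longrightarrow> comb B l \<in> W"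
  unfolding comb_def by (intro subspace_sum subspace_scale) auto

text \<open>The coordinate functionals are extended to the whole space, where linear functionals are
  measurable; the last clause exhibits \<open>span B\<close> as the kernel of a linear map, hence as
  a measurable set.\<close>

lemma dual_coordinates:
  fixes B :: "'v::real_vector set"
  assumes B: "finite B" "independent B"
  obtains \<psi> :: "'v \<Rightarrow> 'v \<Rightarrow> real" where "\<And>v. linear (\<psi> v)" "\<And>l v. v \<in> B \<Longrightarrow> \<psi> v (comb B l) = l v"
    "\<And>z. z \<in> span B \<longleftrightarrow> comb B (\<lambda>v. \<psi> v z) = z"
proof -
  have "\<exists>g. linear g \<and> (\<forall>u\<in>B. g u = (if u = v then 1 else 0 :: real))" for v
    using linear_independent_extend[OF B(2), of "\<lambda>u. if u = v then 1 else 0"] by simp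
  then obtain \<psi> where \<psi>: "linear (\<psi> v)" "\<forall>u\<in>B. \<psi> v u = (if u = v then 1 else 0 :: real)" for v
    by metis
  have 1: "\<psi> v (comb B l) = l v" if "v \<in> B" for l v
  proof -
    have "\<psi> v (comb B l) = (\<Sum>u\<in>B. l u * \<psi> v u)"
      by (simp add: comb_def linear_sum[OF \<psi>(1)] linear_scale[OF \<psi>(1)])
    also have "\<dots> = (\<Sum>u\<in>B. if u = v then l v else 0)"
      using \<psi>(2) by (intro sum.cong) auto
    finally show ?thesis using that B by simp
  qed
  have "comb B (\<lambda>v. \<psi> v z) = z" if z: "z \<in> span B" for z
  proof -
    obtain l where "z = comb B l"
      using z B by (auto simp: span_finite comb_def)
    then show ?thesis by (simp add: 1 comb_def[of _ "\<lambda>v. \<psi> v _"]) (simp add: comb_def)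
  qed
  moreover have "z \<in> span B" if "comb B (\<lambda>v. \<psi> v z) = z" for z
    using comb_in_span that by metis
  ultimately show ?thesis using that \<psi>(1) 1 by blast
qed

text \<open>Dividing the coordinates by positive factors turns translations into translations, so
  the image measure is a multiple of Lebesgue measure; the multiple is read off on the unit cube,
  whose preimage is a box with sides \<open>s i\<close>.\<close>

lemma PiM_lborel_scale:
  fixes s :: "'i \<Rightarrow> real"
  assumes fin: "finite I" and s: "\<And>i. i \<in> I \<Longrightarrow> s i > 0" and A: "A \<in> sets (\<Pi>\<^sub>M i\<in>I. lborel)"
  shows "emeasure (\<Pi>\<^sub>M i\<in>I. lborel) {x \<in> space (\<Pi>\<^sub>M i\<in>I. lborel). (\<lambda>i\<in>I. x i / s i) \<in> A} =
    ennreal (\<Prod>i\<in>I. s i) * emeasure (\<Pi>\<^sub>M i\<in>I. lborel) A"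
proof -
  interpret product_sigma_finite "\<lambda>_::'i. lborel :: real measure" ..
  define P where "P = (\<Pi>\<^sub>M i\<in>I. lborel :: real measure)"
  define d where "d = (\<lambda>x. \<lambda>i\<in>I. x i / s i)"
  have sp: "space P = extensional I" by (simp add: P_def space_PiM PiE_def)
  have [measurable]: "d \<in> P \<rightarrow>\<^sub>M P" unfolding d_def P_def by measurable
  define \<nu> where "\<nu> = distr P P d"
  have ev: "emeasure \<nu> X = emeasure P {x \<in> space P. d x \<in> X}" if "X \<in> sets P" for X
    using that by (simp add: \<nu>_def emeasure_distr vimage_def Int_def conj_commute)
  have inv: "distr \<nu> P (\<lambda>x. \<lambda>i\<in>I. x i + a i) = \<nu>" for a
  proof -
    have [measurable]: "(\<lambda>x. \<lambda>i\<in>I. x i + a i) \<in> P \<rightarrow>\<^sub>M P" "(\<lambda>x. \<lambda>i\<in>I. x i + s i * a i) \<in> P \<rightarrow>\<^sub>M P"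
      unfolding P_def by measurable
    have "distr \<nu> P (\<lambda>x. \<lambda>i\<in>I. x i + a i) = distr P P ((\<lambda>x. \<lambda>i\<in>I. x i + a i) \<circ> d)"
      unfolding \<nu>_def by (rule distr_distr) measurable
    also have "\<dots> = distr P P (d \<circ> (\<lambda>x. \<lambda>i\<in>I. x i + s i * a i))"
    proof (rule distr_cong)
      fix x
      have "x i / s i + a i = (x i + s i * a i) / s i" if "i \<in> I" for i
        using s[OF that] by (simp add: field_simps)
      then show "((\<lambda>x. \<lambda>i\<in>I. x i + a i) \<circ> d) x = (d \<circ> (\<lambda>x. \<lambda>i\<in>I. x i + s i * a i)) x"
        by (auto simp: d_def fun_eq_iff)
    qed auto
    also have "\<dots> = distr (distr P P (\<lambda>x. \<lambda>i\<in>I. x i + s i * a i)) P d"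
      by (rule distr_distr[symmetric]) measurable
    also have "distr P P (\<lambda>x. \<lambda>i\<in>I. x i + s i * a i) = P"
      unfolding P_def by (rule PiM_lborel_translation[OF fin])
    finally show ?thesis unfolding \<nu>_def .
  qed
  have box: "{x \<in> space P. d x \<in> Pi\<^sub>E I (\<lambda>_. J)} = Pi\<^sub>E I (\<lambda>i. {y. y / s i \<in> J})" for J
    by (auto simp: sp d_def PiE_iff extensional_def)
  have ebox: "emeasure \<nu> (Pi\<^sub>E I (\<lambda>_. J)) = (\<Prod>i\<in>I. emeasure lborel {y. y / s i \<in> J})" if "J \<in> sets borel" for J
  proof -
    have [measurable]: "{y. y / s i \<in> J} \<in> sets borel" for i
      using that by measurable
    have "Pi\<^sub>E I (\<lambda>_. J) \<in> sets P" using that fin by (auto simp: P_def intro!: sets_PiM_I_finite)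
    then show ?thesis
      unfolding ev box by (simp add: ev box) (simp add: P_def emeasure_PiM fin)
  qed
  have "emeasure \<nu> (Pi\<^sub>E I (\<lambda>_. {0..<1})) = (\<Prod>i\<in>I. ennreal (s i))"
  proof -
    have "emeasure lborel {y. y / s i \<in> {0..<1}} = ennreal (s i)" if "i \<in> I" for i
    proof -
      have "{y. y / s i \<in> {0..<1}} = {0..<s i}" using s[OF that] by (auto simp: field_simps)
      then show ?thesis using s[OF that] by simp
    qed
    then show ?thesis by (subst ebox) auto
  qed
  moreover have "emeasure \<nu> (Pi\<^sub>E I (\<lambda>_. {- real r..real r})) < \<infinity>" for r
  proof -
    have "emeasure lborel {y. y / s i \<in> {- real r..real r}} < \<infinity>" if "i \<in> I" for i
    proof -
      have "{y. y / s i \<in> {- real r..real r}} = {- (real r * s i)..real r * s i}"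
        using s[OF that] by (auto simp: field_simps)
      then show ?thesis by (simp add: emeasure_lborel_Icc_eq)
    qed
    then show ?thesis unfolding ebox[OF borel_closed[OF closed_atLeastAtMost]] by (simp add: less_top[symmetric] ennreal_prod_eq_top)
  qed
  moreover have "sets \<nu> = sets P" by (simp add: \<nu>_def)
  ultimately have "emeasure \<nu> A = (\<Prod>i\<in>I. ennreal (s i)) * emeasure P A"
    using translation_invariant_unique[OF fin, of \<nu> A] inv A by (simp add: P_def)
  then show ?thesis using ev[of A] A s by (simp add: P_def d_def prod_ennreal less_imp_le)
qed

text \<open>The common ground of Lebesgue measure on \<open>real ^ 'n\<close> and of
  \<open>volM p\<close>, which lives on an infinite-dimensional space and is invariant only under
  translations by the subspace \<open>W\<close>. The assumption \<open>finite_box\<close> is local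
  finiteness on finite-dimensional pieces, stated without a topology.\<close>

locale translation_invariant =
  fixes M :: "'v::real_vector measure" and W :: "'v set"
  assumes space_M [simp]: "space M = UNIV"
    and subspace_W: "subspace W"
    and finite_dim: "\<exists>B. finite B \<and> W \<subseteq> span B"
    and functional_measurable: "linear (f :: 'v \<Rightarrow> real) \<Longrightarrow> f \<in> borel_measurable M"
    and kernel_measurable: "linear T \<Longrightarrow> {z. T z = (0::'v)} \<in> sets M"
    and comb_measurable: "finite B \<Longrightarrow> B \<subseteq> W \<Longrightarrow> comb B \<in> Pi\<^sub>M B (\<lambda>_. lborel) \<rightarrow>\<^sub>M M"
    and translate_measurable: "a \<in> W \<Longrightarrow> (+) a \<in> M \<rightarrow>\<^sub>M M"
    and translate_distr: "a \<in> W \<Longrightarrow> distr M M ((+) a) = M"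
    and finite_box: "finite B \<Longrightarrow> B \<subseteq> W \<Longrightarrow>
      \<exists>D\<in>sets M. emeasure M D < \<infinity> \<and> (\<forall>l. (\<forall>v\<in>B. \<bar>l v\<bar> \<le> r) \<longrightarrow> comb B l \<in> D)"
begin

lemma translate:
  assumes A: "A \<in> sets M" and a: "a \<in> W"
  shows "(+) a ` A \<in> sets M" "emeasure M ((+) a ` A) = emeasure M A"
proof -
  have a': "- a \<in> W" using a subspace_W by (simp add: subspace_neg)
  have eq: "(+) a ` A = (+) (-a) -` A \<inter> space M"
    by (force simp: image_iff)
  show "(+) a ` A \<in> sets M"
    unfolding eq by (rule measurable_sets[OF translate_measurable[OF a'] A])
  have "emeasure M A = emeasure (distr M M ((+) (-a))) A"
    by (simp add: translate_distr[OF a'])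
  also have "\<dots> = emeasure M ((+) a ` A)"
    unfolding eq by (rule emeasure_distr[OF translate_measurable[OF a'] A])
  finally show "emeasure M ((+) a ` A) = emeasure M A" by simp
qed

text \<open>Pulled back to coordinates along \<open>comb B\<close>, the restriction of
  \<open>M\<close> to \<open>span B\<close> is translation invariant, so
  \<open>translation_invariant_unique\<close> applies, with \<open>para B\<close> as the image of
  the unit cube. When \<open>B\<close> does not span \<open>W\<close>, the factor is 0; this is
  exploited in \<open>emeasure_span_null\<close>.\<close>

lemma
  assumes B: "finite B" "independent B" "B \<subseteq> W"
    and A: "A \<in> sets (\<Pi>\<^sub>M v\<in>B. lborel)"
  shows comb_image_measurable: "comb B ` A \<in> sets M"
    and emeasure_comb_image: "emeasure M (comb B ` A) = emeasure M (para B) * emeasure (\<Pi>\<^sub>M v\<in>B. lborel) A"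
    and emeasure_para_finite: "emeasure M (para B) < \<infinity>"
proof -
  obtain \<psi> where \<psi>: "\<And>v. linear (\<psi> v)" "\<And>l v. v \<in> B \<Longrightarrow> \<psi> v (comb B l) = l v"
    "\<And>z. z \<in> span B \<longleftrightarrow> comb B (\<lambda>v. \<psi> v z) = z"
    using dual_coordinates[OF B(1,2)] by metis
  define P where "P = (\<Pi>\<^sub>M v\<in>B. lborel :: real measure)"
  have sp: "space P = extensional B" by (simp add: P_def space_PiM PiE_def)
  define c where "c = (\<lambda>z. \<lambda>v\<in>B. \<psi> v z)"
  have c[measurable]: "c \<in> M \<rightarrow>\<^sub>M P"
    unfolding c_def P_def by (intro measurable_restrict) (simp add: functional_measurable[OF \<psi>(1)])
  have spanm[measurable]: "span B \<in> sets M"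
  proof -
    have "linear (\<lambda>z. comb B (\<lambda>v. \<psi> v z) - z)"
      unfolding comb_def
      by (intro linear_compose_sub linear_compose_sum ballI linear_compose[OF \<psi>(1), unfolded o_def]
            linear_scaleR_left linear_ident)
    moreover have "{z. comb B (\<lambda>v. \<psi> v z) - z = 0} = span B"
      using \<psi>(3) by auto
    ultimately show ?thesis using kernel_measurable by fastforce
  qed
  \<comment> \<open>Images under \<open>comb B\<close> become preimages under the coordinate map
    \<open>c\<close> within \<open>span B\<close>; this makes them measurable.\<close>
  have img: "comb B ` X = c -` X \<inter> span B" if "X \<subseteq> extensional B" for X
  proof (intro equalityI subsetI)
    fix z assume "z \<in> comb B ` X"
    then obtain l where l: "l \<in> X" "z = comb B l" by blast
    then have "c z = l" using that by (auto simp: c_def \<psi>(2) extensional_def fun_eq_iff subset_iff)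
    then show "z \<in> c -` X \<inter> span B" using l comb_in_span by auto
  next
    fix z assume "z \<in> c -` X \<inter> span B"
    then have z: "c z \<in> X" "z \<in> span B" by auto
    then have "z = comb B (c z)" using \<psi>(3) by (simp add: c_def)
    then show "z \<in> comb B ` X" using z(1) by blast
  qed
  have ext: "X \<subseteq> extensional B" if "X \<in> sets P" for X
    using sets.sets_into_space[OF that] sp by simp
  have imgm: "comb B ` X \<in> sets M" if [measurable]: "X \<in> sets P" for X
  proof -
    have "c -` X \<inter> space M \<in> sets M" by measurable
    then show ?thesis unfolding img[OF ext[OF that]] using spanm by simp
  qed
  then show "comb B ` A \<in> sets M" using A by (simp add: P_def)
  define \<nu> where "\<nu> = distr (restrict_space M (span B)) P c"
  have ev: "emeasure \<nu> X = emeasure M (comb B ` X)" if [measurable]: "X \<in> sets P" for X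
  proof -
    have "emeasure \<nu> X = emeasure (restrict_space M (span B)) (c -` X \<inter> space (restrict_space M (span B)))"
      unfolding \<nu>_def using that by (intro emeasure_distr measurable_restrict_space1) measurable
    also have "\<dots> = emeasure M (c -` X \<inter> space (restrict_space M (span B)))"
      by (rule emeasure_restrict_space) (auto simp: space_restrict_space)
    finally show ?thesis using img[OF ext[OF that]] by (simp add: space_restrict_space)
  qed
  have inv: "distr \<nu> P (\<lambda>x. \<lambda>i\<in>B. x i + a i) = \<nu>" for a
  proof (rule measure_eqI)
    show "sets (distr \<nu> P (\<lambda>x. \<lambda>i\<in>B. x i + a i)) = sets \<nu>" by (simp add: \<nu>_def)
    fix X assume "X \<in> sets (distr \<nu> P (\<lambda>x. \<lambda>i\<in>B. x i + a i))"
    then have X[measurable]: "X \<in> sets P" by simp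
    let ?t = "\<lambda>x. \<lambda>i\<in>B. x i + a i"
    have [measurable]: "?t \<in> P \<rightarrow>\<^sub>M P" unfolding P_def by measurable
    have [measurable]: "?t \<in> \<nu> \<rightarrow>\<^sub>M P" by (simp add: \<nu>_def)
    have "emeasure (distr \<nu> P ?t) X = emeasure \<nu> (?t -` X \<inter> space \<nu>)"
      by (rule emeasure_distr) measurable
    also have "\<dots> = emeasure M (comb B ` (?t -` X \<inter> space P))"
      by (subst ev[symmetric]) (auto simp: \<nu>_def)
    also have "\<dots> = emeasure M ((+) (comb B a) ` (comb B ` (?t -` X \<inter> space P)))"
      using translate(2)[OF imgm comb_in_subspace[OF subspace_W B(3)]] by simp
    also have "(+) (comb B a) ` (comb B ` (?t -` X \<inter> space P)) = comb B ` X"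
    proof -
      have "(+) (comb B a) ` (comb B ` (?t -` X \<inter> space P)) = comb B ` (?t ` (?t -` X \<inter> space P))"
        by (simp add: image_image comb_add add.commute)
      also have "?t ` (?t -` X \<inter> space P) = X"
      proof safe
        fix x assume "x \<in> X"
        then have "x = ?t (\<lambda>i\<in>B. x i - a i)"
          using ext[OF X] by (auto simp: fun_eq_iff extensional_def)
        with \<open>x \<in> X\<close> show "x \<in> ?t ` (?t -` X \<inter> space P)"
          by (intro image_eqI[where x="\<lambda>i\<in>B. x i - a i"]) (auto simp: sp)
      qed
      finally show ?thesis .
    qed
    also have "emeasure M (comb B ` X) = emeasure \<nu> X" by (simp add: ev)
    finally show "emeasure (distr \<nu> P ?t) X = emeasure \<nu> X" .
  qed
  have boxm: "Pi\<^sub>E B (\<lambda>_. J) \<in> sets P" if "J \<in> sets borel" for J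
    using that B(1) by (auto simp: P_def intro!: sets_PiM_I_finite)
  have fin: "emeasure \<nu> (Pi\<^sub>E B (\<lambda>_. {- real r..real r})) < \<infinity>" for r
  proof -
    obtain D where D: "D \<in> sets M" "emeasure M D < \<infinity>" "\<forall>l. (\<forall>v\<in>B. \<bar>l v\<bar> \<le> real r) \<longrightarrow> comb B l \<in> D"
      using finite_box[OF B(1,3)] by blast
    have "emeasure \<nu> (Pi\<^sub>E B (\<lambda>_. {- real r..real r})) \<le> emeasure M D"
      using D(1,3) by (subst ev[OF boxm]) (auto simp: PiE_iff abs_le_iff minus_le_iff intro!: emeasure_mono)
    then show ?thesis using D(2) by order
  qed
  have box1: "emeasure \<nu> (Pi\<^sub>E B (\<lambda>_. {0..<1})) = emeasure M (para B)"
    by (simp add: ev boxm para_def)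
  have "sets \<nu> = sets P" by (simp add: \<nu>_def)
  then have "emeasure \<nu> A = emeasure \<nu> (Pi\<^sub>E B (\<lambda>_. {0..<1})) * emeasure P A"
    using translation_invariant_unique[OF B(1), of \<nu> A] inv fin A by (simp add: P_def)
  then show "emeasure M (comb B ` A) = emeasure M (para B) * emeasure (\<Pi>\<^sub>M v\<in>B. lborel) A"
    using A by (simp add: ev box1 P_def)
  have "emeasure \<nu> (Pi\<^sub>E B (\<lambda>_. {0..<1})) \<le> emeasure \<nu> (Pi\<^sub>E B (\<lambda>_. {- real 1..real 1}))"
    using boxm by (intro emeasure_mono) (auto simp: \<nu>_def intro!: PiE_mono)
  with fin[of 1] box1 show "emeasure M (para B) < \<infinity>" by order
qed

lemma para_measurable: "finite B \<Longrightarrow> independent B \<Longrightarrow> B \<subseteq> W \<Longrightarrow> para B \<in> sets M"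
  unfolding para_def by (intro comb_image_measurable sets_PiM_I_finite) auto

lemma measure_comb_image:
  assumes "finite B" "independent B" "B \<subseteq> W" "A \<in> sets (\<Pi>\<^sub>M v\<in>B. lborel)"
  shows "measure M (comb B ` A) = measure M (para B) * measure (\<Pi>\<^sub>M v\<in>B. lborel) A"
  by (simp add: measure_def emeasure_comb_image[OF assms] enn2real_mult)

text \<open>The translates of \<open>para B\<close> by the multiples \<open>1 / (k + 1)\<close> of a
  direction \<open>e\<close> outside \<open>span B\<close> are disjoint and stay inside one set of
  finite measure. So \<open>para B\<close> has measure 0, and with it the whole span.\<close>

lemma emeasure_span_null:
  assumes B: "finite B" "independent B" "B \<subseteq> W" and ne: "span B \<noteq> W"
  shows "span B \<in> null_sets M"
proof -
  have "span B \<subseteq> W" using B(3) subspace_W by (simp add: span_minimal)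
  with ne obtain e where e: "e \<in> W" "e \<notin> span B" by blast
  obtain D where D: "D \<in> sets M" "emeasure M D < \<infinity>"
      "\<forall>l. (\<forall>v\<in>insert e B. \<bar>l v\<bar> \<le> 1) \<longrightarrow> comb (insert e B) l \<in> D"
    using finite_box[of "insert e B" 1] B e by blast
  have eB: "e \<notin> B" using e span_base by blast
  define C where "C k = (+) ((1 / real (Suc k)) *\<^sub>R e) ` para B" for k
  have ke: "(1 / real (Suc k)) *\<^sub>R e \<in> W" for k using e subspace_W by (simp add: subspace_scale)
  have pm: "para B \<in> sets M" by (rule para_measurable[OF B])
  have Cm: "C k \<in> sets M" "emeasure M (C k) = emeasure M (para B)" for k
    unfolding C_def using translate[OF pm ke] by auto
  have "disjoint_family C"
    unfolding disjoint_family_on_def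
  proof (intro ballI impI)
    fix m k :: nat assume "m \<noteq> k"
    show "C m \<inter> C k = {}"
    proof (rule ccontr)
      assume "C m \<inter> C k \<noteq> {}"
      then obtain l l' where eq: "(1 / real (Suc m)) *\<^sub>R e + comb B l = (1 / real (Suc k)) *\<^sub>R e + comb B l'"
        by (auto simp: C_def para_def)
      define q where "q = 1 / real (Suc m) - 1 / real (Suc k)"
      have q: "q \<noteq> 0" using \<open>m \<noteq> k\<close> by (simp add: q_def)
      have "q *\<^sub>R e = comb B l' - comb B l"
        using eq by (simp add: q_def algebra_simps)
      then have "q *\<^sub>R e \<in> span B" by (simp add: span_diff comb_in_span)
      then have "(1/q) *\<^sub>R (q *\<^sub>R e) \<in> span B" by (rule span_scale)
      then show False using q e by simp
    qed
  qed
  moreover have "(\<Union>k. C k) \<subseteq> D"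
  proof -
    have "(1 / real (Suc k)) *\<^sub>R e + comb B l \<in> D" if "l \<in> Pi\<^sub>E B (\<lambda>_. {0..<1})" for k l
    proof -
      let ?l = "l(e := 1 / real (Suc k))"
      have "comb B ?l = comb B l" unfolding comb_def by (rule sum.cong) (use eB in auto)
      then have "comb (insert e B) ?l = (1 / real (Suc k)) *\<^sub>R e + comb B l"
        using B(1) eB by (simp add: comb_def)
      moreover have "\<forall>v\<in>insert e B. \<bar>?l v\<bar> \<le> 1"
        using that eB by (auto simp: PiE_iff less_imp_le)
      ultimately show ?thesis using D(3) by metis
    qed
    then show ?thesis by (auto simp: C_def para_def)
  qed
  ultimately have le: "real m * measure M (para B) \<le> measure M D" for m
  proof -
    assume dj: "disjoint_family C" and sub: "(\<Union>k. C k) \<subseteq> D"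
    have "measure M (\<Union>k\<in>{..<m}. C k) = (\<Sum>k<m. measure M (C k))"
      using Cm emeasure_para_finite[OF B sets.empty_sets] dj
      by (intro measure_finite_Union) (auto simp: disjoint_family_on_def less_top[symmetric])
    also have "\<dots> = real m * measure M (para B)"
      using Cm by (simp add: measure_def)
    finally have "real m * measure M (para B) = measure M (\<Union>k\<in>{..<m}. C k)" by simp
    also have "\<dots> \<le> measure M D"
      using sub D Cm by (intro measure_mono_fmeasurable fmeasurableI) auto
    finally show ?thesis .
  qed
  have "measure M (para B) = 0"
  proof (rule ccontr)
    assume "measure M (para B) \<noteq> 0"
    then have "measure M (para B) > 0" by (simp add: less_le)
    then obtain m :: nat where "measure M D < real m * measure M (para B)"
      using reals_Archimedean3 by blast
    with le[of m] show False by simp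
  qed
  then have k0: "emeasure M (para B) = 0"
    using emeasure_para_finite[OF B sets.empty_sets] by (auto simp: measure_def enn2real_eq_0_iff)
  have full: "comb B ` (space (\<Pi>\<^sub>M v\<in>B. lborel)) = span B"
  proof -
    have "comb B l \<in> comb B ` extensional B" for l
      by (rule image_eqI[where x="restrict l B"]) auto
    then show ?thesis using B(1) by (auto simp: space_PiM PiE_def span_finite comb_in_span[unfolded span_finite[OF B(1)]])
       (auto simp: comb_def)
  qed
  \<comment> \<open>The coordinate space may have infinite measure, but 0 times infinity is 0 in the
    extended reals.\<close>
  show ?thesis
    using emeasure_comb_image[OF B sets.top] comb_image_measurable[OF B sets.top]
    by (auto simp: k0 full null_sets_def)
qed

end

section \<open>Lebesgue measure on families of vectors\<close>

declare One_nat_def [simp del]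

definition emb :: "nat \<Rightarrow> (nat \<Rightarrow> real ^ 'n) \<Rightarrow> (nat \<Rightarrow>\<^sub>0 real ^ 'n)" where
  "emb p w = (\<Sum>l=1..p. incl l (w l))"

definition families :: "nat \<Rightarrow> (nat \<Rightarrow>\<^sub>0 real ^ 'n) set" where
  "families p = {z. \<forall>l. l \<notin> {1..p} \<longrightarrow> Poly_Mapping.lookup z l = 0}"

abbreviation power_lborel :: "nat \<Rightarrow> (nat \<Rightarrow> real ^ 'n) measure" where
  "power_lborel p \<equiv> \<Pi>\<^sub>M l\<in>{1..p}. lborel"

text \<open>Lebesgue measure on \<open>families p\<close>, regarded as a measure on the ambient
  space that is carried by this subspace. The sigma-algebra is the largest one for which
  \<open>emb p\<close> is measurable, so a set is measurable iff its preimage is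
  (\<open>sets_volM_iff\<close>).\<close>

definition volM :: "nat \<Rightarrow> (nat \<Rightarrow>\<^sub>0 real ^ 'n) measure" where
  "volM p = distr (power_lborel p)
     (sigma UNIV {A. emb p -` A \<inter> space (power_lborel p) \<in> sets (power_lborel p)}) (emb p)"

lemma lookup_scaleR [simp]: "Poly_Mapping.lookup (r *\<^sub>R z) l = r *\<^sub>R Poly_Mapping.lookup z l"
  for z :: "'a \<Rightarrow>\<^sub>0 'b::real_vector"
  by (simp add: scaleR_poly_mapping_def Poly_Mapping.map.rep_eq when_def)

lemma lookup_sum: "Poly_Mapping.lookup (sum f I) l = (\<Sum>i\<in>I. Poly_Mapping.lookup (f i) l)"
  by (induction I rule: infinite_finite_induct) (simp_all add: lookup_add)

lemma lookup_incl: "Poly_Mapping.lookup (incl l x) k = (if k = l then x else 0)"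
  by (simp add: incl_def lookup_single when_def)

lemma lookup_emb [simp]: "Poly_Mapping.lookup (emb p w) l = (if l \<in> {1..p} then w l else 0)"
  by (simp add: emb_def lookup_sum lookup_incl)

lemma lookup_diag [simp]: "Poly_Mapping.lookup (diag p x) l = (if l \<in> {1..p} then x else 0)"
  by (simp add: diag_def lookup_sum lookup_incl)

lemma linear_incl: "linear (incl l)"
  by (rule linearI) (auto simp: incl_def single_add intro!: poly_mapping_eqI simp: lookup_single when_def)

lemma linear_diag: "linear (diag p)"
  unfolding diag_def[abs_def] by (intro linear_compose_sum ballI linear_incl)

lemma linear_lookup: "linear (\<lambda>z :: 'a \<Rightarrow>\<^sub>0 'b::real_vector. Poly_Mapping.lookup z l)"
  by (rule linearI) (simp_all add: lookup_add)

lemma emb_lookup: "z \<in> families p \<Longrightarrow> emb p (Poly_Mapping.lookup z) = z"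
  by (rule poly_mapping_eqI) (auto simp: families_def)

lemma emb_restrict [simp]: "emb p (restrict w {1..p}) = emb p w"
  by (simp add: emb_def)

lemma emb_in_families [simp]: "emb p w \<in> families p"
  by (simp add: families_def)

lemma subspace_families: "subspace (families p)"
  by (auto simp: subspace_def families_def lookup_add)

lemma space_power_lborel: "space (power_lborel p) = extensional {1..p}"
  by (simp add: space_PiM PiE_def)

lemma sets_volM_iff:
  fixes A :: "(nat \<Rightarrow>\<^sub>0 real ^ 'n) set"
  shows "A \<in> sets (volM p) \<longleftrightarrow> emb p -` A \<inter> space (power_lborel p) \<in> sets (power_lborel p)"
  (is "_ \<longleftrightarrow> ?P A")
proof -
  have "sigma_algebra UNIV {A. ?P A}"
    unfolding sigma_algebra_iff2
  proof (intro conjI ballI allI impI)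
    fix A assume "A \<in> {A. ?P A}"
    then have "space (power_lborel p) - (emb p -` A \<inter> space (power_lborel p)) \<in> sets (power_lborel p)" by blast
    moreover have "space (power_lborel p) - (emb p -` A \<inter> space (power_lborel p)) = emb p -` (UNIV - A) \<inter> space (power_lborel p)"
      by auto
    ultimately show "UNIV - A \<in> {A. ?P A}" by simp
  next
    fix A :: "nat \<Rightarrow> (nat \<Rightarrow>\<^sub>0 real ^ 'n) set"
    assume "range A \<subseteq> {A. ?P A}"
    then have "(\<Union>i. emb p -` A i \<inter> space (power_lborel p)) \<in> sets (power_lborel p)" by blast
    then show "(\<Union>i. A i) \<in> {A. ?P A}" by (simp add: vimage_UN)
  qed auto
  then show ?thesis
    by (simp add: volM_def sigma_algebra.sigma_sets_eq)
qed

lemma space_volM [simp]: "space (volM p) = UNIV"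
  by (simp add: volM_def space_measure_of_conv)

lemma emb_measurable: "emb p \<in> power_lborel p \<rightarrow>\<^sub>M volM p"
  by (rule measurableI) (simp_all add: sets_volM_iff)

lemma measurable_volM_iff: "space N = UNIV \<Longrightarrow> f \<in> volM p \<rightarrow>\<^sub>M N \<longleftrightarrow> (\<lambda>w. f (emb p w)) \<in> power_lborel p \<rightarrow>\<^sub>M N"
  unfolding measurable_def by (simp add: sets_volM_iff vimage_def Int_def)

lemma emeasure_volM:
  "A \<in> sets (volM p) \<Longrightarrow> emeasure (volM p) A = emeasure (power_lborel p) (emb p -` A \<inter> space (power_lborel p))"
  using emb_measurable[of p] unfolding volM_def measurable_distr_eq2 sets_distr by (rule emeasure_distr)

lemma vimage_emb: "A \<subseteq> families p \<Longrightarrow>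
  (\<lambda>f. restrict (Poly_Mapping.lookup f) {1..p}) ` A = emb p -` A \<inter> space (power_lborel p)"
proof (intro equalityI subsetI)
  fix w assume A: "A \<subseteq> families p" and "w \<in> (\<lambda>f. restrict (Poly_Mapping.lookup f) {1..p}) ` A"
  then obtain f where f: "f \<in> A" "w = restrict (Poly_Mapping.lookup f) {1..p}" by blast
  then show "w \<in> emb p -` A \<inter> space (power_lborel p)"
    using emb_lookup[of f p] A by (auto simp: space_power_lborel)
next
  fix w assume "w \<in> emb p -` A \<inter> space (power_lborel p)"
  then have w: "emb p w \<in> A" "w \<in> extensional {1..p}" by (auto simp: space_power_lborel)
  have "w = restrict (Poly_Mapping.lookup (emb p w)) {1..p}"
    using w(2) by (auto simp: fun_eq_iff extensional_def)
  then show "w \<in> (\<lambda>f. restrict (Poly_Mapping.lookup f) {1..p}) ` A" using w(1) by blast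
qed

text \<open>From here on \<open>vol\<close> is replaced by \<open>volM\<close>, to which the results
  on translation-invariant measures apply.\<close>

lemma vol_eq: "A \<in> sets (volM p) \<Longrightarrow> A \<subseteq> families p \<Longrightarrow> vol p A = measure (volM p) A"
  by (simp add: vol_def vimage_emb measure_def emeasure_volM)

lemma measurable_linear_real:
  fixes f :: "real ^ 'n \<Rightarrow> 'b::euclidean_space"
  assumes "linear f" shows "f \<in> borel_measurable borel"
  using assms by (intro borel_measurable_continuous_onI linear_continuous_on) (simp add: linear_conv_bounded_linear)

lemma linear_emb_measurable:
  fixes f :: "(nat \<Rightarrow>\<^sub>0 real ^ 'n) \<Rightarrow> 'b::euclidean_space"
  assumes "linear f" shows "(\<lambda>w. f (emb p w)) \<in> borel_measurable (power_lborel p)"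
proof -
  have "f (emb p w) = (\<Sum>l=1..p. f (incl l (w l)))" for w
    by (simp add: emb_def linear_sum[OF assms])
  moreover have "(\<lambda>x. f (incl l x)) \<in> borel_measurable borel" for l
    using linear_compose[OF linear_incl assms] by (intro measurable_linear_real) (simp add: o_def)
  then have "(\<lambda>w. f (incl l (w l))) \<in> borel_measurable (power_lborel p)" if "l \<in> {1..p}" for l
    using that by measurable
  ultimately show ?thesis by (simp only:) (intro borel_measurable_sum)
qed

text \<open>Translations by vectors outside \<open>families p\<close> are excluded because they move
  the range of \<open>emb p\<close> off itself.\<close>

interpretation volM: translation_invariant "volM p :: (nat \<Rightarrow>\<^sub>0 real ^ 'n) measure" "families p"
proof
  show "subspace (families p :: (nat \<Rightarrow>\<^sub>0 real ^ 'n) set)" by (rule subspace_families)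
  show "space (volM p :: (nat \<Rightarrow>\<^sub>0 real ^ 'n) measure) = UNIV" by simp
  have "z \<in> span (\<Union>l\<in>{1..p}. incl l ` Basis)" if "z \<in> families p" for z :: "nat \<Rightarrow>\<^sub>0 real ^ 'n"
  proof -
    have "incl l x \<in> span (incl l ` Basis)" for l and x :: "real ^ 'n"
      using span_linear_image[OF linear_incl[of l], of "Basis :: (real ^ 'n) set"] by simp
    then have "incl l x \<in> span (\<Union>l\<in>{1..p}. incl l ` Basis)" if "l \<in> {1..p}" for l and x :: "real ^ 'n"
      using span_mono[of "incl l ` Basis" "\<Union>l\<in>{1..p}. incl l ` (Basis :: (real ^ 'n) set)"] that by blast
    then have "emb p (Poly_Mapping.lookup z) \<in> span (\<Union>l\<in>{1..p}. incl l ` Basis)"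
      unfolding emb_def by (intro span_sum)
    then show ?thesis using emb_lookup[OF that] by simp
  qed
  then show "\<exists>B. finite B \<and> (families p :: (nat \<Rightarrow>\<^sub>0 real ^ 'n) set) \<subseteq> span B"
    by (intro exI[of _ "\<Union>l\<in>{1..p}. incl l ` Basis"]) auto
next
  fix f :: "(nat \<Rightarrow>\<^sub>0 real ^ 'n) \<Rightarrow> real" assume "linear f"
  then show "f \<in> borel_measurable (volM p)"
    by (subst measurable_volM_iff) (auto intro: linear_emb_measurable)
next
  fix T :: "(nat \<Rightarrow>\<^sub>0 real ^ 'n) \<Rightarrow> (nat \<Rightarrow>\<^sub>0 real ^ 'n)" assume T: "linear T"
  have [measurable]: "(\<lambda>w. Poly_Mapping.lookup (T (emb p w)) k) \<in> borel_measurable (power_lborel p)" for k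
    using linear_compose[OF T linear_lookup[of k]] by (intro linear_emb_measurable) (simp add: o_def)
  have "{w \<in> space (power_lborel p). \<forall>k. Poly_Mapping.lookup (T (emb p w)) k = 0} \<in> sets (power_lborel p)"
    by measurable
  moreover have "T (emb p w) = 0 \<longleftrightarrow> (\<forall>k. Poly_Mapping.lookup (T (emb p w)) k = 0)" for w
    by (metis lookup_zero poly_mapping_eqI)
  ultimately show "{z. T z = 0} \<in> sets (volM p)"
    by (simp add: sets_volM_iff vimage_def Int_def conj_commute)
next
  fix B :: "(nat \<Rightarrow>\<^sub>0 real ^ 'n) set" assume B: "finite B" "B \<subseteq> families p"
  have eq: "comb B l = emb p (\<lambda>k\<in>{1..p}. \<Sum>v\<in>B. l v *\<^sub>R Poly_Mapping.lookup v k)" for l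
    using B by (intro poly_mapping_eqI) (auto simp: comb_def lookup_sum families_def subset_iff intro!: sum.neutral)
  have "(\<lambda>l. \<lambda>k\<in>{1..p}. \<Sum>v\<in>B. l v *\<^sub>R Poly_Mapping.lookup v k) \<in> (\<Pi>\<^sub>M v\<in>B. lborel) \<rightarrow>\<^sub>M power_lborel p"
    by measurable
  from measurable_compose[OF this emb_measurable]
  show "comb B \<in> (\<Pi>\<^sub>M v\<in>B. lborel) \<rightarrow>\<^sub>M volM p"
    unfolding eq[symmetric] .
next
  fix a :: "nat \<Rightarrow>\<^sub>0 real ^ 'n" assume a: "a \<in> families p"
  let ?s = "\<lambda>w. \<lambda>l\<in>{1..p}. w l + Poly_Mapping.lookup a l"
  have eq: "a + emb p w = emb p (?s w)" for w
  proof (rule poly_mapping_eqI)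
    fix k show "Poly_Mapping.lookup (a + emb p w) k = Poly_Mapping.lookup (emb p (?s w)) k"
      using a by (cases "k \<in> {1..p}") (auto simp: families_def lookup_add)
  qed
  have "(\<lambda>w. \<lambda>l\<in>{1..p}. w l + c l) \<in> power_lborel p \<rightarrow>\<^sub>M power_lborel p" for c :: "nat \<Rightarrow> real ^ 'n"
    by measurable
  then have s: "?s \<in> power_lborel p \<rightarrow>\<^sub>M power_lborel p" .
  show m: "(+) a \<in> volM p \<rightarrow>\<^sub>M volM p"
    unfolding measurable_volM_iff[OF space_volM] eq using s emb_measurable by (rule measurable_compose)
  show "distr (volM p) (volM p) ((+) a) = volM p"
  proof (rule measure_eqI)
    fix A assume "A \<in> sets (distr (volM p) (volM p) ((+) a))"
    then have A: "A \<in> sets (volM p)" by simp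
    have A': "(+) a -` A \<in> sets (volM p)" using measurable_sets[OF m A] by simp
    have "emeasure (distr (volM p) (volM p) ((+) a)) A = emeasure (volM p) ((+) a -` A)"
      using emeasure_distr[OF m A] by simp
    also have "\<dots> = emeasure (power_lborel p) (emb p -` (+) a -` A \<inter> space (power_lborel p))"
      by (rule emeasure_volM[OF A'])
    also have "emb p -` (+) a -` A \<inter> space (power_lborel p) =
        ?s -` (emb p -` A \<inter> space (power_lborel p)) \<inter> space (power_lborel p)"
      by (auto simp: eq space_power_lborel simp del: emb_restrict)
    also have "emeasure (power_lborel p) \<dots> = emeasure (distr (power_lborel p) (power_lborel p) ?s) (emb p -` A \<inter> space (power_lborel p))"
      using A by (intro emeasure_distr[symmetric] s) (simp add: sets_volM_iff)
    also have "\<dots> = emeasure (power_lborel p) (emb p -` A \<inter> space (power_lborel p))"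
      by (simp add: PiM_lborel_translation)
    also have "\<dots> = emeasure (volM p) A" by (rule emeasure_volM[OF A, symmetric])
    finally show "emeasure (distr (volM p) (volM p) ((+) a)) A = emeasure (volM p) A" .
  qed simp
next
  fix B :: "(nat \<Rightarrow>\<^sub>0 real ^ 'n) set" and r :: real assume B: "finite B" "B \<subseteq> families p"
  define R where "R l = (\<Sum>v\<in>B. \<bar>r\<bar> * norm (Poly_Mapping.lookup v l))" for l
  define D where "D = {z :: nat \<Rightarrow>\<^sub>0 real ^ 'n. \<forall>l\<in>{1..p}. Poly_Mapping.lookup z l \<in> cball 0 (R l)}"
  have eq: "emb p -` D \<inter> space (power_lborel p) = Pi\<^sub>E {1..p} (\<lambda>l. cball 0 (R l))"
    by (auto simp: D_def space_power_lborel PiE_def)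
  have D: "D \<in> sets (volM p)"
    unfolding sets_volM_iff eq by (intro sets_PiM_I_finite) auto
  interpret product_sigma_finite "\<lambda>_::nat. lborel :: (real ^ 'n) measure" ..
  have "emeasure (volM p) D = (\<Prod>l\<in>{1..p}. emeasure lborel (cball (0 :: real ^ 'n) (R l)))"
    unfolding emeasure_volM[OF D] eq by (intro emeasure_PiM) auto
  also have "\<dots> < \<infinity>"
    using emeasure_bounded_finite[of "cball (0 :: real ^ 'n) _"]
    by (simp add: less_top[symmetric] ennreal_prod_eq_top)
  finally have "emeasure (volM p) D < \<infinity>" .
  moreover have "comb B l \<in> D" if l: "\<forall>v\<in>B. \<bar>l v\<bar> \<le> r" for l
  proof -
    have "norm (Poly_Mapping.lookup (comb B l) k) \<le> R k" for k
      unfolding comb_def R_def lookup_sum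
      using l by (intro sum_norm_le) (simp add: mult_right_mono order_trans[OF _ abs_ge_self])
    then show ?thesis by (simp add: D_def)
  qed
  ultimately show "\<exists>D\<in>sets (volM p). emeasure (volM p) D < \<infinity> \<and> (\<forall>l. (\<forall>v\<in>B. \<bar>l v\<bar> \<le> r) \<longrightarrow> comb B l \<in> D)"
    by (intro bexI[OF _ D] conjI allI impI)
qed

lemma bounded_linear_incl: "bounded_linear (incl l :: real ^ 'n \<Rightarrow> _)"
proof -
  have "norm (incl l x) = (\<Sum>k\<in>Poly_Mapping.keys (incl l x). norm (Poly_Mapping.lookup (incl l x) k))" for x :: "real ^ 'n"
    unfolding norm_poly_mapping_def dist_poly_mapping_def by simp
  also have "\<dots> x \<le> (\<Sum>k\<in>{l}. norm (Poly_Mapping.lookup (incl l x) k))" for x :: "real ^ 'n"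
    by (intro sum_mono2) (auto simp: incl_def)
  finally have "norm (incl l x) \<le> norm x * 1" for x :: "real ^ 'n"
    by (simp add: lookup_incl)
  then show ?thesis
    by (intro bounded_linear_intro[where K=1]) (simp_all add: linear_add[OF linear_incl] linear_scale[OF linear_incl])
qed

lemma continuous_emb: "continuous_on UNIV (emb p :: (nat \<Rightarrow> real ^ 'n) \<Rightarrow> _)"
  unfolding emb_def[abs_def]
  by (intro continuous_on_sum bounded_linear.continuous_on[OF bounded_linear_incl] continuous_on_product_coordinates)

text \<open>A closed set is the zero set of its distance function, and \<open>emb p\<close> is
  continuous on the full product \<open>nat \<Rightarrow> real ^ 'n\<close>. There the product
  sigma-algebra is the Borel one, so it remains to extend families on \<open>{1..p}\<close> by 0,
  which is the map \<open>?e\<close>.\<close>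

lemma compact_measurable_volM:
  fixes A :: "(nat \<Rightarrow>\<^sub>0 real ^ 'n) set"
  assumes "compact A" shows "A \<in> sets (volM p)"
proof (cases "A = {}")
  case False
  let ?e = "\<lambda>w l. if l \<in> {1..p} then w l else (0 :: real ^ 'n)"
  have "continuous_on UNIV (\<lambda>w. infdist (emb p w) A)"
    by (intro continuous_on_infdist continuous_emb)
  then have "(\<lambda>w. infdist (emb p w) A) \<in> borel_measurable borel"
    by (rule borel_measurable_continuous_onI)
  then have 1: "(\<lambda>w. infdist (emb p w) A) \<in> borel_measurable (\<Pi>\<^sub>M i\<in>UNIV. borel)"
    by (simp cong: measurable_cong_sets add: sets_PiM_equal_borel)
  have 2: "?e \<in> power_lborel p \<rightarrow>\<^sub>M (\<Pi>\<^sub>M i\<in>UNIV. borel)"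
  proof (rule measurable_PiM_single')
    fix l :: nat
    show "(\<lambda>w. ?e w l) \<in> borel_measurable (power_lborel p)"
    proof (cases "l \<in> {1..p}")
      case False
      then have "(\<lambda>w. ?e w l) = (\<lambda>w. 0)" by auto
      then show ?thesis using measurable_const[of "0 :: real ^ 'n" borel "power_lborel p"] by (metis UNIV_I space_borel)
    qed simp
  qed auto
  have "emb p (?e w) = emb p w" for w by (simp add: emb_def)
  with measurable_compose[OF 2 1] have [measurable]: "(\<lambda>w. infdist (emb p w) A) \<in> borel_measurable (power_lborel p)"
    by simp
  have "{w \<in> space (power_lborel p). infdist (emb p w) A = 0} \<in> sets (power_lborel p)" by measurable
  moreover have "emb p w \<in> A \<longleftrightarrow> infdist (emb p w) A = 0" for w
    using compact_imp_closed[OF assms] False by (rule in_closed_iff_infdist_zero)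
  ultimately show ?thesis by (simp add: sets_volM_iff vimage_def Int_def conj_commute)
qed simp

text \<open>This instance serves the comparison of a simplex with its pieces in
  \<open>small_para\<close>.\<close>

interpretation lborel_inv: translation_invariant "lborel :: (real ^ 'n) measure" UNIV
proof
  show "\<exists>B. finite B \<and> (UNIV :: (real ^ 'n) set) \<subseteq> span B"
    by (rule exI[of _ Basis]) simp
next
  fix f :: "real ^ 'n \<Rightarrow> real" assume "linear f"
  then show "f \<in> borel_measurable lborel" by (simp add: measurable_linear_real)
next
  fix T :: "real ^ 'n \<Rightarrow> real ^ 'n" assume "linear T"
  then have [measurable]: "T \<in> borel_measurable borel" by (rule measurable_linear_real)
  have "{z \<in> space borel. T z = 0} \<in> sets borel" by measurable
  then show "{z. T z = 0} \<in> sets lborel" by simp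
next
  fix B :: "(real ^ 'n) set" assume "finite B"
  then show "comb B \<in> (\<Pi>\<^sub>M v\<in>B. lborel) \<rightarrow>\<^sub>M lborel"
    unfolding comb_def[abs_def] by measurable
next
  fix a :: "real ^ 'n"
  have "distr lborel lborel ((+) a) = distr lborel borel ((+) a)"
    by (rule distr_cong) auto
  then show "distr lborel lborel ((+) a) = lborel"
    by (simp add: lborel_distr_plus)
next
  fix B :: "(real ^ 'n) set" and r :: real assume "finite B"
  have "norm (comb B l) \<le> (\<Sum>v\<in>B. \<bar>r\<bar> * norm v)" if "\<forall>v\<in>B. \<bar>l v\<bar> \<le> r" for l
    unfolding comb_def using that by (intro sum_norm_le) (simp add: mult_right_mono order_trans[OF _ abs_ge_self])
  then show "\<exists>D\<in>sets lborel. emeasure lborel D < \<infinity> \<and> (\<forall>l. (\<forall>v\<in>B. \<bar>l v\<bar> \<le> r) \<longrightarrow> comb B l \<in> D)"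
    using emeasure_bounded_finite[of "cball (0 :: real ^ 'n) _"]
    by (intro bexI[of _ "cball 0 (\<Sum>v\<in>B. \<bar>r\<bar> * norm v)"]) auto
qed auto

section \<open>Lexicographically minimal weights\<close>

primrec lexle :: "'j list \<Rightarrow> ('j \<Rightarrow> real) \<Rightarrow> ('j \<Rightarrow> real) \<Rightarrow> bool" where
  "lexle [] l m \<longleftrightarrow> True"
| "lexle (j # js) l m \<longleftrightarrow> l j < m j \<or> l j = m j \<and> lexle js l m"

definition weights :: "'j set \<Rightarrow> ('j \<Rightarrow> real) set" where
  "weights J = {l. (\<forall>j. 0 \<le> l j) \<and> (\<forall>j. j \<notin> J \<longrightarrow> l j = 0)}"

definition supp :: "('j \<Rightarrow> real) \<Rightarrow> 'j set" where
  "supp l = {j. l j \<noteq> 0}"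

definition wsum :: "('j \<Rightarrow> 'v::real_vector) \<Rightarrow> 'j set \<Rightarrow> ('j \<Rightarrow> real) \<Rightarrow> 'v" where
  "wsum u J l = (\<Sum>j\<in>J. l j *\<^sub>R u j)"

text \<open>The canonical representation of a point as a nonnegative combination. No normalisation
  of the weights is imposed here; it is later encoded in the vectors \<open>u\<close> by
  \<open>lift\<close>.\<close>

definition lexmin :: "('j \<Rightarrow> 'v::real_vector) \<Rightarrow> 'j list \<Rightarrow> ('j \<Rightarrow> real) \<Rightarrow> bool" where
  "lexmin u js l \<longleftrightarrow> l \<in> weights (set js) \<and>
     (\<forall>m\<in>weights (set js). wsum u (set js) m = wsum u (set js) l \<longrightarrow> lexle js l m)"

lemma lexle_antisym: "lexle js l m \<Longrightarrow> lexle js m l \<Longrightarrow> j \<in> set js \<Longrightarrow> l j = m j"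
  by (induction js) auto

text \<open>The order is compatible with addition and with positive factors, so a comparison of
  \<open>m\<close> and \<open>n\<close> can be made in the neighbourhood of any other weight
  \<open>l\<close>.\<close>

lemma lexle_shift: "0 < e \<Longrightarrow> lexle js l (\<lambda>j. l j + e * (n j - m j)) \<longleftrightarrow> lexle js m n"
  by (induction js) (auto simp: zero_less_mult_iff)

lemma lexle_append:
  assumes "\<forall>j\<in>set js1. l j = 0 \<and> m j \<ge> 0" "(\<forall>j\<in>set js1. m j = 0) \<longrightarrow> lexle js2 l m"
  shows "lexle (js1 @ js2) l m"
  using assms
proof (induction js1)
  case (Cons j js1)
  then have "0 \<le> m j" "l j = 0" by auto
  then consider "0 < m j" | "m j = 0" by linarith
  then show ?case
  proof cases
    case 1
    then show ?thesis using \<open>l j = 0\<close> by simp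
  next
    case 2
    then show ?thesis using Cons \<open>l j = 0\<close> by simp
  qed
qed simp

lemma continuous_on_coordinate: "continuous_on A (\<lambda>l :: 'j \<Rightarrow> real. l j)"
  by (rule continuous_on_subset[OF continuous_on_product_coordinates subset_UNIV])

text \<open>One coordinate is minimised after the other; the minimisers of a continuous function on
  a compact set form a compact set again.\<close>

lemma compact_lexmin_exists:
  fixes X :: "('j \<Rightarrow> real) set"
  assumes "compact X" "X \<noteq> {}"
  shows "\<exists>l\<in>X. \<forall>m\<in>X. lexle js l m"
  using assms
proof (induction js arbitrary: X)
  case (Cons j js)
  have c: "continuous_on X (\<lambda>l. l j)"
    by (rule continuous_on_coordinate)
  obtain l0 where l0: "l0 \<in> X" "\<And>m. m \<in> X \<Longrightarrow> l0 j \<le> m j"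
    using continuous_attains_inf[OF Cons.prems c] by blast
  let ?Y = "X \<inter> (\<lambda>l. l j) -` {l0 j}"
  have "closed ((\<lambda>l :: 'j \<Rightarrow> real. l j) -` {l0 j})"
    by (intro closed_vimage closed_singleton continuous_on_coordinate)
  then have "compact ?Y" using Cons.prems by (intro compact_Int_closed)
  moreover have "?Y \<noteq> {}" using l0 by auto
  ultimately obtain l where l: "l \<in> ?Y" "\<forall>m\<in>?Y. lexle js l m" using Cons.IH by blast
  have "lexle (j # js) l m" if "m \<in> X" for m
  proof (cases "m j = l0 j")
    case True
    then show ?thesis using l that by auto
  next
    case False
    then show ?thesis using l l0(2)[OF that] by auto
  qed
  then show ?case using l by blast
qed auto

text \<open>Tychonoff in \<open>'j \<Rightarrow> real\<close>, with the factor \<open>{0}\<close> at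
  each index outside \<open>J\<close>.\<close>

lemma compact_weights: "compact {m \<in> weights J. \<forall>j\<in>J. m j \<le> R j}"
proof -
  let ?B = "\<lambda>j. if j \<in> J then {0..R j} else {0::real}"
  have "compactin (product_topology (\<lambda>_. euclidean) UNIV) (PiE UNIV ?B)"
    by (subst compactin_PiE) auto
  then have "compact (PiE UNIV ?B)" by (simp add: euclidean_product_topology)
  moreover have "PiE UNIV ?B = {m \<in> weights J. \<forall>j\<in>J. m j \<le> R j}"
  proof (intro equalityI subsetI)
    fix m assume "m \<in> PiE UNIV ?B"
    then have m: "\<And>j. m j \<in> ?B j" by (blast dest: PiE_mem[OF _ UNIV_I])
    have "0 \<le> m j" "j \<notin> J \<longrightarrow> m j = 0" "j \<in> J \<longrightarrow> m j \<le> R j" for j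
      using m[of j] by (auto split: if_splits)
    then show "m \<in> {m \<in> weights J. \<forall>j\<in>J. m j \<le> R j}" by (simp add: weights_def)
  next
    fix m assume m: "m \<in> {m \<in> weights J. \<forall>j\<in>J. m j \<le> R j}"
    then have "m j \<in> ?B j" for j by (simp add: weights_def)
    then show "m \<in> PiE UNIV ?B" by (simp add: PiE_UNIV_domain)
  qed
  ultimately show ?thesis by simp
qed

lemma closed_wsum_eq: "closed {m. wsum u J m = w}" for u :: "'j \<Rightarrow> 'v::real_normed_vector"
  unfolding wsum_def by (intro closed_Collect_eq continuous_intros continuous_on_coordinate)

lemma compact_weights_fiber:
  fixes u :: "'j \<Rightarrow> 'v::real_normed_vector"
  assumes R: "\<And>m j. m \<in> weights J \<Longrightarrow> wsum u J m = w \<Longrightarrow> j \<in> J \<Longrightarrow> m j \<le> R j"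
  shows "compact {m \<in> weights J. wsum u J m = w}"
proof -
  have "compact ({m \<in> weights J. \<forall>j\<in>J. m j \<le> R j} \<inter> {m. wsum u J m = w})"
    by (intro compact_Int_closed compact_weights closed_wsum_eq)
  moreover have "{m \<in> weights J. \<forall>j\<in>J. m j \<le> R j} \<inter> {m. wsum u J m = w} = {m \<in> weights J. wsum u J m = w}"
    using R by blast
  ultimately show ?thesis by simp
qed

text \<open>The bound \<open>R\<close> makes the fibre over \<open>w\<close> compact; for lifted
  vectors the row sums provide it.\<close>

lemma lexmin_exists:
  fixes u :: "'j \<Rightarrow> 'v::real_normed_vector"
  assumes R: "\<And>m j. m \<in> weights (set js) \<Longrightarrow> wsum u (set js) m = w \<Longrightarrow> j \<in> set js \<Longrightarrow> m j \<le> R j"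
    and ex: "\<exists>l\<in>weights (set js). wsum u (set js) l = w"
  shows "\<exists>l. lexmin u js l \<and> wsum u (set js) l = w"
proof -
  let ?X = "{m \<in> weights (set js). wsum u (set js) m = w}"
  have "compact ?X" using R by (intro compact_weights_fiber) auto
  moreover have "?X \<noteq> {}" using ex by auto
  ultimately obtain l where "l \<in> ?X" "\<forall>m\<in>?X. lexle js l m" using compact_lexmin_exists by blast
  then show ?thesis by (auto simp: lexmin_def)
qed

lemma lexmin_unique:
  assumes "lexmin u js l" "lexmin u js m" "wsum u (set js) l = wsum u (set js) m"
  shows "l = m"
proof
  fix j
  show "l j = m j"
  proof (cases "j \<in> set js")
    case True
    then show ?thesis using assms lexle_antisym[of js l m j] by (auto simp: lexmin_def)
  next
    case False
    then show ?thesis using assms by (auto simp: lexmin_def weights_def)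
  qed
qed

lemma weights_perturb:
  assumes J: "finite J" and l: "l \<in> weights J" and d: "\<And>j. j \<notin> J \<Longrightarrow> d j = 0"
    and s: "\<And>j. d j < 0 \<Longrightarrow> l j \<noteq> 0"
  shows "\<exists>e>0. (\<lambda>j. l j + e * d j) \<in> weights J"
proof -
  define N where "N = {j\<in>J. d j < 0}"
  \<comment> \<open>The largest step that keeps all decreasing weights nonnegative, capped at 1 in
    case none decreases.\<close>
  define e where "e = Min (insert 1 ((\<lambda>j. l j / - d j) ` N))"
  have fin: "finite (insert 1 ((\<lambda>j. l j / - d j) ` N))" using J by (simp add: N_def)
  have pos: "l j > 0" if "j \<in> N" for j
    using that s[of j] l by (auto simp: N_def weights_def less_le)
  have "e > 0"
    unfolding e_def using fin pos by (subst Min_gr_iff) (auto simp: N_def divide_pos_neg minus_divide_right[symmetric])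
  moreover have "0 \<le> l j + e * d j" for j
  proof (cases "d j < 0")
    case True
    then have "j \<in> N" using d[of j] by (auto simp: N_def)
    then have "e \<le> l j / - d j" unfolding e_def using fin by (intro Min_le) auto
    then show ?thesis using True by (simp add: field_simps)
  next
    case False
    then show ?thesis using \<open>e > 0\<close> l by (simp add: weights_def)
  qed
  ultimately show ?thesis using l d by (intro exI[of _ e]) (simp add: weights_def)
qed

lemma wsum_perturb: "wsum u J (\<lambda>j. l j + e * (n j - m j)) = wsum u J l + e *\<^sub>R (wsum u J n - wsum u J m)"
  by (simp add: wsum_def scaleR_left_distrib sum.distrib scaleR_right.sum scaleR_diff_left
      right_diff_distrib scaleR_diff_right sum_subtractf)

text \<open>Moving a lexicographically minimal weight a little towards a better one would improve it.\<close>

lemma lexmin_face: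
  assumes l: "lexmin u js l" and m: "m \<in> weights (set js)" "supp m \<subseteq> supp l"
  shows "lexmin u js m"
  unfolding lexmin_def
proof (intro conjI ballI impI)
  show "m \<in> weights (set js)" by (rule m(1))
  fix n assume n: "n \<in> weights (set js)" and eq: "wsum u (set js) n = wsum u (set js) m"
  have "\<exists>e>0. (\<lambda>j. l j + e * (n j - m j)) \<in> weights (set js)"
  proof (rule weights_perturb)
    show "l \<in> weights (set js)" using l by (simp add: lexmin_def)
    fix j
    show "n j - m j = 0" if "j \<notin> set js" using that n m by (auto simp: weights_def)
    show "l j \<noteq> 0" if "n j - m j < 0"
    proof -
      have "m j \<noteq> 0" using that n by (auto simp: weights_def not_less[symmetric])
      then show ?thesis using m(2) by (auto simp: supp_def)
    qed
  qed auto
  then obtain e where e: "e > 0" "(\<lambda>j. l j + e * (n j - m j)) \<in> weights (set js)" by blast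
  have "lexle js l (\<lambda>j. l j + e * (n j - m j))"
    using l e(2) wsum_perturb[of u "set js" l e n m] eq by (auto simp: lexmin_def)
  then show "lexle js m n" using lexle_shift[OF e(1)] by blast
qed

lemma weights_mono: "J \<subseteq> J' \<Longrightarrow> weights J \<subseteq> weights J'"
  by (auto simp: weights_def)

lemma wsum_mono: "finite J' \<Longrightarrow> J \<subseteq> J' \<Longrightarrow> l \<in> weights J \<Longrightarrow> wsum u J' l = wsum u J l"
  unfolding wsum_def by (rule sum.mono_neutral_right) (auto simp: weights_def)

text \<open>A competitor that uses an index of \<open>js1\<close> is larger than \<open>l\<close> at
  the first such index, where \<open>l\<close> is 0; every other competitor lives on
  \<open>js2\<close>. Hence new indices have to be put in front.\<close>

lemma lexmin_append:
  assumes l: "lexmin u js2 l" and dj: "set js1 \<inter> set js2 = {}"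
  shows "lexmin u (js1 @ js2) l"
  unfolding lexmin_def
proof (intro conjI ballI impI)
  have lw: "l \<in> weights (set js2)" using l by (simp add: lexmin_def)
  then show "l \<in> weights (set (js1 @ js2))" using weights_mono[of "set js2" "set (js1 @ js2)"] by auto
  fix m assume m: "m \<in> weights (set (js1 @ js2))"
    and eq: "wsum u (set (js1 @ js2)) m = wsum u (set (js1 @ js2)) l"
  show "lexle (js1 @ js2) l m"
  proof (rule lexle_append)
    show "\<forall>j\<in>set js1. l j = 0 \<and> m j \<ge> 0"
      using lw m dj by (auto simp: weights_def)
    show "(\<forall>j\<in>set js1. m j = 0) \<longrightarrow> lexle js2 l m"
    proof
    assume 0: "\<forall>j\<in>set js1. m j = 0"
    then have "m \<in> weights (set js2)" using m by (auto simp: weights_def)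
    moreover have "wsum u (set js2) m = wsum u (set js2) l"
      using eq wsum_mono[OF _ _ calculation, of "set (js1 @ js2)" u] wsum_mono[OF _ _ lw, of "set (js1 @ js2)" u] by simp
    ultimately show "lexle js2 l m" using l by (simp add: lexmin_def)
    qed
  qed
qed

text \<open>A small multiple of a linear relation \<open>d\<close> on the support can be added to
  \<open>l\<close>. The result represents the same point and is minimal by
  \<open>lexmin_face\<close>, so it coincides with \<open>l\<close> by uniqueness.\<close>

lemma lexmin_support_independent:
  assumes l: "lexmin u js l" and d: "\<And>j. j \<notin> supp l \<Longrightarrow> d j = 0" and 0: "wsum u (set js) d = 0"
  shows "d j = 0"
proof -
  have lw: "l \<in> weights (set js)" using l by (simp add: lexmin_def)
  then have dj: "d j = 0" if "j \<notin> set js" for j using that d by (auto simp: weights_def supp_def)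
  have "l j \<noteq> 0" if "d j < 0" for j using d[of j] that by (auto simp: supp_def)
  with dj have "\<exists>e>0. (\<lambda>j. l j + e * d j) \<in> weights (set js)"
    by (intro weights_perturb[OF finite_set lw])
  then obtain e where e: "e > 0" "(\<lambda>j. l j + e * d j) \<in> weights (set js)" by blast
  have "supp (\<lambda>j. l j + e * d j) \<subseteq> supp l" using d by (auto simp: supp_def)
  then have "lexmin u js (\<lambda>j. l j + e * d j)" using lexmin_face[OF l e(2)] by blast
  moreover have "wsum u (set js) (\<lambda>j. l j + e * d j) = wsum u (set js) l"
    using wsum_perturb[of u "set js" l e d "\<lambda>_. 0"] 0 by (simp add: wsum_def)
  ultimately have "(\<lambda>j. l j + e * d j) = l" using l lexmin_unique by blast
  then show ?thesis using e(1) by (auto simp: fun_eq_iff)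
qed

section \<open>Iterated partial derivatives of polynomials\<close>

lemma at_within_nonneg_neq_bot: "0 \<le> x \<Longrightarrow> at x within {0::real..} \<noteq> bot"
proof -
  assume "0 \<le> x"
  then have "at_right x \<le> at x within {0::real..}" by (intro at_le) auto
  then show ?thesis using trivial_limit_at_right_real[of x] by (metis bot.extremum_uniqueI)
qed

text \<open>Values at nonnegative arguments suffice for derivatives within the half-line. For
  exponent 0 the factor \<open>real 0\<close> kills the term, whatever the truncated exponent
  \<open>0 - 1\<close> stands for.\<close>

lemma mixed_partial_poly:
  fixes c :: "'k \<Rightarrow> real" and a :: "'k \<Rightarrow> nat \<Rightarrow> nat"
  assumes F: "\<And>s. (\<And>i. 0 \<le> s i) \<Longrightarrow> F s = (\<Sum>k\<in>K. c k * (\<Prod>i<N. s i ^ a k i))"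
    and s: "\<And>i. 0 \<le> s i" and m: "m \<le> N"
  shows "mixed_partial m F s =
    (\<Sum>k\<in>K. c k * (\<Prod>i<m. real (a k i) * s i ^ (a k i - 1)) * (\<Prod>i\<in>{m..<N}. s i ^ a k i))"
  using s m
proof (induction m arbitrary: s)
  case 0
  then show ?case by (simp add: F lessThan_atLeast0)
next
  case (Suc m)
  define q where "q k = c k * (\<Prod>i<m. real (a k i) * s i ^ (a k i - 1)) * (\<Prod>i\<in>{Suc m..<N}. s i ^ a k i)" for k
  have eq: "mixed_partial m F (s(m := u)) = (\<Sum>k\<in>K. q k * u ^ a k m)" if "u \<ge> 0" for u
  proof -
    have "mixed_partial m F (s(m := u)) =
      (\<Sum>k\<in>K. c k * (\<Prod>i<m. real (a k i) * (s(m := u)) i ^ (a k i - 1)) * (\<Prod>i\<in>{m..<N}. (s(m := u)) i ^ a k i))"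
      using Suc.prems that by (intro Suc.IH) auto
    also have "\<dots> = (\<Sum>k\<in>K. q k * u ^ a k m)"
    proof (rule sum.cong[OF refl])
      fix k
      have "(\<Prod>i\<in>{m..<N}. (s(m := u)) i ^ a k i) = u ^ a k m * (\<Prod>i\<in>{Suc m..<N}. s i ^ a k i)"
        using Suc.prems(2) by (subst prod.atLeast_Suc_lessThan) auto
      then show "c k * (\<Prod>i<m. real (a k i) * (s(m := u)) i ^ (a k i - 1)) * (\<Prod>i\<in>{m..<N}. (s(m := u)) i ^ a k i)
          = q k * u ^ a k m"
        by (simp add: q_def)
    qed
    finally show ?thesis .
  qed
  have "((\<lambda>u. \<Sum>k\<in>K. q k * u ^ a k m) has_real_derivative (\<Sum>k\<in>K. q k * (real (a k m) * s m ^ (a k m - 1)))) (at (s m) within {0..})"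
    by (auto intro!: derivative_eq_intros sum.cong simp: One_nat_def)
  then have "((\<lambda>u. \<Sum>k\<in>K. q k * u ^ a k m) has_vector_derivative (\<Sum>k\<in>K. q k * (real (a k m) * s m ^ (a k m - 1)))) (at (s m) within {0..})"
    by (simp add: has_real_derivative_iff_has_vector_derivative)
  then have "((\<lambda>u. mixed_partial m F (s(m := u))) has_vector_derivative (\<Sum>k\<in>K. q k * (real (a k m) * s m ^ (a k m - 1)))) (at (s m) within {0..})"
    using Suc.prems by (rule_tac has_vector_derivative_transform[where f="\<lambda>u. \<Sum>k\<in>K. q k * u ^ a k m"]) (auto simp: eq)
  moreover have "at (s m) within {0..} \<noteq> bot"
    using Suc.prems(1)[of m] by (intro at_within_nonneg_neq_bot)
  ultimately have "mixed_partial (Suc m) F s = (\<Sum>k\<in>K. q k * (real (a k m) * s m ^ (a k m - 1)))"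
    by (simp add: vector_derivative_within)
  then show ?case by (simp add: q_def mult_ac)
qed

text \<open>At the origin the factor \<open>real a * 0 ^ (a - 1)\<close> is 1 for
  \<open>a = 1\<close> and 0 otherwise, so only the square-free monomial survives; several
  \<open>k\<close> may contribute to it.\<close>

lemma mixed_partial_poly_0:
  fixes c :: "'k \<Rightarrow> real" and a :: "'k \<Rightarrow> nat \<Rightarrow> nat"
  assumes K: "finite K" and F: "\<And>s. (\<And>i. 0 \<le> s i) \<Longrightarrow> F s = (\<Sum>k\<in>K. c k * (\<Prod>i<N. s i ^ a k i))"
  shows "mixed_partial N F (\<lambda>_. 0) = (\<Sum>k | k \<in> K \<and> (\<forall>i<N. a k i = 1). c k)"
proof -
  have z: "(\<Prod>i<N. real (a k i) * 0 ^ (a k i - 1)) = (if \<forall>i<N. a k i = 1 then 1 else 0)" for k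
  proof -
    have "real b * 0 ^ (b - 1) = (if b = 1 then 1 else 0)" for b
      by (cases b rule: nat.exhaust) (auto simp: power_0_left One_nat_def)
    then show ?thesis by (auto intro: prod_zero)
  qed
  have "mixed_partial N F (\<lambda>_. 0) = (\<Sum>k\<in>K. c k * (\<Prod>i<N. real (a k i) * 0 ^ (a k i - 1)))"
    using mixed_partial_poly[where F=F and s="\<lambda>_. 0" and m=N, OF F] by simp
  also have "\<dots> = (\<Sum>k\<in>K. if \<forall>i<N. a k i = 1 then c k else 0)"
    by (intro sum.cong) (auto simp: z)
  also have "\<dots> = (\<Sum>k | k \<in> K \<and> (\<forall>i<N. a k i = 1). c k)"
    using K by (subst sum.inter_filter) auto
  finally show ?thesis .
qed

text \<open>This is the shape of the volume polynomial of \<open>N\<close> equal bodies. Each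
  derivative lowers the power by one, so the full derivative is \<open>fact N * c\<close>.\<close>

lemma mixed_partial_power:
  assumes F: "\<And>s. (\<And>i. 0 \<le> s i) \<Longrightarrow> F s = c * (\<Sum>i<N. s i) ^ N"
    and s: "\<And>i. 0 \<le> s i" and m: "m \<le> N"
  shows "mixed_partial m F s = c * (fact N / fact (N - m)) * (\<Sum>i<N. s i) ^ (N - m)"
  using s m
proof (induction m arbitrary: s)
  case 0
  then show ?case by (simp add: F)
next
  case (Suc m)
  define r where "r = (\<Sum>i\<in>{..<N} - {m}. s i)"
  have sum: "(\<Sum>i<N. (s(m := u)) i) = r + u" for u
  proof -
    have "(\<Sum>i<N. (s(m := u)) i) = u + (\<Sum>i\<in>{..<N} - {m}. (s(m := u)) i)"
      using Suc.prems(2) by (subst sum.remove[of _ m]) auto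
    also have "(\<Sum>i\<in>{..<N} - {m}. (s(m := u)) i) = r"
      unfolding r_def by (rule sum.cong) auto
    finally show ?thesis by simp
  qed
  define q where "q = c * (fact N / fact (N - m))"
  have eq: "mixed_partial m F (s(m := u)) = q * (r + u) ^ (N - m)" if "u \<ge> 0" for u
  proof -
    have "0 \<le> (s(m := u)) i" for i using Suc.prems(1)[of i] that by simp
    then show ?thesis using Suc.IH[of "s(m := u)"] Suc.prems(2) by (simp add: sum q_def del: fun_upd_apply)
  qed
  let ?D = "q * (real (N - m) * (r + s m) ^ (N - m - 1))"
  have "((\<lambda>u. q * (r + u) ^ (N - m)) has_real_derivative ?D) (at (s m) within {0..})"
    by (auto intro!: derivative_eq_intros simp: One_nat_def)
  then have "((\<lambda>u. q * (r + u) ^ (N - m)) has_vector_derivative ?D) (at (s m) within {0..})"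
    by (simp add: has_real_derivative_iff_has_vector_derivative)
  then have "((\<lambda>u. mixed_partial m F (s(m := u))) has_vector_derivative ?D) (at (s m) within {0..})"
    using Suc.prems by (rule_tac has_vector_derivative_transform[where f="\<lambda>u. q * (r + u) ^ (N - m)"]) (auto simp: eq)
  moreover have "at (s m) within {0..} \<noteq> bot"
    using Suc.prems(1)[of m] by (intro at_within_nonneg_neq_bot)
  ultimately have "mixed_partial (Suc m) F s = ?D"
    by (simp add: vector_derivative_within)
  moreover have "N - m = Suc (N - Suc m)" using Suc.prems by simp
  then have "fact N / fact (N - m) * real (N - m) = fact N / (fact (N - Suc m) :: real)"
    by (simp add: divide_simps)
  moreover have "?D = c * (fact N / fact (N - m) * real (N - m)) * (r + s m) ^ (N - m - 1)"
    by (simp only: q_def mult.assoc)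
  moreover have "N - m - 1 = N - Suc m" by simp
  moreover have "(\<Sum>i<N. s i) = r + s m" using sum[of "s m"] by simp
  ultimately show ?case by (simp only:)
qed

section \<open>Cells of a mixed subdivision\<close>

lemma family_independent:
  fixes f :: "'j \<Rightarrow> 'v::real_vector"
  assumes I: "finite I" and ind: "\<And>c. (\<Sum>j\<in>I. c j *\<^sub>R f j) = 0 \<Longrightarrow> \<forall>j\<in>I. c j = 0"
  shows "inj_on f I" "independent (f ` I)"
proof -
  show inj: "inj_on f I"
  proof (rule inj_onI, rule ccontr)
    fix i j assume ij: "i \<in> I" "j \<in> I" "f i = f j" "i \<noteq> j"
    define c where "c = (\<lambda>k. if k = i then 1 else if k = j then - 1 else (0::real))"
    have "(\<Sum>k\<in>I. c k *\<^sub>R f k) = (\<Sum>k\<in>{i, j}. c k *\<^sub>R f k)"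
      using ij I by (intro sum.mono_neutral_right) (auto simp: c_def)
    also have "\<dots> = 0" using ij by (simp add: c_def)
    finally have "c i = 0" using ind ij by blast
    then show False by (simp add: c_def)
  qed
  show "independent (f ` I)"
  proof
    assume "dependent (f ` I)"
    then obtain u v where u: "v \<in> f ` I" "u v \<noteq> 0" "(\<Sum>v\<in>f ` I. u v *\<^sub>R v) = 0"
      using I by (auto simp: dependent_finite)
    then have "(\<Sum>j\<in>I. u (f j) *\<^sub>R f j) = 0" by (simp add: sum.reindex[OF inj])
    then have "\<forall>j\<in>I. u (f j) = 0" using ind[of "\<lambda>j. u (f j)"] by simp
    then show False using u by auto
  qed
qed

text \<open>A mixed cell: the Minkowski sum of the relatively open hulls of the sets
  \<open>S i\<close>, scaled by \<open>s i\<close>.\<close>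

definition cell :: "nat \<Rightarrow> (nat \<Rightarrow> 'v::real_vector set) \<Rightarrow> (nat \<Rightarrow> real) \<Rightarrow> 'v set" where
  "cell N S s = {\<Sum>i<N. \<Sum>v\<in>S i. l i v *\<^sub>R v | l.
     (\<forall>i<N. \<forall>v\<in>S i. 0 < l i v) \<and> (\<forall>i<N. (\<Sum>v\<in>S i. l i v) = s i)}"

context translation_invariant
begin

text \<open>After the choice of a vertex \<open>b i\<close> in each \<open>S i\<close>, the
  differences \<open>v - b i\<close> are linearly independent by \<open>ind\<close>, and the cell is
  a translate of the image of a product of open corner simplices. The coordinates of row
  \<open>i\<close> scale by \<open>s i\<close>, once for each of the \<open>card (S i) - 1\<close>
  differences; this produces the monomial.\<close>

lemma
  assumes fin: "\<And>i. i < N \<Longrightarrow> finite (S i)" and ne: "\<And>i. i < N \<Longrightarrow> S i \<noteq> {}"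
    and SW: "\<And>i. i < N \<Longrightarrow> S i \<subseteq> W"
    and ind: "\<And>d i v. (\<forall>i<N. (\<Sum>v\<in>S i. d i v) = 0) \<Longrightarrow> (\<Sum>i<N. \<Sum>v\<in>S i. d i v *\<^sub>R v) = 0 \<Longrightarrow>
      i < N \<Longrightarrow> v \<in> S i \<Longrightarrow> d i v = 0"
    and s: "\<And>i. i < N \<Longrightarrow> 0 < s i"
  shows cell_measurable: "cell N S s \<in> sets M"
    and measure_cell: "measure M (cell N S s) = (\<Prod>i<N. s i ^ (card (S i) - 1)) * measure M (cell N S (\<lambda>_. 1))"
proof -
  define b where "b i = (SOME v. v \<in> S i)" for i
  have b: "b i \<in> S i" if "i < N" for i using ne[OF that] by (simp add: b_def some_in_eq)
  define S' where "S' i = S i - {b i}" for i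
  have fin': "finite (S' i)" if "i < N" for i using fin[OF that] by (simp add: S'_def)
  have S_insert: "(\<Sum>v\<in>S i. g v) = g (b i) + (\<Sum>v\<in>S' i. g v)" if "i < N" for i and g :: "'v \<Rightarrow> 'b::comm_monoid_add"
    unfolding S'_def by (rule sum.remove[OF fin[OF that] b[OF that]])
  define I where "I = (SIGMA i:{..<N}. S' i)"
  define \<beta> where "\<beta> = (\<lambda>(i, v). v - b i)"
  have I: "finite I" using fin' by (auto simp: I_def)
  have sum_I: "(\<Sum>j\<in>I. g j) = (\<Sum>i<N. \<Sum>v\<in>S' i. g (i, v))" for g :: "nat \<times> 'v \<Rightarrow> 'b::comm_monoid_add"
    unfolding I_def using fin' by (subst sum.Sigma) auto
  have "\<forall>j\<in>I. c j = 0" if "(\<Sum>j\<in>I. c j *\<^sub>R \<beta> j) = 0" for c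
  proof -
    \<comment> \<open>The coefficient at the base vertex is chosen such that every row sums to
      0.\<close>
    define d where "d i v = (if v = b i then - (\<Sum>v\<in>S' i. c (i, v)) else c (i, v))" for i v
    have d: "(\<Sum>v\<in>S' i. g v (d i v)) = (\<Sum>v\<in>S' i. g v (c (i, v)))" for i and g :: "'v \<Rightarrow> real \<Rightarrow> 'b::comm_monoid_add"
      by (rule sum.cong) (auto simp: d_def S'_def)
    have 1: "\<forall>i<N. (\<Sum>v\<in>S i. d i v) = 0"
      using d[of "\<lambda>_ x. x"] by (simp add: S_insert) (simp add: d_def)
    have "(\<Sum>i<N. \<Sum>v\<in>S i. d i v *\<^sub>R v) = (\<Sum>i<N. \<Sum>v\<in>S' i. c (i, v) *\<^sub>R (v - b i))"
    proof (rule sum.cong[OF refl])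
      fix i assume "i \<in> {..<N}"
      then have "(\<Sum>v\<in>S i. d i v *\<^sub>R v) = d i (b i) *\<^sub>R b i + (\<Sum>v\<in>S' i. c (i, v) *\<^sub>R v)"
        using d[of "\<lambda>v x. x *\<^sub>R v"] by (simp add: S_insert)
      then show "(\<Sum>v\<in>S i. d i v *\<^sub>R v) = (\<Sum>v\<in>S' i. c (i, v) *\<^sub>R (v - b i))"
        by (simp add: d_def scaleR_diff_right sum_subtractf scaleR_left.sum)
    qed
    also have "\<dots> = 0" using that by (simp add: sum_I \<beta>_def)
    finally have 2: "(\<Sum>i<N. \<Sum>v\<in>S i. d i v *\<^sub>R v) = 0" .
    show ?thesis
    proof
      fix j assume "j \<in> I"
      then obtain i v where j: "j = (i, v)" "i < N" "v \<in> S' i" by (auto simp: I_def)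
      then have "d i v = 0" using ind[OF 1 2] by (auto simp: S'_def)
      then show "c j = 0" using j by (auto simp: d_def S'_def)
    qed
  qed
  note fi = family_independent[where f=\<beta>, OF I this]
  define B where "B = \<beta> ` I"
  have B: "finite B" "independent B" using I fi(2) by (auto simp: B_def)
  have BW: "B \<subseteq> W"
    using SW b subspace_W by (auto simp: B_def \<beta>_def I_def S'_def subset_iff intro!: subspace_diff)
  have sum_B: "(\<Sum>w\<in>B. g w) = (\<Sum>i<N. \<Sum>v\<in>S' i. g (v - b i))" for g :: "'v \<Rightarrow> 'b::comm_monoid_add"
  proof -
    have "(\<Sum>w\<in>B. g w) = (\<Sum>j\<in>I. g (\<beta> j))"
      using sum.reindex[OF fi(1), of g] by (simp add: B_def o_def)
    then show ?thesis by (simp add: sum_I) (simp add: \<beta>_def)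
  qed
  define P where "P = (\<Pi>\<^sub>M w\<in>B. lborel :: real measure)"
  have spP: "space P = extensional B" by (simp add: P_def space_PiM PiE_def)
  have inB: "v - b i \<in> B" if "i < N" "v \<in> S' i" for i v
    using that unfolding B_def by (intro image_eqI[of _ _ "(i, v)"]) (auto simp: \<beta>_def I_def)
  define A where "A s = {x \<in> space P. (\<forall>w\<in>B. 0 < x w) \<and> (\<forall>i\<in>{..<N}. (\<Sum>v\<in>S' i. x (v - b i)) < s i)}" for s
  have [measurable]: "(\<lambda>x. x w) \<in> borel_measurable P" if "w \<in> B" for w
    using that unfolding P_def by measurable
  have [measurable]: "(\<lambda>x. \<Sum>v\<in>S' i. x (v - b i)) \<in> borel_measurable P" if "i < N" for i
    using inB[OF that] by (intro borel_measurable_sum) measurable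
  have Am: "A s \<in> sets P" for s
  proof -
    have "{x \<in> space P. \<forall>w\<in>B. 0 < x w} \<in> sets P"
      using B(1) by (intro sets.sets_Collect_finite_All) measurable
    moreover have "{x \<in> space P. \<forall>i\<in>{..<N}. (\<Sum>v\<in>S' i. x (v - b i)) < s i} \<in> sets P"
      by (intro sets.sets_Collect_finite_All) measurable
    ultimately have "{x \<in> space P. \<forall>w\<in>B. 0 < x w} \<inter> {x \<in> space P. \<forall>i\<in>{..<N}. (\<Sum>v\<in>S' i. x (v - b i)) < s i} \<in> sets P"
      by blast
    moreover have "{x \<in> space P. \<forall>w\<in>B. 0 < x w} \<inter> {x \<in> space P. \<forall>i\<in>{..<N}. (\<Sum>v\<in>S' i. x (v - b i)) < s i} = A s"
      by (auto simp: A_def)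
    ultimately show ?thesis by simp
  qed
  define t where "t s = (\<Sum>i<N. s i *\<^sub>R b i)" for s
  have tW: "t s \<in> W" for s
    using SW b subspace_W unfolding t_def by (intro subspace_sum subspace_scale) auto
  have cell_eq: "cell N S s = (+) (t s) ` comb B ` A s" for s
  proof (intro equalityI subsetI)
    fix z assume "z \<in> cell N S s"
    then obtain l where l: "\<forall>i<N. \<forall>v\<in>S i. 0 < l i v" "\<forall>i<N. (\<Sum>v\<in>S i. l i v) = s i"
      "z = (\<Sum>i<N. \<Sum>v\<in>S i. l i v *\<^sub>R v)" by (auto simp: cell_def)
    define x where "x = restrict (\<lambda>w. case the_inv_into I \<beta> w of (i, v) \<Rightarrow> l i v) B"
    have x: "x (v - b i) = l i v" if "i < N" "v \<in> S' i" for i v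
    proof -
      have "(i, v) \<in> I" using that by (auto simp: I_def)
      then have "the_inv_into I \<beta> (\<beta> (i, v)) = (i, v)" using the_inv_into_f_f[OF fi(1)] by blast
      then show ?thesis using inB[OF that] by (simp add: x_def \<beta>_def)
    qed
    have "x \<in> A s"
      unfolding A_def
    proof (intro CollectI conjI ballI)
      show "x \<in> space P" by (simp add: spP x_def)
      show "0 < x w" if w: "w \<in> B" for w
      proof -
        obtain i v where "w = v - b i" "i < N" "v \<in> S' i"
          using w by (auto simp: B_def I_def \<beta>_def)
        then show ?thesis using x[of i v] l(1) by (simp add: S'_def)
      qed
      fix i assume i: "i \<in> {..<N}"
      then have "(\<Sum>v\<in>S' i. x (v - b i)) = (\<Sum>v\<in>S' i. l i v)"
        using x by (intro sum.cong) auto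
      \<comment> \<open>Strict because the base vertex has positive weight.\<close>
      also have "\<dots> < s i" using i l S_insert[of i "l i"] b[of i] by fastforce
      finally show "(\<Sum>v\<in>S' i. x (v - b i)) < s i" .
    qed
    moreover have "z = t s + comb B x"
    proof -
      have "comb B x = (\<Sum>i<N. \<Sum>v\<in>S' i. l i v *\<^sub>R (v - b i))"
        unfolding comb_def sum_B using x by (intro sum.cong) auto
      also have "\<dots> = (\<Sum>i<N. (\<Sum>v\<in>S i. l i v *\<^sub>R v) - s i *\<^sub>R b i)"
      proof (rule sum.cong[OF refl])
        fix i assume i: "i \<in> {..<N}"
        then have "s i = l i (b i) + (\<Sum>v\<in>S' i. l i v)" using l(2) S_insert[of i "l i"] by simp
        then show "(\<Sum>v\<in>S' i. l i v *\<^sub>R (v - b i)) = (\<Sum>v\<in>S i. l i v *\<^sub>R v) - s i *\<^sub>R b i"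
          using i by (simp add: S_insert scaleR_diff_right sum_subtractf scaleR_left.sum scaleR_left_distrib)
      qed
      finally show ?thesis by (simp add: l(3) t_def sum_subtractf)
    qed
    ultimately show "z \<in> (+) (t s) ` comb B ` A s" by blast
  next
    fix z assume "z \<in> (+) (t s) ` comb B ` A s"
    then obtain x where x: "x \<in> A s" "z = t s + comb B x" by blast
    define l where "l i v = (if v = b i then s i - (\<Sum>v\<in>S' i. x (v - b i)) else x (v - b i))" for i v
    have l: "(\<Sum>v\<in>S' i. g v (l i v)) = (\<Sum>v\<in>S' i. g v (x (v - b i)))" for i and g :: "'v \<Rightarrow> real \<Rightarrow> 'b::comm_monoid_add"
      by (rule sum.cong) (auto simp: l_def S'_def)
    have "0 < l i v" if "i < N" "v \<in> S i" for i v
      using that x(1) inB[of i v] by (auto simp: l_def A_def S'_def)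
    moreover have "(\<Sum>v\<in>S i. l i v) = s i" if "i < N" for i
      using that l[of "\<lambda>_ x. x"] by (simp add: S_insert) (simp add: l_def)
    moreover have "z = (\<Sum>i<N. \<Sum>v\<in>S i. l i v *\<^sub>R v)"
    proof -
      have "(\<Sum>v\<in>S i. l i v *\<^sub>R v) = s i *\<^sub>R b i + (\<Sum>v\<in>S' i. x (v - b i) *\<^sub>R (v - b i))" if "i < N" for i
      proof -
        have "(\<Sum>v\<in>S i. l i v *\<^sub>R v) = l i (b i) *\<^sub>R b i + (\<Sum>v\<in>S' i. x (v - b i) *\<^sub>R v)"
          using that l[of "\<lambda>v x. x *\<^sub>R v"] by (simp add: S_insert)
        then show ?thesis
          by (simp add: l_def scaleR_diff_right scaleR_diff_left sum_subtractf scaleR_left.sum)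
      qed
      then show ?thesis
        by (simp add: x(2) t_def comb_def sum_B sum.distrib)
    qed
    ultimately show "z \<in> cell N S s" unfolding cell_def by blast
  qed
  have Cm: "comb B ` A s \<in> sets M" for s
    using comb_image_measurable[OF B BW] Am by (simp add: P_def)
  show "cell N S s \<in> sets M"
    unfolding cell_eq by (rule translate(1)[OF Cm tW])
  have mc: "measure M (cell N S s) = measure M (para B) * measure P (A s)" for s
    using translate(2)[OF Cm tW] measure_comb_image[OF B BW] Am
    by (simp add: cell_eq measure_def P_def)
  \<comment> \<open>The scale factor has to be a function of the difference vector, so the row is
    recovered through the inverse of \<open>\<beta>\<close>.\<close>
  define s' where "s' w = s (fst (the_inv_into I \<beta> w))" for w
  have s': "s' (v - b i) = s i" if "i < N" "v \<in> S' i" for i v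
  proof -
    have "(i, v) \<in> I" using that by (auto simp: I_def)
    then have "the_inv_into I \<beta> (\<beta> (i, v)) = (i, v)" using the_inv_into_f_f[OF fi(1)] by blast
    then show ?thesis by (simp add: s'_def \<beta>_def)
  qed
  have Bcases: "\<exists>i v. w = v - b i \<and> i < N \<and> v \<in> S' i" if "w \<in> B" for w
    using that by (auto simp: B_def I_def \<beta>_def)
  have s'pos: "0 < s' w" if "w \<in> B" for w
    using Bcases[OF that] s s' by auto
  have scale: "A s = {x \<in> space P. (\<lambda>w\<in>B. x w / s' w) \<in> A (\<lambda>_. 1)}"
  proof -
    have "(\<Sum>v\<in>S' i. (\<lambda>w\<in>B. x w / s' w) (v - b i)) = (\<Sum>v\<in>S' i. x (v - b i)) / s i" if "i < N" for i x
      using inB[OF that] s'[OF that] by (simp add: sum_divide_distrib)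
    then have "(\<Sum>v\<in>S' i. (\<lambda>w\<in>B. x w / s' w) (v - b i)) < 1 \<longleftrightarrow> (\<Sum>v\<in>S' i. x (v - b i)) < s i" if "i < N" for i x
      using that s[OF that] by simp
    moreover have "0 < (\<lambda>w\<in>B. x w / s' w) w \<longleftrightarrow> 0 < x w" if "w \<in> B" for w x
      using s'pos[OF that] that by (simp add: zero_less_divide_iff)
    moreover have "(\<lambda>w\<in>B. x w / s' w) \<in> space P" for x by (simp add: spP)
    ultimately show ?thesis unfolding A_def by (intro Collect_cong) (simp del: restrict_apply)
  qed
  have "(\<Prod>w\<in>B. s' w) = (\<Prod>j\<in>I. s' (\<beta> j))"
    using prod.reindex[OF fi(1), of s'] by (simp add: B_def o_def)
  also have "\<dots> = (\<Prod>i<N. \<Prod>v\<in>S' i. s' (v - b i))"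
    unfolding I_def using fin' by (subst prod.Sigma) (auto simp: \<beta>_def intro!: prod.cong)
  also have "\<dots> = (\<Prod>i<N. s i ^ (card (S i) - 1))"
    using s' b fin by (intro prod.cong) (auto simp: S'_def card_Diff_singleton)
  finally have prod: "(\<Prod>w\<in>B. s' w) = (\<Prod>i<N. s i ^ (card (S i) - 1))" .
  have "emeasure P (A s) = ennreal (\<Prod>w\<in>B. s' w) * emeasure P (A (\<lambda>_. 1))"
    using PiM_lborel_scale[OF B(1) s'pos Am[of "\<lambda>_. 1", unfolded P_def]]
    by (simp add: scale[unfolded P_def] P_def)
  then have "measure P (A s) = (\<Prod>w\<in>B. s' w) * measure P (A (\<lambda>_. 1))"
    using s'pos by (simp add: measure_def enn2real_mult prod_nonneg less_imp_le)
  then show "measure M (cell N S s) = (\<Prod>i<N. s i ^ (card (S i) - 1)) * measure M (cell N S (\<lambda>_. 1))"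
    by (simp add: mc prod)
qed

end

text \<open>All coordinates with respect to a basis of \<open>W\<close> scale by \<open>r\<close>,
  so the degree of homogeneity is the dimension of \<open>W\<close>.\<close>

lemma (in translation_invariant) measure_scale:
  assumes B: "finite B" "independent B" "span B = W" and A: "A \<in> sets M" "A \<subseteq> W" and r: "0 < r"
  shows "measure M ((*\<^sub>R) r ` A) = r ^ card B * measure M A"
proof -
  define P where "P = (\<Pi>\<^sub>M w\<in>B. lborel :: real measure)"
  have spP: "space P = extensional B" by (simp add: P_def space_PiM PiE_def)
  have BW: "B \<subseteq> W" using B(3) span_superset by blast
  define A0 where "A0 = comb B -` A \<inter> space P"
  have A0: "A0 \<in> sets P"
    unfolding A0_def P_def by (rule measurable_sets[OF comb_measurable[OF B(1) BW] A(1)])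
  define d where "d x = (\<lambda>w\<in>B. x w / r)" for x
  have d: "d \<in> P \<rightarrow>\<^sub>M P" unfolding d_def[abs_def] P_def by measurable
  have A1: "{x \<in> space P. d x \<in> A0} \<in> sets P"
    using measurable_sets[OF d A0] by (simp add: vimage_def Int_def conj_commute)
  have ex: "\<exists>x\<in>space P. z = comb B x" if z: "z \<in> W" for z
  proof -
    obtain l where "z = comb B l" using z B by (auto simp: span_finite comb_def)
    then show ?thesis by (intro bexI[of _ "restrict l B"]) (auto simp: spP)
  qed
  have im: "comb B ` A0 = A"
    using ex A(2) by (auto simp: A0_def) blast
  have im': "comb B ` {x \<in> space P. d x \<in> A0} = (*\<^sub>R) r ` A"
  proof (intro equalityI subsetI)
    fix z assume "z \<in> comb B ` {x \<in> space P. d x \<in> A0}"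
    then obtain x where x: "d x \<in> A0" "z = comb B x" by blast
    have "comb B x = r *\<^sub>R comb B (d x)"
      using r by (auto simp: comb_def d_def scaleR_sum_right intro!: sum.cong)
    then show "z \<in> (*\<^sub>R) r ` A" using x by (auto simp: A0_def)
  next
    fix z assume "z \<in> (*\<^sub>R) r ` A"
    then obtain y where y: "y \<in> A" "z = r *\<^sub>R y" by blast
    then obtain x where x: "x \<in> space P" "y = comb B x" using ex A(2) by blast
    let ?x = "\<lambda>w\<in>B. r * x w"
    have "d ?x = x" using r x(1) by (auto simp: d_def spP fun_eq_iff extensional_def)
    moreover have "comb B ?x = r *\<^sub>R comb B x" by (simp add: comb_def scaleR_sum_right)
    ultimately show "z \<in> comb B ` {x \<in> space P. d x \<in> A0}"
      using x y by (intro image_eqI[of _ _ ?x]) (auto simp: spP A0_def)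
  qed
  have "emeasure P {x \<in> space P. d x \<in> A0} = ennreal (\<Prod>w\<in>B. r) * emeasure P A0"
    using PiM_lborel_scale[OF B(1) _ A0[unfolded P_def], of "\<lambda>_. r"] r by (simp add: P_def d_def)
  then have "measure P {x \<in> space P. d x \<in> A0} = r ^ card B * measure P A0"
    using r by (simp add: measure_def enn2real_mult)
  then show ?thesis
    using measure_comb_image[OF B(1,2) BW A0[unfolded P_def]] measure_comb_image[OF B(1,2) BW A1[unfolded P_def]]
    by (simp add: P_def[symmetric] im im')
qed

section \<open>Minkowski sums through the Cayley trick\<close>

lemma lookup_sum_incl: "Poly_Mapping.lookup (\<Sum>i\<in>I. Poly_Mapping.single i (a i)) k = (if k \<in> I then a k else 0)"
  if "finite I" for a :: "nat \<Rightarrow> real"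
  using that by (simp add: lookup_sum lookup_single when_def)

text \<open>The pair \<open>(i, v)\<close> becomes the i-th unit vector together with
  \<open>v\<close>, so that one equation for \<open>wsum lift\<close> prescribes both the row sums
  and the represented point. Unit vectors are taken in a space of finitely supported functions
  because \<open>N\<close> is a variable.\<close>

definition lift :: "nat \<times> 'v \<Rightarrow> (nat \<Rightarrow>\<^sub>0 real) \<times> 'v" where
  "lift j = (Poly_Mapping.single (fst j) 1, snd j)"

lemma scaleR_single: "r *\<^sub>R Poly_Mapping.single i (1::real) = Poly_Mapping.single i r"
  by (rule poly_mapping_eqI) (simp add: lookup_single when_def)

lemma single_sum: "(\<Sum>j\<in>A. Poly_Mapping.single i (g j)) = Poly_Mapping.single i (\<Sum>j\<in>A. g j)"
  by (induction A rule: infinite_finite_induct) (simp_all add: single_add)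

lemma wsum_lift:
  fixes V :: "nat \<Rightarrow> 'v::real_vector set"
  assumes "\<And>i. i < N \<Longrightarrow> finite (V i)"
  shows "wsum lift (Sigma {..<N} V) l =
    (\<Sum>i<N. Poly_Mapping.single i (\<Sum>v\<in>V i. l (i, v)), \<Sum>i<N. \<Sum>v\<in>V i. l (i, v) *\<^sub>R v)"
proof -
  have "wsum lift (Sigma {..<N} V) l = (\<Sum>i<N. \<Sum>v\<in>V i. l (i, v) *\<^sub>R lift (i, v))"
    unfolding wsum_def using assms by (subst sum.Sigma) auto
  also have "\<dots> = (\<Sum>i<N. Poly_Mapping.single i (\<Sum>v\<in>V i. l (i, v)), \<Sum>i<N. \<Sum>v\<in>V i. l (i, v) *\<^sub>R v)"
    by (simp add: lift_def scaleR_single sum_prod single_sum)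
  finally show ?thesis .
qed

lemma wsum_lift_eq_iff:
  fixes V :: "nat \<Rightarrow> 'v::real_vector set"
  assumes "\<And>i. i < N \<Longrightarrow> finite (V i)"
  shows "wsum lift (Sigma {..<N} V) l = wsum lift (Sigma {..<N} V) m \<longleftrightarrow>
    (\<forall>i<N. (\<Sum>v\<in>V i. l (i, v)) = (\<Sum>v\<in>V i. m (i, v))) \<and>
    (\<Sum>i<N. \<Sum>v\<in>V i. l (i, v) *\<^sub>R v) = (\<Sum>i<N. \<Sum>v\<in>V i. m (i, v) *\<^sub>R v)"
proof -
  have "(\<Sum>i<N. Poly_Mapping.single i (a i)) = (\<Sum>i<N. Poly_Mapping.single i (b i)) \<longleftrightarrow> (\<forall>i<N. a i = b i)"
    for a b :: "nat \<Rightarrow> real"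
  proof
    assume "(\<Sum>i<N. Poly_Mapping.single i (a i)) = (\<Sum>i<N. Poly_Mapping.single i (b i))"
    then have "(if i \<in> {..<N} then a i else 0) = (if i \<in> {..<N} then b i else 0)" for i
      by (metis lookup_sum_incl finite_lessThan)
    then show "\<forall>i<N. a i = b i" by (metis lessThan_iff)
  qed simp
  then show ?thesis by (simp add: wsum_lift[OF assms])
qed

text \<open>The names of the cells. Nonempty entries are required because a row with positive sum
  has a nonzero weight.\<close>

definition supports :: "nat \<Rightarrow> (nat \<times> 'v::real_normed_vector) list \<Rightarrow> (nat \<Rightarrow> 'v set) set" where
  "supports N js = {(\<lambda>i. {v. l (i, v) \<noteq> 0}) | l. lexmin lift js l \<and> (\<forall>i<N. \<exists>v. l (i, v) \<noteq> 0)}"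

definition msum :: "nat \<Rightarrow> (nat \<Rightarrow> 'v::real_vector set) \<Rightarrow> (nat \<Rightarrow> real) \<Rightarrow> 'v set" where
  "msum N K s = {\<Sum>i<N. s i *\<^sub>R x i | x. \<forall>i<N. x i \<in> K i}"

lemma supportsE:
  assumes "S \<in> supports N js" "set js = Sigma {..<N} V"
  obtains l where "lexmin lift js l" "supp l = Sigma {..<N} S" "\<And>i. i < N \<Longrightarrow> S i \<noteq> {}"
    "\<And>i. i < N \<Longrightarrow> S i \<subseteq> V i" "\<And>i. \<not> i < N \<Longrightarrow> S i = {}"
proof -
  obtain l where l: "lexmin lift js l" "\<forall>i<N. \<exists>v. l (i, v) \<noteq> 0" "S = (\<lambda>i. {v. l (i, v) \<noteq> 0})"
    using assms(1) by (auto simp: supports_def)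
  have "\<forall>j. j \<notin> Sigma {..<N} V \<longrightarrow> l j = 0"
    using l(1) unfolding lexmin_def weights_def assms(2) by blast
  then have *: "i < N \<and> v \<in> V i" if "l (i, v) \<noteq> 0" for i v using that by (metis SigmaD1 SigmaD2 lessThan_iff)
  show thesis
    by (rule that[OF l(1)]) (use l * in \<open>auto simp: supp_def\<close>)
qed

lemma finite_supports:
  assumes js: "set js = Sigma {..<N} V"
  shows "finite (supports N js)"
proof -
  have "supports N js \<subseteq> (\<lambda>\<sigma> i. {v. (i, v) \<in> \<sigma>}) ` Pow (set js)"
  proof
    fix S assume "S \<in> supports N js"
    then obtain l where "supp l = Sigma {..<N} S" "\<And>i. i < N \<Longrightarrow> S i \<subseteq> V i" "\<And>i. \<not> i < N \<Longrightarrow> S i = {}"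
      using supportsE[OF _ js] by metis
    moreover from this have "i < N" if "v \<in> S i" for i v using that by (metis empty_iff)
    ultimately have "S = (\<lambda>i. {v. (i, v) \<in> Sigma {..<N} S})" "Sigma {..<N} S \<in> Pow (set js)"
      unfolding js by (auto simp: fun_eq_iff)
    then show "S \<in> (\<lambda>\<sigma> i. {v. (i, v) \<in> \<sigma>}) ` Pow (set js)" by blast
  qed
  then show ?thesis by (rule finite_subset) simp
qed

section \<open>The cells subdivide the Minkowski sum\<close>

context
  fixes V :: "nat \<Rightarrow> 'v::real_normed_vector set" and N :: nat and js :: "(nat \<times> 'v) list"
  assumes fin: "\<And>i. i < N \<Longrightarrow> finite (V i)" and js: "set js = Sigma {..<N} V"
begin

lemma wsum_lift_Sigma: "wsum lift (Sigma {..<N} V) l =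
    (\<Sum>i<N. Poly_Mapping.single i (\<Sum>v\<in>V i. l (i, v)), \<Sum>i<N. \<Sum>v\<in>V i. l (i, v) *\<^sub>R v)"
  by (rule wsum_lift) (rule fin)

lemma wsum_lift_Sigma_eq_iff: "wsum lift (Sigma {..<N} V) l = wsum lift (Sigma {..<N} V) m \<longleftrightarrow>
    (\<forall>i<N. (\<Sum>v\<in>V i. l (i, v)) = (\<Sum>v\<in>V i. m (i, v))) \<and>
    (\<Sum>i<N. \<Sum>v\<in>V i. l (i, v) *\<^sub>R v) = (\<Sum>i<N. \<Sum>v\<in>V i. m (i, v) *\<^sub>R v)"
  by (rule wsum_lift_eq_iff) (rule fin)

text \<open>This is \<open>lexmin_support_independent\<close> for the lifted vectors; it supplies
  the hypothesis \<open>ind\<close> of \<open>cell_measurable\<close> and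
  \<open>measure_cell\<close>.\<close>

lemma supports_independent:
  assumes S: "S \<in> supports N js" and d1: "\<forall>i<N. (\<Sum>v\<in>S i. d i v) = 0"
    and d2: "(\<Sum>i<N. \<Sum>v\<in>S i. d i v *\<^sub>R v) = 0" and iv: "i < N" "v \<in> S i"
  shows "d i v = 0"
proof -
  obtain l where l: "lexmin lift js l" "supp l = Sigma {..<N} S" "\<And>i. i < N \<Longrightarrow> S i \<subseteq> V i"
    using supportsE[OF S js] by metis
  define d' where "d' = (\<lambda>(i, v). if i < N \<and> v \<in> S i then d i v else 0)"
  have sum: "(\<Sum>v\<in>V i. g v (d' (i, v))) = (\<Sum>v\<in>S i. g v (d i v))"
    if "i < N" "\<And>v. g v 0 = 0" for i and g :: "'v \<Rightarrow> real \<Rightarrow> 'b::comm_monoid_add"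
  proof -
    have "(\<Sum>v\<in>V i. g v (d' (i, v))) = (\<Sum>v\<in>S i. g v (d' (i, v)))"
      using l(3)[of i] that fin[of i] by (intro sum.mono_neutral_right) (auto simp: d'_def)
    then show ?thesis using that by (simp add: d'_def)
  qed
  have "wsum lift (set js) d' = wsum lift (set js) (\<lambda>_. 0)"
    unfolding js wsum_lift_Sigma_eq_iff
    using sum[of _ "\<lambda>_ x. x"] sum[of _ "\<lambda>v x. x *\<^sub>R v"] d1 d2 by simp
  then have 0: "wsum lift (set js) d' = 0" by (simp add: wsum_def)
  have "d' j = 0" if "j \<notin> supp l" for j using that by (auto simp: d'_def l(2) split: prod.splits)
  then have "d' (i, v) = 0" using lexmin_support_independent[OF l(1) _ 0] by blast
  then show ?thesis using iv by (simp add: d'_def)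
qed

text \<open>By \<open>lexmin_face\<close> every positive weight on the support of a minimal one is
  minimal too, so all points of a cell have their canonical representation on the same support.
  Disjointness of the cells follows.\<close>

lemma cell_witness:
  assumes S: "S \<in> supports N js" and z: "z \<in> cell N S s"
  obtains m where "lexmin lift js m" "supp m = Sigma {..<N} S"
    "wsum lift (set js) m = (\<Sum>i<N. Poly_Mapping.single i (s i), z)"
proof -
  obtain l where l: "lexmin lift js l" "supp l = Sigma {..<N} S" "\<And>i. i < N \<Longrightarrow> S i \<subseteq> V i"
    using supportsE[OF S js] by metis
  obtain d where d: "\<forall>i<N. \<forall>v\<in>S i. 0 < d i v" "\<forall>i<N. (\<Sum>v\<in>S i. d i v) = s i"
    "z = (\<Sum>i<N. \<Sum>v\<in>S i. d i v *\<^sub>R v)"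
    using z by (auto simp: cell_def)
  define m where "m = (\<lambda>(i, v). if i < N \<and> v \<in> S i then d i v else 0)"
  have sum: "(\<Sum>v\<in>V i. g v (m (i, v))) = (\<Sum>v\<in>S i. g v (d i v))"
    if "i < N" "\<And>v. g v 0 = 0" for i and g :: "'v \<Rightarrow> real \<Rightarrow> 'b::comm_monoid_add"
  proof -
    have "(\<Sum>v\<in>V i. g v (m (i, v))) = (\<Sum>v\<in>S i. g v (m (i, v)))"
      using l(3)[of i] that fin[of i] by (intro sum.mono_neutral_right) (auto simp: m_def)
    then show ?thesis using that by (simp add: m_def)
  qed
  have w: "m \<in> weights (set js)"
    using d(1) l(3) by (auto simp: weights_def m_def js less_imp_le)
  have s: "supp m = Sigma {..<N} S"
    using d(1) by (force simp: supp_def m_def split: if_splits)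
  have "lexmin lift js m" using lexmin_face[OF l(1) w] s l(2) by simp
  moreover have "wsum lift (set js) m = (\<Sum>i<N. Poly_Mapping.single i (s i), z)"
    unfolding js wsum_lift_Sigma
    using sum[of _ "\<lambda>_ x. x"] sum[of _ "\<lambda>v x. x *\<^sub>R v"] d by simp
  ultimately show thesis using s that by blast
qed

lemma cells_disjoint:
  assumes S: "S \<in> supports N js" "S' \<in> supports N js" "S \<noteq> S'"
  shows "cell N S s \<inter> cell N S' s = {}"
proof (rule ccontr)
  assume "cell N S s \<inter> cell N S' s \<noteq> {}"
  then obtain z where z: "z \<in> cell N S s" "z \<in> cell N S' s" by blast
  obtain m where m: "lexmin lift js m" "supp m = Sigma {..<N} S"
    "wsum lift (set js) m = (\<Sum>i<N. Poly_Mapping.single i (s i), z)"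
    using cell_witness[OF S(1) z(1)] .
  obtain m' where m': "lexmin lift js m'" "supp m' = Sigma {..<N} S'"
    "wsum lift (set js) m' = (\<Sum>i<N. Poly_Mapping.single i (s i), z)"
    using cell_witness[OF S(2) z(2)] .
  have "m = m'" using lexmin_unique[OF m(1) m'(1)] m(3) m'(3) by simp
  then have eq: "Sigma {..<N} S = Sigma {..<N} S'" using m(2) m'(2) by simp
  have "S i = S' i" for i
  proof (cases "i < N")
    case True
    have "v \<in> S i \<longleftrightarrow> v \<in> S' i" for v
      using eq True by (metis SigmaE SigmaI lessThan_iff prod.inject)
    then show ?thesis by blast
  next
    case False
    then show ?thesis using supportsE[OF S(1) js] supportsE[OF S(2) js] by metis
  qed
  then show False using S(3) by blast
qed

lemma msum_eq_cells:
  assumes s: "\<And>i. i < N \<Longrightarrow> 0 < s i"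
  shows "msum N (\<lambda>i. convex hull V i) s = (\<Union>S\<in>supports N js. cell N S s)"
proof (intro equalityI subsetI)
  fix z assume "z \<in> msum N (\<lambda>i. convex hull V i) s"
  then obtain x where x: "\<forall>i<N. x i \<in> convex hull V i" "z = (\<Sum>i<N. s i *\<^sub>R x i)"
    by (auto simp: msum_def)
  have "\<forall>i. \<exists>a. i < N \<longrightarrow> (\<forall>v\<in>V i. 0 \<le> a v) \<and> sum a (V i) = 1 \<and> (\<Sum>v\<in>V i. a v *\<^sub>R v) = x i"
    using x(1) fin by (auto simp: convex_hull_finite)
  then obtain a where a: "\<And>i v. i < N \<Longrightarrow> v \<in> V i \<Longrightarrow> 0 \<le> a i v" "\<And>i. i < N \<Longrightarrow> sum (a i) (V i) = 1"
    "\<And>i. i < N \<Longrightarrow> (\<Sum>v\<in>V i. a i v *\<^sub>R v) = x i" by metis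
  define l0 where "l0 = (\<lambda>(i, v). if i < N \<and> v \<in> V i then s i * a i v else 0)"
  define w where "w = wsum lift (set js) l0"
  have w: "w = (\<Sum>i<N. Poly_Mapping.single i (s i), z)"
    unfolding w_def js wsum_lift_Sigma using a
    by (simp add: l0_def x(2) flip: sum_distrib_left scaleR_scaleR scaleR_sum_right)
  have "l0 \<in> weights (set js)"
    using a(1) s by (auto simp: weights_def l0_def js less_imp_le)
  \<comment> \<open>The prescribed row sum bounds every weight of the row; this is the bound that
    \<open>lexmin_exists\<close> asks for.\<close>
  moreover have "m j \<le> Poly_Mapping.lookup (fst w) (fst j)"
    if m: "m \<in> weights (set js)" "wsum lift (set js) m = w" "j \<in> set js" for m j
  proof -
    obtain i v where j: "j = (i, v)" "i < N" "v \<in> V i" using m(3) js by auto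
    have "m (i, v) \<le> (\<Sum>v\<in>V i. m (i, v))"
      using fin j m(1) by (intro member_le_sum) (auto simp: weights_def)
    also have "\<dots> = Poly_Mapping.lookup (fst w) i"
      using j(2) by (simp add: m(2)[symmetric] js wsum_lift_Sigma lookup_sum_incl)
    finally show ?thesis by (simp add: j)
  qed
  ultimately have "\<exists>l. lexmin lift js l \<and> wsum lift (set js) l = w"
    by (intro lexmin_exists[where R="\<lambda>j. Poly_Mapping.lookup (fst w) (fst j)"]) (blast, metis w_def)
  then obtain l where l: "lexmin lift js l" "wsum lift (set js) l = w" by blast
  have ls: "(\<Sum>v\<in>V i. l (i, v)) = s i" if "i < N" for i
  proof -
    have "Poly_Mapping.lookup (fst (wsum lift (set js) l)) i = Poly_Mapping.lookup (fst w) i" by (simp add: l)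
    then show ?thesis using that by (simp add: js wsum_lift_Sigma w lookup_sum_incl)
  qed
  have lz: "(\<Sum>i<N. \<Sum>v\<in>V i. l (i, v) *\<^sub>R v) = z"
    using l(2) by (simp add: js wsum_lift_Sigma w)
  define S where "S i = {v. l (i, v) \<noteq> 0}" for i
  have lw: "l \<in> weights (Sigma {..<N} V)" using l(1) js by (simp add: lexmin_def)
  have SV: "S i \<subseteq> V i" for i using lw by (auto simp: weights_def S_def)
  have sum: "(\<Sum>v\<in>V i. g v (l (i, v))) = (\<Sum>v\<in>S i. g v (l (i, v)))"
    if "i < N" "\<And>v. g v 0 = 0" for i and g :: "'v \<Rightarrow> real \<Rightarrow> 'b::comm_monoid_add"
    using SV[of i] that fin[of i] by (intro sum.mono_neutral_right) (auto simp: S_def)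
  \<comment> \<open>Here positivity of \<open>s i\<close> enters: a row without support would have
    sum 0.\<close>
  have "\<exists>v. l (i, v) \<noteq> 0" if "i < N" for i
  proof (rule ccontr)
    assume "\<not> ?thesis"
    then show False using ls[OF that] s[OF that] by simp
  qed
  then have "S \<in> supports N js" using l(1) by (auto simp: supports_def S_def[abs_def])
  moreover have "z \<in> cell N S s"
  proof -
    have "0 < l (i, v)" if "v \<in> S i" for i v
      using that lw by (simp add: S_def weights_def less_le)
    moreover have "(\<Sum>v\<in>S i. l (i, v)) = s i" if "i < N" for i
      using ls[OF that] sum[OF that, of "\<lambda>_ x. x"] by simp
    moreover have "z = (\<Sum>i<N. \<Sum>v\<in>S i. l (i, v) *\<^sub>R v)"
      unfolding lz[symmetric] using sum[of _ "\<lambda>v x. x *\<^sub>R v"] by simp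
    ultimately show ?thesis unfolding cell_def
      by (intro CollectI exI[of _ "\<lambda>i v. l (i, v)"]) auto
  qed
  ultimately show "z \<in> (\<Union>S\<in>supports N js. cell N S s)" by blast
next
  fix z assume "z \<in> (\<Union>S\<in>supports N js. cell N S s)"
  then obtain S where S: "S \<in> supports N js" "z \<in> cell N S s" by blast
  obtain d where d: "\<forall>i<N. \<forall>v\<in>S i. 0 < d i v" "\<forall>i<N. (\<Sum>v\<in>S i. d i v) = s i"
    "z = (\<Sum>i<N. \<Sum>v\<in>S i. d i v *\<^sub>R v)"
    using S(2) by (auto simp: cell_def)
  have SV: "S i \<subseteq> V i" if "i < N" for i using supportsE[OF S(1) js] that by metis
  define x where "x i = (\<Sum>v\<in>S i. (d i v / s i) *\<^sub>R v)" for i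
  have "x i \<in> convex hull V i" if "i < N" for i
  proof -
    have "x i \<in> convex hull S i"
      unfolding x_def
    proof (rule convex_sum)
      show "finite (S i)" using SV[OF that] fin[OF that] finite_subset by blast
      show "(\<Sum>v\<in>S i. d i v / s i) = 1" using d(2) s[OF that] that by (simp flip: sum_divide_distrib)
      show "0 \<le> d i v / s i" if "v \<in> S i" for v using d(1) s \<open>i < N\<close> that by (simp add: less_imp_le)
    qed (auto intro: hull_inc)
    then show ?thesis using hull_mono[OF SV[OF that]] by blast
  qed
  moreover have "z = (\<Sum>i<N. s i *\<^sub>R x i)"
    unfolding d(3) x_def scaleR_sum_right
    by (intro sum.cong refl) (use s in \<open>auto simp: less_imp_neq[symmetric] dest!: s\<close>)
  ultimately show "z \<in> msum N (\<lambda>i. convex hull V i) s" by (auto simp: msum_def)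
qed

end

lemma supports_append:
  assumes "set js1 \<inter> set js2 = {}"
  shows "supports N js2 \<subseteq> supports N (js1 @ js2)"
  unfolding supports_def using lexmin_append[OF _ assms] by fastforce

section \<open>The volume polynomial of polytopes\<close>

lemma norm_lookup_le: "norm (Poly_Mapping.lookup z l) \<le> norm z" for z :: "nat \<Rightarrow>\<^sub>0 real ^ 'n"
proof (cases "l \<in> Poly_Mapping.keys z")
  case True
  then show ?thesis
    unfolding norm_poly_mapping_def dist_poly_mapping_def
    using member_le_sum[of l "Poly_Mapping.keys z" "\<lambda>k. norm (Poly_Mapping.lookup z k)"] by simp
next
  case False
  then show ?thesis by (simp add: in_keys_iff)
qed

lemma bounded_finite_volM:
  fixes A :: "(nat \<Rightarrow>\<^sub>0 real ^ 'n) set"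
  assumes "bounded A" shows "emeasure (volM p) A < \<infinity>"
proof -
  obtain R where R: "\<And>z. z \<in> A \<Longrightarrow> norm z \<le> R" using assms by (auto simp: bounded_iff)
  define D where "D = {z :: nat \<Rightarrow>\<^sub>0 real ^ 'n. \<forall>l\<in>{1..p}. Poly_Mapping.lookup z l \<in> cball 0 R}"
  have eq: "emb p -` D \<inter> space (power_lborel p) = Pi\<^sub>E {1..p} (\<lambda>l. cball 0 R)"
    by (auto simp: D_def space_power_lborel PiE_def)
  have D: "D \<in> sets (volM p)"
    unfolding sets_volM_iff eq by (intro sets_PiM_I_finite) auto
  interpret product_sigma_finite "\<lambda>_::nat. lborel :: (real ^ 'n) measure" ..
  have "emeasure (volM p) D = (\<Prod>l\<in>{1..p}. emeasure lborel (cball (0 :: real ^ 'n) R))"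
    unfolding emeasure_volM[OF D] eq by (intro emeasure_PiM) auto
  also have "\<dots> < \<infinity>"
    using emeasure_bounded_finite[of "cball (0 :: real ^ 'n) _"]
    by (simp add: less_top[symmetric] power_eq_top_ennreal)
  finally have "emeasure (volM p) D < \<infinity>" .
  moreover have "emeasure (volM p) A \<le> emeasure (volM p) D"
    using R norm_lookup_le order_trans by (intro emeasure_mono D) (fastforce simp: D_def)
  ultimately show ?thesis by order
qed

lemma compact_fmeasurable_volM: "compact A \<Longrightarrow> A \<in> fmeasurable (volM p)"
  by (intro fmeasurableI compact_measurable_volM bounded_finite_volM compact_imp_bounded)

lemma basis_families:
  obtains B :: "(nat \<Rightarrow>\<^sub>0 real ^ 'n) set" where "finite B" "independent B" "span B = families p" "card B = CARD('n) * p"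
proof -
  define I where "I = {1..p} \<times> (Basis :: (real ^ 'n) set)"
  define f where "f = (\<lambda>(l, b :: real ^ 'n). incl l b)"
  have I: "finite I" by (simp add: I_def)
  have sum: "(\<Sum>j\<in>I. c j *\<^sub>R f j) = emb p (\<lambda>l. \<Sum>b\<in>Basis. c (l, b) *\<^sub>R b)" for c
  proof -
    have "(\<Sum>j\<in>I. c j *\<^sub>R f j) = (\<Sum>l\<in>{1..p}. \<Sum>b\<in>Basis. c (l, b) *\<^sub>R incl l b)"
      unfolding I_def by (subst sum.cartesian_product) (auto simp: f_def intro!: sum.cong)
    then show ?thesis
      by (simp add: emb_def linear_sum[OF linear_incl] linear_scale[OF linear_incl])
  qed
  have "\<forall>j\<in>I. c j = 0" if "(\<Sum>j\<in>I. c j *\<^sub>R f j) = 0" for c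
  proof
    fix j assume "j \<in> I"
    then obtain l b where j: "j = (l, b)" "l \<in> {1..p}" "b \<in> Basis" by (auto simp: I_def)
    have "Poly_Mapping.lookup (emb p (\<lambda>l. \<Sum>b\<in>Basis. c (l, b) *\<^sub>R b)) l = 0"
      using that by (simp add: sum)
    then have "(\<Sum>b\<in>Basis. c (l, b) *\<^sub>R b) = 0" using j(2) by simp
    then have "(\<Sum>b\<in>Basis. c (l, b) *\<^sub>R b) \<bullet> b = 0" by simp
    then show "c j = 0" using j by simp
  qed
  note fi = family_independent[where f=f, OF I this]
  have "span (f ` I) = families p"
  proof (intro equalityI subsetI)
    fix z assume "z \<in> span (f ` I)"
    moreover have "f ` I \<subseteq> families p" by (auto simp: f_def I_def families_def lookup_incl)
    ultimately show "z \<in> families p" using span_minimal[OF _ subspace_families] by blast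
  next
    fix z :: "nat \<Rightarrow>\<^sub>0 real ^ 'n" assume "z \<in> families p"
    then have "z = emb p (Poly_Mapping.lookup z)" by (simp add: emb_lookup)
    also have "\<dots> = (\<Sum>j\<in>I. (case j of (l, b) \<Rightarrow> Poly_Mapping.lookup z l \<bullet> b) *\<^sub>R f j)"
      unfolding sum by (simp add: euclidean_representation)
    also have "\<dots> \<in> span (f ` I)" by (intro span_sum span_scale span_base) auto
    finally show "z \<in> span (f ` I)" .
  qed
  moreover have "card (f ` I) = CARD('n) * p"
    using card_image[OF fi(1)] by (simp add: I_def card_cartesian_product)
  ultimately show thesis using that[of "f ` I"] I fi(2) by simp
qed

lemma measure_volM_scale:
  fixes A :: "(nat \<Rightarrow>\<^sub>0 real ^ 'n) set"
  assumes "A \<in> sets (volM p)" "A \<subseteq> families p" "0 < r"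
  shows "measure (volM p) ((*\<^sub>R) r ` A) = r ^ (CARD('n) * p) * measure (volM p) A"
  using basis_families[where 'n='n and p=p] volM.measure_scale assms by metis

lemma compact_msum:
  fixes K :: "nat \<Rightarrow> 'v::real_normed_vector set"
  shows "(\<And>i. i < N \<Longrightarrow> compact (K i)) \<Longrightarrow> compact (msum N K s)"
proof (induction N)
  case 0
  then show ?case by (simp add: msum_def)
next
  case (Suc N)
  have "msum (Suc N) K s = {x + y | x y. x \<in> msum N K s \<and> y \<in> (*\<^sub>R) (s N) ` K N}"
  proof (intro equalityI subsetI)
    fix z assume "z \<in> msum (Suc N) K s"
    then obtain x where "z = (\<Sum>i<N. s i *\<^sub>R x i) + s N *\<^sub>R x N" "\<forall>i<Suc N. x i \<in> K i"
      by (auto simp: msum_def)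
    then show "z \<in> {x + y | x y. x \<in> msum N K s \<and> y \<in> (*\<^sub>R) (s N) ` K N}"
      unfolding msum_def
      by (intro CollectI exI[of _ "\<Sum>i<N. s i *\<^sub>R x i"] exI[of _ "s N *\<^sub>R x N"]) auto
  next
    fix z assume "z \<in> {x + y | x y. x \<in> msum N K s \<and> y \<in> (*\<^sub>R) (s N) ` K N}"
    then obtain x y where "z = (\<Sum>i<N. s i *\<^sub>R x i) + s N *\<^sub>R y" "\<forall>i<N. x i \<in> K i" "y \<in> K N"
      by (auto simp: msum_def)
    then show "z \<in> msum (Suc N) K s"
      unfolding msum_def by (intro CollectI exI[of _ "x(N := y)"]) (auto simp: less_Suc_eq)
  qed
  also have "compact \<dots>"
    using Suc by (intro compact_sums compact_scaling) auto
  finally show ?case .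
qed

lemma msum_scale: "msum N K (\<lambda>i. r * s i) = (*\<^sub>R) r ` msum N K s"
proof -
  have "(\<Sum>i<N. (r * s i) *\<^sub>R x i) = r *\<^sub>R (\<Sum>i<N. s i *\<^sub>R x i)" for x :: "nat \<Rightarrow> 'a"
    by (simp add: scaleR_sum_right)
  then show ?thesis unfolding msum_def by (simp add: image_Collect) (metis (no_types, lifting))
qed

lemma msum_subset_families: "(\<And>i. i < N \<Longrightarrow> K i \<subseteq> families p) \<Longrightarrow> msum N K s \<subseteq> families p"
  unfolding msum_def using subspace_families[of p]
  by (auto intro!: subspace_sum subspace_scale)

lemma msum_const:
  fixes K :: "'v::real_vector set"
  assumes K: "convex K" and N: "0 < N" and s: "\<And>i. i < N \<Longrightarrow> 0 < s i"
  shows "msum N (\<lambda>_. K) s = (*\<^sub>R) (\<Sum>i<N. s i) ` K"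
proof (intro equalityI subsetI)
  have pos: "0 < (\<Sum>i<N. s i)" using N s by (intro sum_pos) auto
  fix z assume "z \<in> msum N (\<lambda>_. K) s"
  then obtain x where x: "\<forall>i<N. x i \<in> K" "z = (\<Sum>i<N. s i *\<^sub>R x i)" by (auto simp: msum_def)
  have "(\<Sum>i<N. (s i / (\<Sum>i<N. s i)) *\<^sub>R x i) \<in> K"
    using K x(1) s pos by (intro convex_sum) (auto simp: less_imp_le simp flip: sum_divide_distrib)
  moreover have "z = (\<Sum>i<N. s i) *\<^sub>R (\<Sum>i<N. (s i / (\<Sum>i<N. s i)) *\<^sub>R x i)"
    using pos by (simp add: x(2) scaleR_sum_right)
  ultimately show "z \<in> (*\<^sub>R) (\<Sum>i<N. s i) ` K" by blast
next
  fix z assume "z \<in> (*\<^sub>R) (\<Sum>i<N. s i) ` K"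
  then obtain y where "y \<in> K" "z = (\<Sum>i<N. s i *\<^sub>R y)" by (auto simp: scaleR_left.sum)
  then show "z \<in> msum N (\<lambda>_. K) s" unfolding msum_def by (intro CollectI exI[of _ "\<lambda>_. y"]) auto
qed

context
  fixes p N :: nat and V :: "nat \<Rightarrow> (nat \<Rightarrow>\<^sub>0 real ^ 'n) set" and js
  assumes N: "N = CARD('n) * p" "0 < N"
    and fin: "\<And>i. i < N \<Longrightarrow> finite (V i)" and V: "\<And>i. i < N \<Longrightarrow> V i \<subseteq> families p"
    and js: "set js = Sigma {..<N} V"
begin

lemma measure_msum_cells:
  assumes s: "\<And>i. i < N \<Longrightarrow> 0 < s i"
  shows "measure (volM p) (msum N (\<lambda>i. convex hull V i) s) =
    (\<Sum>S\<in>supports N js. measure (volM p) (cell N S (\<lambda>_. 1)) * (\<Prod>i<N. s i ^ (card (S i) - 1)))"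
proof -
  have c: "compact (msum N (\<lambda>i. convex hull V i) s)"
    using fin by (intro compact_msum finite_imp_compact_convex_hull)
  have cl: "cell N S s \<in> sets (volM p) \<and> measure (volM p) (cell N S s) =
      (\<Prod>i<N. s i ^ (card (S i) - 1)) * measure (volM p) (cell N S (\<lambda>_. 1))" if S: "S \<in> supports N js" for S
  proof -
    have SV: "i < N \<Longrightarrow> S i \<subseteq> V i" "i < N \<Longrightarrow> S i \<noteq> {}" for i using supportsE[OF S js] by metis+
    have 1: "finite (S i)" "S i \<subseteq> families p" if "i < N" for i
      using SV[OF that] fin[OF that] V[OF that] finite_subset by blast+
    show ?thesis
      by (intro conjI volM.cell_measurable volM.measure_cell)
         (use 1 SV(2) s supports_independent[OF fin js S] in auto)
  qed
  have eq: "msum N (\<lambda>i. convex hull V i) s = (\<Union>S\<in>supports N js. cell N S s)"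
    by (rule msum_eq_cells) (use fin js s in auto)
  have "measure (volM p) (\<Union>S\<in>supports N js. cell N S s) = (\<Sum>S\<in>supports N js. measure (volM p) (cell N S s))"
  proof (rule measure_finite_Union)
    show "finite (supports N js)" by (rule finite_supports[OF js])
    show "disjoint_family_on (\<lambda>S. cell N S s) (supports N js)"
      unfolding disjoint_family_on_def using cells_disjoint[OF fin js] by blast
    show "emeasure (volM p) (cell N S s) \<noteq> \<infinity>" if "S \<in> supports N js" for S
    proof -
      have "emeasure (volM p) (cell N S s) \<le> emeasure (volM p) (msum N (\<lambda>i. convex hull V i) s)"
        using that eq compact_measurable_volM[OF c] by (intro emeasure_mono) auto
      then show ?thesis using bounded_finite_volM[OF compact_imp_bounded[OF c], of p] by (auto simp: top_unique)
    qed
  qed (use cl in auto)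
  then show ?thesis unfolding eq using cl by (simp add: mult.commute)
qed

text \<open>When all factors equal \<open>r\<close>, the whole sum grows like \<open>r ^ N\<close>,
  but the cell grows like \<open>r ^ d\<close> with \<open>d\<close> the sum of its exponents; so a
  cell of positive volume has \<open>d \<le> N\<close>. This confines all exponents to one finite
  set that does not depend on the polytopes.\<close>

lemma cell_degree:
  assumes S: "S \<in> supports N js" and ne: "measure (volM p) (cell N S (\<lambda>_. 1)) \<noteq> 0" and i: "i < N"
  shows "card (S i) - 1 \<le> N"
proof (rule ccontr)
  let ?F = "\<lambda>s. measure (volM p) (msum N (\<lambda>i. convex hull V i) s)"
  let ?c = "measure (volM p) (cell N S (\<lambda>_. 1))"
  assume no: "\<not> card (S i) - 1 \<le> N"
  define d where "d = (\<Sum>i<N. card (S i) - 1)"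
  have "card (S i) - 1 \<le> d" unfolding d_def using i by (intro member_le_sum) auto
  then have "N < d" using no by simp
  have c: "0 < ?c" using ne by (simp add: less_le)
  have cpt: "compact (msum N (\<lambda>i. convex hull V i) (\<lambda>_. 1))"
    using fin by (intro compact_msum finite_imp_compact_convex_hull)
  have "convex hull V i \<subseteq> families p" if "i < N" for i
    using V[OF that] subspace_imp_convex[OF subspace_families] by (rule hull_minimal)
  then have sub: "msum N (\<lambda>i. convex hull V i) (\<lambda>_. 1) \<subseteq> families p" by (rule msum_subset_families)
  \<comment> \<open>With this value \<open>?c * r\<close> exceeds \<open>?F (\<lambda>_. 1)\<close>,
    against the comparison of growth.\<close>
  define r where "r = 1 + ?F (\<lambda>_. 1) / ?c"
  have r: "1 \<le> r" using c by (simp add: r_def)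
  have "?c * r ^ d \<le> ?F (\<lambda>_. r)"
  proof -
    have "?c * r ^ d = ?c * (\<Prod>i<N. r ^ (card (S i) - 1))" by (simp add: d_def power_sum)
    also have "\<dots> \<le> ?F (\<lambda>_. r)"
      using r S finite_supports[OF js]
      by (subst measure_msum_cells) (auto intro!: member_le_sum[where f="\<lambda>S. measure (volM p) (cell N S (\<lambda>_. 1)) * (\<Prod>i<N. r ^ (card (S i) - 1))"] mult_nonneg_nonneg prod_nonneg)
    finally show ?thesis .
  qed
  also have "msum N (\<lambda>i. convex hull V i) (\<lambda>_. r) = (*\<^sub>R) r ` msum N (\<lambda>i. convex hull V i) (\<lambda>_. 1)"
    using msum_scale[of N _ r "\<lambda>_. 1"] by simp
  also have "measure (volM p) \<dots> = r ^ N * ?F (\<lambda>_. 1)"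
    using measure_volM_scale[OF compact_measurable_volM[OF cpt] sub, of r] r by (simp add: N(1))
  finally have "?c * r ^ d \<le> r ^ N * ?F (\<lambda>_. 1)" .
  moreover have "r ^ (N + 1) \<le> r ^ d" using r \<open>N < d\<close> by (intro power_increasing) auto
  ultimately have "?c * r ^ (N + 1) \<le> r ^ N * ?F (\<lambda>_. 1)"
    using c by (meson mult_left_mono less_imp_le order_trans)
  then have "r ^ N * (?c * r) \<le> r ^ N * ?F (\<lambda>_. 1)" by (simp add: power_add mult_ac)
  then have "?c * r \<le> ?F (\<lambda>_. 1)" using r by (simp add: mult_le_cancel_left)
  moreover have "?c * r = ?c + ?F (\<lambda>_. 1)" using c by (simp add: r_def distrib_left)
  ultimately show False using c by simp
qed

end

text \<open>The subdivision requires positive factors, but the derivative at 0 is taken on the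
  boundary; shifting all factors by the same positive amount and letting it tend to 0 closes the
  gap.\<close>

lemma nonneg_poly_eqI:
  fixes f g :: "(nat \<Rightarrow> real) \<Rightarrow> real"
  assumes eq: "\<And>s. (\<And>i. 0 < s i) \<Longrightarrow> f s = g s"
    and f: "\<And>s. continuous_on UNIV (\<lambda>e. f (\<lambda>i. s i + e))" and g: "\<And>s. continuous_on UNIV (\<lambda>e. g (\<lambda>i. s i + e))"
    and s: "\<And>i. 0 \<le> s i"
  shows "f s = g s"
proof (rule tendsto_unique[OF trivial_limit_at_right_real[of 0]])
  have c: "((\<lambda>e. h (\<lambda>i. s i + e)) \<longlongrightarrow> h s) (at_right 0)" if "continuous_on UNIV (\<lambda>e. h (\<lambda>i. s i + e))"
    for h :: "(nat \<Rightarrow> real) \<Rightarrow> real"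
    using that by (auto simp: continuous_on_def dest!: spec[of _ 0] intro: tendsto_within_subset)
  show "((\<lambda>e. g (\<lambda>i. s i + e)) \<longlongrightarrow> g s) (at_right 0)" by (rule c[OF g])
  have "eventually (\<lambda>e. f (\<lambda>i. s i + e) = g (\<lambda>i. s i + e)) (at_right (0::real))"
    using eventually_at_right_less[of 0]
  proof eventually_elim
    case (elim e)
    then have "0 < s i + e" for i using s[of i] by simp
    then show ?case by (rule eq)
  qed
  then show "((\<lambda>e. g (\<lambda>i. s i + e)) \<longlongrightarrow> f s) (at_right 0)"
    using c[OF f] by (rule tendsto_cong[THEN iffD1])
qed

text \<open>For \<open>N\<close> copies of one polytope, the volume is also the volume of the
  polytope times the N-th power of the sum of the factors; the mixed derivatives of the two
  expressions agree.\<close>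

lemma coefficient_hull:
  fixes W :: "(nat \<Rightarrow>\<^sub>0 real ^ 'n) set"
  assumes N: "N = CARD('n) * p" "0 < N" and W: "finite W" "W \<subseteq> families p" and js: "set js = Sigma {..<N} (\<lambda>_. W)"
  shows "(\<Sum>S | S \<in> supports N js \<and> (\<forall>i<N. card (S i) - 1 = 1). measure (volM p) (cell N S (\<lambda>_. 1))) =
    fact N * measure (volM p) (convex hull W)"
proof -
  let ?c = "\<lambda>S. measure (volM p) (cell N S (\<lambda>_. 1))"
  let ?F = "\<lambda>s. \<Sum>S\<in>supports N js. ?c S * (\<Prod>i<N. s i ^ (card (S i) - 1))"
  let ?G = "\<lambda>s. measure (volM p) (convex hull W) * (\<Sum>i<N. s i) ^ N"
  have hW: "convex hull W \<subseteq> families p"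
    using W(2) subspace_imp_convex[OF subspace_families] by (rule hull_minimal)
  have pos: "?F s = ?G s" if s: "\<And>i. 0 < s i" for s
  proof -
    have "?F s = measure (volM p) (msum N (\<lambda>i. convex hull W) s)"
      by (rule measure_msum_cells[symmetric]) (use N W js s in auto)
    also have "msum N (\<lambda>i. convex hull W) s = (*\<^sub>R) (\<Sum>i<N. s i) ` (convex hull W)"
      using N s by (intro msum_const) auto
    also have "measure (volM p) \<dots> = (\<Sum>i<N. s i) ^ N * measure (volM p) (convex hull W)"
    proof -
      have "0 < (\<Sum>i<N. s i)" using N(2) s by (intro sum_pos) auto
      then show ?thesis
        using measure_volM_scale[OF compact_measurable_volM[OF finite_imp_compact_convex_hull[OF W(1)]] hW] N(1) by simp
    qed
    finally show ?thesis by simp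
  qed
  have FG: "?F s = ?G s" if "\<And>i. 0 \<le> s i" for s
    by (rule nonneg_poly_eqI[where f="?F" and g="?G"]) (use pos that in \<open>auto intro!: continuous_intros\<close>)
  have "(\<Sum>S | S \<in> supports N js \<and> (\<forall>i<N. card (S i) - 1 = 1). ?c S) = mixed_partial N ?F (\<lambda>_. 0)"
    by (rule mixed_partial_poly_0[symmetric]) (auto intro: finite_supports[OF js])
  also have "\<dots> = fact N * measure (volM p) (convex hull W)"
    using mixed_partial_power[where F="?F" and s="\<lambda>_. 0" and m=N and N=N, OF FG] by simp
  finally show ?thesis .
qed

text \<open>The coefficient with all exponents 1 is what the mixed derivative extracts. It is
  compared with the same coefficient for \<open>N\<close> copies of the hull of the union
  \<open>W\<close>, which \<open>coefficient_hull\<close> evaluates.\<close>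

lemma polytope_polynomial:
  fixes V :: "nat \<Rightarrow> (nat \<Rightarrow>\<^sub>0 real ^ 'n) set"
  assumes N: "N = CARD('n) * p" "0 < N"
    and fin: "\<And>i. i < N \<Longrightarrow> finite (V i)" and V: "\<And>i. i < N \<Longrightarrow> V i \<subseteq> families p"
  obtains c :: "(nat \<Rightarrow> nat) \<Rightarrow> real" where "\<And>k. 0 \<le> c k"
    "\<And>s. (\<And>i. i < N \<Longrightarrow> 0 < s i) \<Longrightarrow> measure (volM p) (msum N (\<lambda>i. convex hull V i) s) =
       (\<Sum>k\<in>Pi\<^sub>E {..<N} (\<lambda>_. {..N}). c k * (\<Prod>i<N. s i ^ k i))"
    "c (\<lambda>i\<in>{..<N}. 1) \<le> fact N * measure (volM p) (convex hull (\<Union>i<N. V i))"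
proof -
  define W where "W = (\<Union>i<N. V i)"
  have W: "finite W" "W \<subseteq> families p" using fin V by (auto simp: W_def)
  have "finite (Sigma {..<N} V)" using fin by auto
  then obtain js where js: "set js = Sigma {..<N} V" using finite_list by blast
  \<comment> \<open>The pairs added on passing to \<open>W\<close> go to the front of the list, as
    \<open>lexmin_append\<close> requires.\<close>
  have "finite (Sigma {..<N} (\<lambda>_. W) - Sigma {..<N} V)" using W by auto
  then obtain js1 where js1: "set js1 = Sigma {..<N} (\<lambda>_. W) - Sigma {..<N} V" using finite_list by blast
  have jsW: "set (js1 @ js) = Sigma {..<N} (\<lambda>_. W)" using js js1 by (auto simp: W_def)
  let ?c = "\<lambda>S. measure (volM p) (cell N S (\<lambda>_. 1))"
  let ?K = "Pi\<^sub>E {..<N} (\<lambda>_. {..N})"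
  define e where "e S = (\<lambda>i\<in>{..<N}. card (S i) - 1)" for S :: "nat \<Rightarrow> (nat \<Rightarrow>\<^sub>0 real ^ 'n) set"
  \<comment> \<open>Cells of volume 0 are left out because \<open>cell_degree\<close> bounds the
    exponents of the others only.\<close>
  define c where "c k = (\<Sum>S | S \<in> supports N js \<and> ?c S \<noteq> 0 \<and> e S = k. ?c S)" for k
  have fs: "finite (supports N js)" by (rule finite_supports[OF js])
  show thesis
  proof (rule that)
    show "0 \<le> c k" for k by (simp add: c_def sum_nonneg)
    show "measure (volM p) (msum N (\<lambda>i. convex hull V i) s) = (\<Sum>k\<in>?K. c k * (\<Prod>i<N. s i ^ k i))"
      if s: "\<And>i. i < N \<Longrightarrow> 0 < s i" for s
    proof -
      let ?T = "{S \<in> supports N js. ?c S \<noteq> 0}"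
      have "measure (volM p) (msum N (\<lambda>i. convex hull V i) s) =
          (\<Sum>S\<in>supports N js. ?c S * (\<Prod>i<N. s i ^ (card (S i) - 1)))"
        by (rule measure_msum_cells) (use N fin V js s in auto)
      also have "\<dots> = (\<Sum>S\<in>?T. ?c S * (\<Prod>i<N. s i ^ e S i))"
        using fs by (intro sum.mono_neutral_cong_right) (auto simp: e_def)
      also have "\<dots> = (\<Sum>k\<in>?K. \<Sum>S | S \<in> ?T \<and> e S = k. ?c S * (\<Prod>i<N. s i ^ e S i))"
      proof (rule sum.group[symmetric])
        show "e ` ?T \<subseteq> ?K"
        proof (rule image_subsetI)
          fix S assume "S \<in> ?T"
          then show "e S \<in> ?K"
            unfolding e_def restrict_PiE_iff using cell_degree[OF N fin V js] by simp
        qed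
      qed (use fs in \<open>auto intro: finite_PiE\<close>)
      also have "\<dots> = (\<Sum>k\<in>?K. c k * (\<Prod>i<N. s i ^ k i))"
        by (intro sum.cong refl) (auto simp: c_def sum_distrib_right conj_assoc intro!: sum.cong)
      finally show ?thesis .
    qed
    have "c (\<lambda>i\<in>{..<N}. 1) \<le> (\<Sum>S | S \<in> supports N (js1 @ js) \<and> (\<forall>i<N. card (S i) - 1 = 1). ?c S)"
      unfolding c_def
    proof (rule sum_mono2)
      show "finite {S \<in> supports N (js1 @ js). \<forall>i<N. card (S i) - 1 = 1}"
        using finite_supports[OF jsW] by simp
      have "supports N js \<subseteq> supports N (js1 @ js)" using js js1 by (intro supports_append) auto
      moreover have "card (S i) - 1 = 1" if "e S = (\<lambda>i\<in>{..<N}. 1)" "i < N" for S i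
        using fun_cong[OF that(1), of i] that(2) by (simp add: e_def)
      ultimately show "{S \<in> supports N js. ?c S \<noteq> 0 \<and> e S = (\<lambda>i\<in>{..<N}. 1)}
          \<subseteq> {S \<in> supports N (js1 @ js). \<forall>i<N. card (S i) - 1 = 1}" by blast
    qed simp
    also have "\<dots> = fact N * measure (volM p) (convex hull W)"
      by (rule coefficient_hull[OF N W jsW])
    finally show "c (\<lambda>i\<in>{..<N}. 1) \<le> fact N * measure (volM p) (convex hull (\<Union>i<N. V i))"
      by (simp add: W_def)
  qed
qed

section \<open>The volume polynomial of linear images of a convex body\<close>

lemma interior_point_finite_hull:
  fixes K :: "'a::euclidean_space set"
  assumes "y \<in> interior K"
  shows "\<exists>V. finite V \<and> V \<subseteq> K \<and> y \<in> interior (convex hull V)"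
proof -
  obtain e where e: "0 < e" "ball y e \<subseteq> K" using assms mem_interior by blast
  \<comment> \<open>The half-side of a cube inside \<open>ball y e\<close>: on it the 1-norm of the
    distance to \<open>y\<close> is at most \<open>e / 2\<close>.\<close>
  define d where "d = e / (2 * real DIM('a))"
  have d: "0 < d" using e(1) by (simp add: d_def)
  define u where "u = (\<Sum>i\<in>Basis. d *\<^sub>R i :: 'a)"
  obtain V where V: "finite V" "cbox (y - u) (y + u) = convex hull V"
    using cube_convex_hull[OF d, of y] unfolding u_def by blast
  have ub: "u \<bullet> i = d" if "i \<in> Basis" for i
    using that by (simp add: u_def)
  have "cbox (y - u) (y + u) \<subseteq> ball y e"
  proof
    fix z assume z: "z \<in> cbox (y - u) (y + u)"
    have "norm (z - y) \<le> (\<Sum>i\<in>Basis. \<bar>(z - y) \<bullet> i\<bar>)" by (rule norm_le_l1)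
    also have "\<dots> \<le> (\<Sum>i\<in>(Basis::'a set). d)"
      using z ub by (intro sum_mono) (auto simp: mem_box inner_diff_left inner_add_left abs_le_iff algebra_simps)
    also have "\<dots> < e" using e(1) by (simp add: d_def)
    finally show "z \<in> ball y e" by (simp add: dist_norm norm_minus_commute)
  qed
  then have "V \<subseteq> K" using V(2) e(2) hull_subset[of V convex] by blast
  moreover have "y \<in> box (y - u) (y + u)" using d ub by (simp add: mem_box inner_diff_left inner_add_left)
  then have "y \<in> interior (convex hull V)" by (simp flip: V(2))
  ultimately show ?thesis using V(1) by blast
qed

text \<open>The copy of \<open>K\<close> shrunk towards \<open>x0\<close> is compact and lies in the
  interior of \<open>K\<close>, so the interiors of finitely many polytopes with vertices in
  \<open>K\<close> cover it.\<close>

lemma polytope_approximation: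
  fixes K :: "'a::euclidean_space set"
  assumes K: "convex K" "compact K" and x0: "x0 \<in> interior K" and e: "0 < e" "e \<le> 1"
  obtains V where "finite V" "V \<subseteq> K" "\<And>x. x \<in> K \<Longrightarrow> x - e *\<^sub>R (x - x0) \<in> convex hull V"
proof -
  let ?g = "\<lambda>x. x - e *\<^sub>R (x - x0)"
  let ?\<V> = "{V. finite V \<and> V \<subseteq> K}"
  have cov: "?g ` K \<subseteq> \<Union>((\<lambda>V. interior (convex hull V)) ` ?\<V>)"
  proof
    fix y assume "y \<in> ?g ` K"
    then have "y \<in> interior K" using mem_interior_convex_shrink[OF K(1) x0 _ e] by blast
    then show "y \<in> \<Union>((\<lambda>V. interior (convex hull V)) ` ?\<V>)"
      using interior_point_finite_hull by blast
  qed
  have cpt: "compact (?g ` K)" using K(2) by (intro compact_continuous_image continuous_intros)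
  obtain \<V>' where V': "\<V>' \<subseteq> ?\<V>" "finite \<V>'" "?g ` K \<subseteq> (\<Union>V\<in>\<V>'. interior (convex hull V))"
    by (rule compactE_image[OF cpt _ cov]) auto
  define V where "V = \<Union>\<V>'"
  have "finite V" "V \<subseteq> K" using V'(1,2) by (auto simp: V_def)
  moreover have "?g x \<in> convex hull V" if x: "x \<in> K" for x
  proof -
    have "?g x \<in> (\<Union>V\<in>\<V>'. interior (convex hull V))" using V'(3) x by (rule subsetD[OF _ imageI])
    then obtain U where "U \<in> \<V>'" "?g x \<in> interior (convex hull U)" by (elim UN_E)
    moreover have "convex hull U \<subseteq> convex hull V" using \<open>U \<in> \<V>'\<close> by (intro hull_mono) (auto simp: V_def)
    ultimately show ?thesis using interior_subset[of "convex hull U"] by (meson subsetD)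
  qed
  ultimately show thesis by (rule that)
qed

text \<open>Bolzano-Weierstrass, one index at a time.\<close>

lemma finite_convergent_subsequence:
  fixes a :: "nat \<Rightarrow> 'k \<Rightarrow> real"
  assumes "finite A" "\<And>k m. k \<in> A \<Longrightarrow> 0 \<le> a m k" "\<And>k m. k \<in> A \<Longrightarrow> a m k \<le> R"
  shows "\<exists>r l. strict_mono (r :: nat \<Rightarrow> nat) \<and> (\<forall>k\<in>A. (\<lambda>m. a (r m) k) \<longlonglongrightarrow> l k)"
  using assms
proof (induction A rule: finite_induct)
  case empty
  then show ?case using strict_mono_id by blast
next
  case (insert k A)
  have "\<exists>r l. strict_mono (r :: nat \<Rightarrow> nat) \<and> (\<forall>k\<in>A. (\<lambda>m. a (r m) k) \<longlonglongrightarrow> l k)"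
    by (rule insert.IH) (use insert.prems in auto)
  then obtain r l where r: "strict_mono r" "\<forall>k\<in>A. (\<lambda>m. a (r m) k) \<longlonglongrightarrow> l k" by blast
  have "a (r m) k \<in> {0..R}" for m using insert.prems(1)[of k "r m"] insert.prems(2)[of k "r m"] by simp
  then obtain q x where q: "strict_mono q" "((\<lambda>m. a (r m) k) \<circ> q) \<longlonglongrightarrow> x"
    using seq_compactE[OF compact_imp_seq_compact[OF compact_Icc[of 0 R]], of "\<lambda>m. a (r m) k"] by metis
  have "(\<lambda>m. a ((r \<circ> q) m) k') \<longlonglongrightarrow> (l(k := x)) k'" if "k' \<in> insert k A" for k'
  proof (cases "k' = k")
    case True
    then show ?thesis using q(2) by (simp add: o_def)
  next
    case False
    then have "(\<lambda>m. a (r m) k') \<longlonglongrightarrow> l k'" using that r(2) by simp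
    then show ?thesis using LIMSEQ_subseq_LIMSEQ[OF _ q(1)] False by (fastforce simp: o_def)
  qed
  moreover have "strict_mono (r \<circ> q)" using r(1) q(1) by (rule strict_mono_o)
  ultimately show ?case by blast
qed

lemma msum_mono: "(\<And>i. i < N \<Longrightarrow> K i \<subseteq> L i) \<Longrightarrow> msum N K s \<subseteq> msum N L s"
  unfolding msum_def by blast

lemma msum_translate:
  fixes f :: "nat \<Rightarrow> 'a::real_vector \<Rightarrow> 'v::real_vector"
  assumes f: "\<And>i. i < N \<Longrightarrow> linear (f i)"
  shows "msum N (\<lambda>i. f i ` (\<lambda>y. y - x) ` K) s = (+) (- (\<Sum>i<N. s i *\<^sub>R f i x)) ` msum N (\<lambda>i. f i ` K) s"
proof -
  have eq: "(\<Sum>i<N. s i *\<^sub>R f i (y i - x)) = - (\<Sum>i<N. s i *\<^sub>R f i x) + (\<Sum>i<N. s i *\<^sub>R f i (y i))" for y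
    using f by (simp add: linear_diff scaleR_diff_right sum_subtractf)
  show ?thesis
  proof (intro equalityI subsetI)
    fix z assume "z \<in> msum N (\<lambda>i. f i ` (\<lambda>y. y - x) ` K) s"
    then obtain u where u: "\<forall>i<N. u i \<in> f i ` (\<lambda>y. y - x) ` K" "z = (\<Sum>i<N. s i *\<^sub>R u i)" by (auto simp: msum_def)
    then have "\<forall>i. \<exists>y. i < N \<longrightarrow> y \<in> K \<and> u i = f i (y - x)" by blast
    then obtain y where y: "\<And>i. i < N \<Longrightarrow> y i \<in> K \<and> u i = f i (y i - x)" by metis
    then have "z = - (\<Sum>i<N. s i *\<^sub>R f i x) + (\<Sum>i<N. s i *\<^sub>R f i (y i))" using u(2) eq[of y] by simp
    moreover have "(\<Sum>i<N. s i *\<^sub>R f i (y i)) \<in> msum N (\<lambda>i. f i ` K) s"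
      using y unfolding msum_def by (intro CollectI exI[of _ "\<lambda>i. f i (y i)"]) auto
    ultimately show "z \<in> (+) (- (\<Sum>i<N. s i *\<^sub>R f i x)) ` msum N (\<lambda>i. f i ` K) s" by blast
  next
    fix z assume "z \<in> (+) (- (\<Sum>i<N. s i *\<^sub>R f i x)) ` msum N (\<lambda>i. f i ` K) s"
    then obtain u where u: "\<forall>i<N. u i \<in> f i ` K" "z = - (\<Sum>i<N. s i *\<^sub>R f i x) + (\<Sum>i<N. s i *\<^sub>R u i)"
      by (auto simp: msum_def)
    then have "\<forall>i. \<exists>y. i < N \<longrightarrow> y \<in> K \<and> u i = f i y" by blast
    then obtain y where y: "\<And>i. i < N \<Longrightarrow> y i \<in> K \<and> u i = f i (y i)" by metis
    then have "z = (\<Sum>i<N. s i *\<^sub>R f i (y i - x))" using u(2) by (simp add: eq)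
    then show "z \<in> msum N (\<lambda>i. f i ` (\<lambda>y. y - x) ` K) s"
      using y unfolding msum_def by (intro CollectI exI[of _ "\<lambda>i. f i (y i - x)"]) auto
  qed
qed

section \<open>Sums of linear images of one convex body\<close>

context
  fixes p N :: nat and f :: "nat \<Rightarrow> real ^ 'n \<Rightarrow> (nat \<Rightarrow>\<^sub>0 real ^ 'n)"
  assumes N: "N = CARD('n) * p" "0 < N"
    and f: "\<And>i. i < N \<Longrightarrow> linear (f i)" and fW: "\<And>i x. i < N \<Longrightarrow> f i x \<in> families p"
begin

abbreviation volsum :: "(real ^ 'n) set \<Rightarrow> (nat \<Rightarrow> real) \<Rightarrow> real" where
  "volsum K s \<equiv> measure (volM p) (msum N (\<lambda>i. f i ` K) s)"

lemma compact_image_f: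
  assumes "i < N" "compact K" shows "compact (f i ` K)"
proof -
  have "f i x = (\<Sum>b\<in>Basis. (x \<bullet> b) *\<^sub>R f i b)" for x
  proof -
    have "f i x = f i (\<Sum>b\<in>Basis. (x \<bullet> b) *\<^sub>R b)" by (simp only: euclidean_representation)
    then show ?thesis by (simp only: linear_sum[OF f[OF assms(1)]] linear_scale[OF f[OF assms(1)]])
  qed
  then have "f i = (\<lambda>x. \<Sum>b\<in>Basis. (x \<bullet> b) *\<^sub>R f i b)" ..
  moreover have "continuous_on K (\<lambda>x. \<Sum>b\<in>Basis. (x \<bullet> b) *\<^sub>R f i b)" by (intro continuous_intros)
  ultimately have "continuous_on K (f i)" by metis
  then show ?thesis using assms(2) by (rule compact_continuous_image)
qed

lemma compact_msum_f: "compact K \<Longrightarrow> compact (msum N (\<lambda>i. f i ` K) s)"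
  by (intro compact_msum compact_image_f)

lemma msum_f_families: "msum N (\<lambda>i. f i ` K) s \<subseteq> families p"
  using fW by (intro msum_subset_families) auto

lemma volsum_mono: "compact K \<Longrightarrow> compact L \<Longrightarrow> K \<subseteq> L \<Longrightarrow> volsum K s \<le> volsum L s"
  by (intro measure_mono_fmeasurable msum_mono image_mono fmeasurableD compact_fmeasurable_volM compact_msum_f)

lemma volsum_translate:
  assumes "compact K" shows "volsum ((\<lambda>y. y - x) ` K) s = volsum K s"
proof -
  have "(\<Sum>i<N. s i *\<^sub>R f i x) \<in> families p"
    using fW subspace_families by (intro subspace_sum subspace_scale) auto
  then have "- (\<Sum>i<N. s i *\<^sub>R f i x) \<in> families p"
    using subspace_families by (rule_tac subspace_neg)
  moreover have "msum N (\<lambda>i. f i ` (\<lambda>y. y - x) ` K) s = (+) (- (\<Sum>i<N. s i *\<^sub>R f i x)) ` msum N (\<lambda>i. f i ` K) s"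
    by (rule msum_translate) (rule f)
  ultimately show ?thesis
    unfolding measure_def
    using volM.translate(2)[OF compact_measurable_volM[OF compact_msum_f[OF assms]]] by (simp only:)
qed

text \<open>Seen from \<open>x0\<close>, the body shrunk by \<open>1 - e\<close> lies in the
  polytope; linear maps and Minkowski sums preserve this inclusion, and homogeneity gives the power
  \<open>N\<close>.\<close>

lemma volsum_shrink:
  assumes K: "compact K" and V: "finite V" "\<And>x. x \<in> K \<Longrightarrow> x - e *\<^sub>R (x - x0) \<in> convex hull V" and e: "e < 1"
  shows "(1 - e) ^ N * volsum K s \<le> volsum (convex hull V) s"
proof -
  let ?K = "(\<lambda>y. y - x0) ` K" and ?V = "(\<lambda>y. y - x0) ` (convex hull V)"
  have cK: "compact ?K" using K by (intro compact_continuous_image continuous_intros)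
  have cV: "compact ?V" using V(1) by (intro compact_continuous_image continuous_intros finite_imp_compact_convex_hull)
  have "(*\<^sub>R) (1 - e) ` msum N (\<lambda>i. f i ` ?K) s \<subseteq> msum N (\<lambda>i. f i ` ?V) s"
  proof
    fix z assume "z \<in> (*\<^sub>R) (1 - e) ` msum N (\<lambda>i. f i ` ?K) s"
    then obtain u where u: "\<forall>i<N. u i \<in> f i ` ?K" "z = (1 - e) *\<^sub>R (\<Sum>i<N. s i *\<^sub>R u i)" by (auto simp: msum_def)
    have "(1 - e) *\<^sub>R u i \<in> f i ` ?V" if "i < N" for i
    proof -
      obtain y where y: "y \<in> K" "u i = f i (y - x0)" using u(1) \<open>i < N\<close> by blast
      have "(1 - e) *\<^sub>R u i = f i (y - e *\<^sub>R (y - x0) - x0)"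
        by (simp add: y linear_scale[OF f[OF that], symmetric] algebra_simps)
      then show ?thesis using V(2)[OF y(1)] by blast
    qed
    moreover have "z = (\<Sum>i<N. s i *\<^sub>R ((1 - e) *\<^sub>R u i))"
      by (simp add: u(2) scaleR_sum_right mult.commute)
    ultimately show "z \<in> msum N (\<lambda>i. f i ` ?V) s" unfolding msum_def
      by (intro CollectI exI[of _ "\<lambda>i. (1 - e) *\<^sub>R u i"]) auto
  qed
  then have "measure (volM p) ((*\<^sub>R) (1 - e) ` msum N (\<lambda>i. f i ` ?K) s) \<le> volsum ?V s"
    using compact_scaling[OF compact_msum_f[OF cK]] compact_msum_f[OF cV]
    by (intro measure_mono_fmeasurable fmeasurableD compact_fmeasurable_volM) auto
  moreover have "measure (volM p) ((*\<^sub>R) (1 - e) ` msum N (\<lambda>i. f i ` ?K) s) = (1 - e) ^ N * volsum ?K s"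
    unfolding N(1) using e compact_msum_f[OF cK] msum_f_families
    by (intro measure_volM_scale compact_measurable_volM) (auto simp: N(1))
  ultimately show ?thesis
    using volsum_translate[OF K] volsum_translate[OF finite_imp_compact_convex_hull[OF V(1)]] by simp
qed

text \<open>Once 0 lies in the body, the sums decrease with their factors; by compactness their
  intersection is the limiting sum, and the measure is continuous from above. The translation by
  \<open>x0\<close> serves to put 0 into the body.\<close>

lemma volsum_right_continuous:
  assumes K: "convex K" "compact K" "K \<noteq> {}" and s: "\<And>i. 0 \<le> s i"
  shows "(\<lambda>m. volsum K (\<lambda>i. s i + 1 / real (Suc m))) \<longlonglongrightarrow> volsum K s"
proof -
  obtain x0 where x0: "x0 \<in> K" using K(3) by blast
  define L where "L = (\<lambda>y. y - x0) ` K"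
  have L: "convex L" "compact L" "0 \<in> L"
    using K x0 by (auto simp: L_def intro!: compact_continuous_image continuous_intros)
  have grow: "r *\<^sub>R f i y \<in> (*\<^sub>R) t ` f i ` L" if "y \<in> L" "0 \<le> r" "r \<le> t" "i < N" for r t i y
  proof (cases "t = 0")
    case True
    then show ?thesis using that by auto
  next
    case False
    then have "(r / t) *\<^sub>R y \<in> L"
      using convexD_alt[OF L(1,3) that(1), of "r / t"] that by (simp add: divide_le_eq_1)
    moreover have "r *\<^sub>R f i y = t *\<^sub>R f i ((r / t) *\<^sub>R y)"
      using False by (simp add: linear_scale[OF f[OF that(4)]])
    ultimately show ?thesis by blast
  qed
  have mono: "msum N (\<lambda>i. f i ` L) r \<subseteq> msum N (\<lambda>i. f i ` L) t" if "\<And>i. 0 \<le> r i" "\<And>i. r i \<le> t i" for r t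
  proof
    fix z assume "z \<in> msum N (\<lambda>i. f i ` L) r"
    then obtain u where u: "\<forall>i<N. u i \<in> f i ` L" "z = (\<Sum>i<N. r i *\<^sub>R u i)" by (auto simp: msum_def)
    have "\<forall>i. \<exists>w. i < N \<longrightarrow> w \<in> f i ` L \<and> r i *\<^sub>R u i = t i *\<^sub>R w"
      using u(1) grow[OF _ that] by (fastforce simp: image_iff)
    then obtain w where "\<And>i. i < N \<Longrightarrow> w i \<in> f i ` L \<and> r i *\<^sub>R u i = t i *\<^sub>R w i" by metis
    then show "z \<in> msum N (\<lambda>i. f i ` L) t"
      unfolding msum_def using u(2) by (intro CollectI exI[of _ w]) auto
  qed
  define A where "A m = msum N (\<lambda>i. f i ` L) (\<lambda>i. s i + 1 / real (Suc m))" for m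
  have cA: "compact (A m)" for m unfolding A_def by (rule compact_msum_f[OF L(2)])
  have c0: "compact (msum N (\<lambda>i. f i ` L) s)" by (rule compact_msum_f[OF L(2)])
  have "(\<Inter>m. A m) = msum N (\<lambda>i. f i ` L) s"
  proof (intro equalityI subsetI)
    fix z assume "z \<in> msum N (\<lambda>i. f i ` L) s"
    moreover have "msum N (\<lambda>i. f i ` L) s \<subseteq> A m" for m
      unfolding A_def using s by (intro mono) auto
    ultimately show "z \<in> (\<Inter>m. A m)" by blast
  next
    fix z assume z: "z \<in> (\<Inter>m. A m)"
    obtain R where R: "\<And>w. w \<in> msum N (\<lambda>i. f i ` L) (\<lambda>_. 1) \<Longrightarrow> norm w \<le> R"
      using compact_imp_bounded[OF compact_msum_f[OF L(2), of "\<lambda>_. 1"]] by (auto simp: bounded_iff)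
    \<comment> \<open>Splitting off the surplus \<open>1 / (m + 1)\<close> of the factors leaves
      points of the limiting sum that converge to \<open>z\<close>.\<close>
    have "\<forall>m. \<exists>a w. a \<in> msum N (\<lambda>i. f i ` L) s \<and> norm w \<le> R \<and> z = a + (1 / real (Suc m)) *\<^sub>R w"
    proof
      fix m
      obtain u where u: "\<forall>i<N. u i \<in> f i ` L" "z = (\<Sum>i<N. (s i + 1 / real (Suc m)) *\<^sub>R u i)"
        using INT_D[OF z UNIV_I, of m] unfolding A_def msum_def by blast
      have "(\<Sum>i<N. s i *\<^sub>R u i) \<in> msum N (\<lambda>i. f i ` L) s" "(\<Sum>i<N. 1 *\<^sub>R u i) \<in> msum N (\<lambda>i. f i ` L) (\<lambda>_. 1)"
        using u(1) unfolding msum_def by blast+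
      moreover have "z = (\<Sum>i<N. s i *\<^sub>R u i) + (1 / real (Suc m)) *\<^sub>R (\<Sum>i<N. 1 *\<^sub>R u i)"
        by (simp add: u(2) scaleR_left_distrib sum.distrib scaleR_sum_right)
      ultimately show "\<exists>a w. a \<in> msum N (\<lambda>i. f i ` L) s \<and> norm w \<le> R \<and> z = a + (1 / real (Suc m)) *\<^sub>R w"
        using R by blast
    qed
    then obtain a w where aw: "\<And>m. a m \<in> msum N (\<lambda>i. f i ` L) s" "\<And>m. norm (w m) \<le> R"
      "\<And>m. z = a m + (1 / real (Suc m)) *\<^sub>R w m" by metis
    have "(\<lambda>m. (1 / real (Suc m)) *\<^sub>R w m) \<longlonglongrightarrow> 0"
    proof (rule Lim_null_comparison)
      have "norm ((1 / real (Suc m)) *\<^sub>R w m) \<le> R * inverse (real (Suc m))" for m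
        using mult_right_mono[OF aw(2)[of m], of "inverse (real (Suc m))"]
        by (simp add: divide_inverse mult.commute)
      then show "\<forall>\<^sub>F m in sequentially. norm ((1 / real (Suc m)) *\<^sub>R w m) \<le> R * inverse (real (Suc m))" by simp
      show "(\<lambda>m. R * inverse (real (Suc m))) \<longlonglongrightarrow> 0"
        using LIMSEQ_inverse_real_of_nat by (rule tendsto_mult_right_zero)
    qed
    then have "(\<lambda>m. z - (1 / real (Suc m)) *\<^sub>R w m) \<longlonglongrightarrow> z - 0" by (intro tendsto_intros)
    moreover have "a = (\<lambda>m. z - (1 / real (Suc m)) *\<^sub>R w m)"
    proof
      fix m show "a m = z - (1 / real (Suc m)) *\<^sub>R w m" using aw(3)[of m] by (simp only: eq_diff_eq)
    qed
    ultimately have "a \<longlonglongrightarrow> z" by (simp only: diff_zero)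
    then show "z \<in> msum N (\<lambda>i. f i ` L) s"
      using closed_sequentially[OF compact_imp_closed[OF c0]] aw(1) by blast
  qed
  moreover have "(\<lambda>m. measure (volM p) (A m)) \<longlonglongrightarrow> measure (volM p) (\<Inter>m. A m)"
  proof (rule Lim_measure_decseq)
    show "range A \<subseteq> sets (volM p)" using compact_measurable_volM[OF cA] by blast
    show "decseq A" unfolding decseq_Suc_iff A_def
      using s by (intro allI mono) (auto intro!: add_nonneg_nonneg simp: frac_le)
    show "emeasure (volM p) (A m) \<noteq> \<infinity>" for m
      using bounded_finite_volM[OF compact_imp_bounded[OF cA], of p m] by (simp add: less_top)
  qed
  ultimately show ?thesis
    using volsum_translate[OF K(2), of x0] by (simp add: A_def L_def)
qed

text \<open>Inner polytopes give polynomials over the same finite set of exponents. Their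
  coefficients are nonnegative and bounded by the volume at factors 1, so a subsequence converges,
  and the squeeze by \<open>volsum_shrink\<close> identifies the limit with the volume of the sum
  for \<open>K\<close>. The bound on the square-free coefficient passes to the limit.\<close>

lemma volsum_polynomial:
  assumes K: "convex K" "compact K" "interior K \<noteq> {}"
  shows "\<exists>c. (\<forall>s. (\<forall>i. 0 \<le> s i) \<longrightarrow> volsum K s = (\<Sum>k\<in>Pi\<^sub>E {..<N} (\<lambda>_. {..N}). c k * (\<Prod>i<N. s i ^ k i))) \<and>
    (\<forall>C. C \<in> fmeasurable (volM p) \<longrightarrow> convex C \<longrightarrow> (\<forall>i<N. f i ` K \<subseteq> C) \<longrightarrow>
       c (\<lambda>i\<in>{..<N}. 1) \<le> fact N * measure (volM p) C)"
proof -
  obtain x0 where x0: "x0 \<in> interior K" using K(3) by blast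
  \<comment> \<open>Two successors keep every \<open>e m\<close> strictly below 1.\<close>
  define e where "e m = inverse (real (Suc (Suc m)))" for m
  have e: "0 < e m" "e m < 1" for m by (simp_all add: e_def inverse_less_1_iff)
  let ?P = "Pi\<^sub>E {..<N} (\<lambda>_. {..N})"
  have "\<forall>m. \<exists>V. finite V \<and> V \<subseteq> K \<and> (\<forall>x\<in>K. x - e m *\<^sub>R (x - x0) \<in> convex hull V)"
    using polytope_approximation[OF K(1,2) x0 e(1) less_imp_le[OF e(2)]] by metis
  then obtain V where V: "\<And>m. finite (V m)" "\<And>m. V m \<subseteq> K" "\<And>m x. x \<in> K \<Longrightarrow> x - e m *\<^sub>R (x - x0) \<in> convex hull V m"
    by metis
  have cV: "compact (convex hull V m)" for m using V(1) by (rule finite_imp_compact_convex_hull)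
  have VK: "convex hull V m \<subseteq> K" for m using V(2) K(1) by (rule hull_minimal)
  define Q where "Q m c \<longleftrightarrow> (\<forall>k. 0 \<le> c k) \<and>
    (\<forall>s. (\<forall>i<N. 0 < s i) \<longrightarrow> volsum (convex hull V m) s = (\<Sum>k\<in>?P. c k * (\<Prod>i<N. s i ^ k i))) \<and>
    c (\<lambda>i\<in>{..<N}. 1) \<le> fact N * measure (volM p) (convex hull (\<Union>i<N. f i ` V m))" for m c
  have "\<exists>c. Q m c" for m
  proof -
    have eq: "msum N (\<lambda>i. convex hull (f i ` V m)) s = msum N (\<lambda>i. f i ` (convex hull V m)) s" for s
      using f by (simp add: msum_def convex_hull_linear_image)
    show ?thesis
    proof (rule polytope_polynomial[OF N, of "\<lambda>i. f i ` V m"])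
      show "finite (f i ` V m)" for i using V(1) by simp
      show "f i ` V m \<subseteq> families p" if "i < N" for i using fW[OF that] by blast
      fix c :: "(nat \<Rightarrow> nat) \<Rightarrow> real"
      assume c: "\<And>k. 0 \<le> c k"
        "\<And>s. (\<And>i. i < N \<Longrightarrow> 0 < s i) \<Longrightarrow> measure (volM p) (msum N (\<lambda>i. convex hull (f i ` V m)) s) =
           (\<Sum>k\<in>?P. c k * (\<Prod>i<N. s i ^ k i))"
        "c (\<lambda>i\<in>{..<N}. 1) \<le> fact N * measure (volM p) (convex hull (\<Union>i<N. f i ` V m))"
      show ?thesis
        unfolding Q_def
      proof (intro exI[of _ c] conjI allI impI)
        fix s :: "nat \<Rightarrow> real" assume "\<forall>i<N. 0 < s i"
        then show "volsum (convex hull V m) s = (\<Sum>k\<in>?P. c k * (\<Prod>i<N. s i ^ k i))"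
          using c(2)[of s] eq[of s] by simp
      next
        fix k show "0 \<le> c k" by (rule c(1))
      next
        show "c (\<lambda>i\<in>{..<N}. 1) \<le> fact N * measure (volM p) (convex hull (\<Union>i<N. f i ` V m))"
          by (rule c(3))
      qed
    qed
  qed
  then obtain c where "\<And>m. Q m (c m)" using choice[of Q] by blast
  then have c: "\<And>m k. 0 \<le> c m k"
    "\<And>m s. (\<And>i. i < N \<Longrightarrow> 0 < s i) \<Longrightarrow> volsum (convex hull V m) s = (\<Sum>k\<in>?P. c m k * (\<Prod>i<N. s i ^ k i))"
    "\<And>m. c m (\<lambda>i\<in>{..<N}. 1) \<le> fact N * measure (volM p) (convex hull (\<Union>i<N. f i ` V m))"
    unfolding Q_def by simp_all
  have finP: "finite ?P" by (intro finite_PiE) auto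
  have "c m k \<le> volsum K (\<lambda>_. 1)" if "k \<in> ?P" for m k
  proof -
    have "c m k \<le> (\<Sum>k\<in>?P. c m k * (\<Prod>i<N. 1 ^ k i))"
      using member_le_sum[of k ?P "c m"] that c(1) finP by simp
    also have "\<dots> = volsum (convex hull V m) (\<lambda>_. 1)" by (rule c(2)[symmetric]) simp
    also have "\<dots> \<le> volsum K (\<lambda>_. 1)" using cV K(2) VK by (rule volsum_mono)
    finally show ?thesis .
  qed
  then have "\<exists>r l. strict_mono (r :: nat \<Rightarrow> nat) \<and> (\<forall>k\<in>?P. (\<lambda>m. c (r m) k) \<longlonglongrightarrow> l k)"
    by (intro finite_convergent_subsequence finP c(1))
  then obtain r l where r: "strict_mono r" and l: "\<And>k. k \<in> ?P \<Longrightarrow> (\<lambda>m. c (r m) k) \<longlonglongrightarrow> l k" by blast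
  have e0: "(\<lambda>m. e (r m)) \<longlonglongrightarrow> 0"
  proof -
    have "e \<longlonglongrightarrow> 0" unfolding e_def by (rule LIMSEQ_Suc[OF LIMSEQ_inverse_real_of_nat])
    then show ?thesis using LIMSEQ_subseq_LIMSEQ[OF _ r] by (simp add: o_def)
  qed
  have pos: "volsum K s = (\<Sum>k\<in>?P. l k * (\<Prod>i<N. s i ^ k i))" if s: "\<And>i. 0 < s i" for s
  proof -
    have lim1: "(\<lambda>m. volsum (convex hull V (r m)) s) \<longlonglongrightarrow> (\<Sum>k\<in>?P. l k * (\<Prod>i<N. s i ^ k i))"
      using s by (subst c(2)) (auto intro!: tendsto_intros l)
    have "(\<lambda>m. (1 - e (r m)) ^ N * volsum K s) \<longlonglongrightarrow> (1 - 0) ^ N * volsum K s"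
      by (intro tendsto_intros e0)
    then have lim2: "(\<lambda>m. (1 - e (r m)) ^ N * volsum K s) \<longlonglongrightarrow> volsum K s" by simp
    have "(\<lambda>m. volsum (convex hull V (r m)) s) \<longlonglongrightarrow> volsum K s"
    proof (rule tendsto_sandwich[OF _ _ lim2 tendsto_const])
      show "\<forall>\<^sub>F m in sequentially. (1 - e (r m)) ^ N * volsum K s \<le> volsum (convex hull V (r m)) s"
        using volsum_shrink[OF K(2) V(1) V(3) e(2)] by simp
      show "\<forall>\<^sub>F m in sequentially. volsum (convex hull V (r m)) s \<le> volsum K s"
        using volsum_mono[OF cV K(2) VK] by simp
    qed
    then show ?thesis using lim1 LIMSEQ_unique by blast
  qed
  show ?thesis
  proof (intro exI[of _ l] conjI allI impI)
    fix s :: "nat \<Rightarrow> real" assume "\<forall>i. 0 \<le> s i"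
    then have s: "0 \<le> s i" for i by blast
    let ?s = "\<lambda>m i. s i + 1 / real (Suc m)"
    have "K \<noteq> {}" using K(3) interior_subset by blast
    then have "(\<lambda>m. volsum K (?s m)) \<longlonglongrightarrow> volsum K s"
      using K s by (intro volsum_right_continuous)
    moreover have "volsum K (?s m) = (\<Sum>k\<in>?P. l k * (\<Prod>i<N. ?s m i ^ k i))" for m
      using s by (intro pos) (simp add: add_nonneg_pos)
    moreover have "(\<lambda>m. \<Sum>k\<in>?P. l k * (\<Prod>i<N. ?s m i ^ k i)) \<longlonglongrightarrow> (\<Sum>k\<in>?P. l k * (\<Prod>i<N. (s i + 0) ^ k i))"
      using LIMSEQ_inverse_real_of_nat by (intro tendsto_intros) (simp add: inverse_eq_divide)
    ultimately show "volsum K s = (\<Sum>k\<in>?P. l k * (\<Prod>i<N. s i ^ k i))"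
      using LIMSEQ_unique by simp blast
  next
    fix C assume C: "C \<in> fmeasurable (volM p)" "convex C" "\<forall>i<N. f i ` K \<subseteq> C"
    have "c m (\<lambda>i\<in>{..<N}. 1) \<le> fact N * measure (volM p) C" for m
    proof -
      have "(\<Union>i<N. f i ` V m) \<subseteq> C" using C(3) V(2)[of m] by blast
      then have "convex hull (\<Union>i<N. f i ` V m) \<subseteq> C" using C(2) by (rule hull_minimal)
      then have "measure (volM p) (convex hull (\<Union>i<N. f i ` V m)) \<le> measure (volM p) C"
        using C(1) V(1) by (intro measure_mono_fmeasurable compact_measurable_volM finite_imp_compact_convex_hull) auto
      then show ?thesis using c(3)[of m] by (smt (verit) mult_left_mono fact_ge_zero)
    qed
    moreover have "(\<lambda>i\<in>{..<N}. 1) \<in> ?P" using N(2) by (auto simp: restrict_PiE_iff)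
    ultimately show "l (\<lambda>i\<in>{..<N}. 1) \<le> fact N * measure (volM p) C"
      by (intro LIMSEQ_le_const2[OF l]) auto
  qed
qed

end

text \<open>Translations do not change the volume, so the polynomial of the maps
  \<open>t i *\<^sub>R f i\<close> on \<open>K - x\<close> arises from that of the
  \<open>f i\<close> on \<open>K\<close> by substituting \<open>s i * t i\<close>; its square-free
  coefficient therefore carries the product of the \<open>t i\<close>. The derivative at 0
  identifies coefficients that come from two separate existence statements.\<close>

lemma mixed_partial_volsum_le:
  fixes f :: "nat \<Rightarrow> real ^ 'n \<Rightarrow> (nat \<Rightarrow>\<^sub>0 real ^ 'n)"
  assumes N: "N = CARD('n) * p" "0 < N"
    and f: "\<And>i. i < N \<Longrightarrow> linear (f i)" and fW: "\<And>i x. i < N \<Longrightarrow> f i x \<in> families p"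
    and K: "convex K" "compact K" "interior K \<noteq> {}"
    and F: "\<And>s. (\<And>i. 0 \<le> s i) \<Longrightarrow> F s = measure (volM p) (msum N (\<lambda>i. f i ` K) s)"
    and t: "\<And>i. 0 < t i"
    and C: "C \<in> fmeasurable (volM p)" "convex C" "\<And>i y. i < N \<Longrightarrow> y \<in> K \<Longrightarrow> t i *\<^sub>R f i (y - x) \<in> C"
  shows "(\<Prod>i<N. t i) * mixed_partial N F (\<lambda>_. 0) \<le> fact N * measure (volM p) C"
proof -
  let ?P = "Pi\<^sub>E {..<N} (\<lambda>_. {..N})"
  let ?one = "\<lambda>i\<in>{..<N}. 1::nat"
  have finP: "finite ?P" by (intro finite_PiE) auto
  have one: "{k \<in> ?P. \<forall>i<N. k i = 1} = {?one}"
    using N(2) by (auto simp: PiE_iff extensional_def fun_eq_iff)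
  have "\<exists>c. (\<forall>s. (\<forall>i. 0 \<le> s i) \<longrightarrow> measure (volM p) (msum N (\<lambda>i. f i ` K) s) = (\<Sum>k\<in>?P. c k * (\<Prod>i<N. s i ^ k i))) \<and>
    (\<forall>C. C \<in> fmeasurable (volM p) \<longrightarrow> convex C \<longrightarrow> (\<forall>i<N. f i ` K \<subseteq> C) \<longrightarrow>
       c ?one \<le> fact N * measure (volM p) C)"
    by (rule volsum_polynomial) (fact N f fW K)+
  then obtain c where c: "\<forall>s. (\<forall>i. 0 \<le> s i) \<longrightarrow> measure (volM p) (msum N (\<lambda>i. f i ` K) s) = (\<Sum>k\<in>?P. c k * (\<Prod>i<N. s i ^ k i))"
    by (elim exE conjE)
  let ?K = "(\<lambda>y. y - x) ` K"
  let ?f = "\<lambda>i y. t i *\<^sub>R f i y"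
  have f': "linear (?f i)" if "i < N" for i
    using linear_compose_scale_right[OF f[OF that]] .
  have fW': "?f i y \<in> families p" if "i < N" for i y
    by (rule subspace_scale[OF subspace_families fW[OF that]])
  have K': "convex ?K" "compact ?K" "interior ?K \<noteq> {}"
    using K by (auto simp: interior_translation_subtract intro!: compact_continuous_image continuous_intros)
  have "\<exists>c. (\<forall>s. (\<forall>i. 0 \<le> s i) \<longrightarrow> measure (volM p) (msum N (\<lambda>i. ?f i ` ?K) s) = (\<Sum>k\<in>?P. c k * (\<Prod>i<N. s i ^ k i))) \<and>
    (\<forall>C. C \<in> fmeasurable (volM p) \<longrightarrow> convex C \<longrightarrow> (\<forall>i<N. ?f i ` ?K \<subseteq> C) \<longrightarrow>
       c ?one \<le> fact N * measure (volM p) C)"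
    by (rule volsum_polynomial) (fact N f' fW' K')+
  then obtain c' where c': "\<forall>s. (\<forall>i. 0 \<le> s i) \<longrightarrow> measure (volM p) (msum N (\<lambda>i. ?f i ` ?K) s) = (\<Sum>k\<in>?P. c' k * (\<Prod>i<N. s i ^ k i))"
    "\<forall>C. C \<in> fmeasurable (volM p) \<longrightarrow> convex C \<longrightarrow> (\<forall>i<N. ?f i ` ?K \<subseteq> C) \<longrightarrow>
       c' ?one \<le> fact N * measure (volM p) C"
    by (elim exE conjE)
  have eq: "measure (volM p) (msum N (\<lambda>i. ?f i ` ?K) s) = (\<Sum>k\<in>?P. (c k * (\<Prod>i<N. t i ^ k i)) * (\<Prod>i<N. s i ^ k i))"
    if s: "\<And>i. 0 \<le> s i" for s
  proof -
    have "msum N (\<lambda>i. ?f i ` ?K) s = msum N (\<lambda>i. f i ` ?K) (\<lambda>i. s i * t i)"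
    proof (intro equalityI subsetI)
      fix z assume "z \<in> msum N (\<lambda>i. ?f i ` ?K) s"
      then obtain u where u: "\<forall>i<N. u i \<in> ?f i ` ?K" "z = (\<Sum>i<N. s i *\<^sub>R u i)" unfolding msum_def by blast
      have "\<forall>i<N. (1 / t i) *\<^sub>R u i \<in> f i ` ?K"
      proof (intro allI impI)
        fix i assume "i < N"
        then obtain y where "y \<in> ?K" "u i = t i *\<^sub>R f i y" using u(1) by blast
        then show "(1 / t i) *\<^sub>R u i \<in> f i ` ?K" using t[of i] by simp
      qed
      moreover have "z = (\<Sum>i<N. (s i * t i) *\<^sub>R ((1 / t i) *\<^sub>R u i))"
        unfolding u(2)
      proof (rule sum.cong[OF refl])
        fix i
        show "s i *\<^sub>R u i = (s i * t i) *\<^sub>R ((1 / t i) *\<^sub>R u i)" using t[of i] by simp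
      qed
      ultimately show "z \<in> msum N (\<lambda>i. f i ` ?K) (\<lambda>i. s i * t i)"
        unfolding msum_def by (intro CollectI exI[of _ "\<lambda>i. (1 / t i) *\<^sub>R u i"]) (intro conjI)
    next
      fix z assume "z \<in> msum N (\<lambda>i. f i ` ?K) (\<lambda>i. s i * t i)"
      then obtain u where u: "\<forall>i<N. u i \<in> f i ` ?K" "z = (\<Sum>i<N. (s i * t i) *\<^sub>R u i)" unfolding msum_def by blast
      have "\<forall>i<N. t i *\<^sub>R u i \<in> ?f i ` ?K"
      proof (intro allI impI)
        fix i assume "i < N"
        then obtain y where y: "y \<in> ?K" "u i = f i y" using u(1) by blast
        show "t i *\<^sub>R u i \<in> ?f i ` ?K" unfolding y(2) using y(1) by (rule imageI)
      qed
      moreover have "z = (\<Sum>i<N. s i *\<^sub>R (t i *\<^sub>R u i))" by (simp add: u(2))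
      ultimately show "z \<in> msum N (\<lambda>i. ?f i ` ?K) s"
        unfolding msum_def by (intro CollectI exI[of _ "\<lambda>i. t i *\<^sub>R u i"]) (intro conjI)
    qed
    then have "measure (volM p) (msum N (\<lambda>i. ?f i ` ?K) s) = measure (volM p) (msum N (\<lambda>i. f i ` K) (\<lambda>i. s i * t i))"
      by (simp only: volsum_translate[where f=f and N=N and p=p, OF N f fW K(2)])
    also have "\<dots> = (\<Sum>k\<in>?P. c k * (\<Prod>i<N. (s i * t i) ^ k i))"
      by (rule c[rule_format]) (simp add: s less_imp_le[OF t])
    also have "\<dots> = (\<Sum>k\<in>?P. (c k * (\<Prod>i<N. t i ^ k i)) * (\<Prod>i<N. s i ^ k i))"
      by (simp add: power_mult_distrib prod.distrib mult_ac)
    finally show ?thesis .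
  qed
  let ?G = "\<lambda>s. measure (volM p) (msum N (\<lambda>i. ?f i ` ?K) s)"
  have coeff: "mixed_partial N H (\<lambda>_. 0) = b ?one"
    if "\<And>s. (\<And>i. 0 \<le> s i) \<Longrightarrow> H s = (\<Sum>k\<in>?P. b k * (\<Prod>i<N. s i ^ k i))" for H b
    using mixed_partial_poly_0[where K="?P" and F=H and c=b and N=N and a="\<lambda>k. k", OF finP that] one by simp
  have "mixed_partial N F (\<lambda>_. 0) = c ?one"
    by (rule coeff) (simp add: F c)
  moreover have "mixed_partial N ?G (\<lambda>_. 0) = c' ?one"
    by (rule coeff) (simp add: c')
  moreover have "mixed_partial N ?G (\<lambda>_. 0) = c ?one * (\<Prod>i<N. t i ^ ?one i)"
    by (rule coeff[of ?G "\<lambda>k. c k * (\<Prod>i<N. t i ^ k i)"]) (rule eq)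
  moreover have "c' ?one \<le> fact N * measure (volM p) C"
    using C by (intro c'(2)[rule_format]) auto
  ultimately show ?thesis by (simp add: mult.commute)
qed

section \<open>Counting linked families\<close>

text \<open>Connectedness of the hypergraph with vertices \<open>A\<close> and edges
  \<open>B l\<close>, expressed by labels that are constant on edges: the form in which linear
  independence delivers it.\<close>

definition linked :: "nat \<Rightarrow> (nat \<Rightarrow> 'a set) \<Rightarrow> 'a set \<Rightarrow> bool" where
  "linked m B A \<longleftrightarrow> (\<forall>\<alpha> :: 'a \<Rightarrow> real.
     (\<forall>l<m. \<forall>u\<in>B l. \<forall>v\<in>B l. \<alpha> u = \<alpha> v) \<longrightarrow> (\<forall>u\<in>A. \<forall>v\<in>A. \<alpha> u = \<alpha> v))"

lemma linked_cong:
  assumes "\<And>l. l < m \<Longrightarrow> B l = B' l" "linked m B A"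
  shows "linked m B' A"
  unfolding linked_def
proof (intro allI impI)
  fix \<alpha> :: "'a \<Rightarrow> real"
  assume "\<forall>l<m. \<forall>u\<in>B' l. \<forall>v\<in>B' l. \<alpha> u = \<alpha> v"
  then have "\<forall>l<m. \<forall>u\<in>B l. \<forall>v\<in>B l. \<alpha> u = \<alpha> v" using assms(1) by metis
  then show "\<forall>u\<in>A. \<forall>v\<in>A. \<alpha> u = \<alpha> v" using assms(2) unfolding linked_def by blast
qed

section \<open>Contraction of a block to a point\<close>

definition contract :: "'a set \<Rightarrow> 'a \<Rightarrow> 'a \<Rightarrow> 'a" where
  "contract X b v = (if v \<in> X then b else v)"

lemma contract_image: "b \<in> X \<Longrightarrow> X \<subseteq> A \<Longrightarrow> contract X b ` A = insert b (A - X)"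
  by (auto simp: contract_def)

lemma card_contract:
  assumes "finite A" "b \<in> X" "X \<subseteq> A"
  shows "card (contract X b ` A) = Suc (card A - card X)"
proof -
  have "card (insert b (A - X)) = Suc (card (A - X))" using assms by (intro card_insert_disjoint) auto
  then show ?thesis using assms by (simp add: contract_image card_Diff_subset finite_subset)
qed

lemma linked_contract:
  assumes "linked (Suc m) B A" "b \<in> B m" "B m \<subseteq> A"
  shows "linked m (\<lambda>l. contract (B m) b ` B l) (contract (B m) b ` A)"
  unfolding linked_def
proof (intro allI impI)
  fix \<alpha> :: "'a \<Rightarrow> real"
  assume \<alpha>: "\<forall>l<m. \<forall>u\<in>contract (B m) b ` B l. \<forall>v\<in>contract (B m) b ` B l. \<alpha> u = \<alpha> v"
  let ?q = "contract (B m) b"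
  have "\<alpha> (?q u) = \<alpha> (?q v)" if "l < Suc m" "u \<in> B l" "v \<in> B l" for l u v
  proof (cases "l = m")
    case True
    then show ?thesis using that by (simp add: contract_def)
  next
    case False
    then have "l < m" using that(1) by simp
    then show ?thesis using \<alpha> that(2,3) by blast
  qed
  then have "\<forall>u\<in>A. \<forall>v\<in>A. \<alpha> (?q u) = \<alpha> (?q v)"
    using assms(1)[unfolded linked_def, rule_format, of "\<lambda>v. \<alpha> (?q v)"] by blast
  then show "\<forall>u\<in>?q ` A. \<forall>v\<in>?q ` A. \<alpha> u = \<alpha> v" by blast
qed

text \<open>Each edge joins at most \<open>card (B l) - 1\<close> further vertices; the induction
  contracts the last edge, which keeps connectedness.\<close>

lemma linked_card:
  assumes "finite A" "linked m B A" "\<And>l. l < m \<Longrightarrow> B l \<subseteq> A" "\<And>l. l < m \<Longrightarrow> B l \<noteq> {}"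
  shows "card A \<le> Suc (\<Sum>l<m. card (B l) - 1)"
  using assms
proof (induction m arbitrary: A B)
  case 0
  \<comment> \<open>Without edges every label is admissible, in particular the indicator of
    \<open>u\<close>.\<close>
  have "u = v" if "u \<in> A" "v \<in> A" for u v
    using 0(2)[unfolded linked_def, rule_format, of "\<lambda>x. if x = u then 1 else 0" u v] that
    by (simp split: if_splits)
  then have "card A \<le> 1" using 0(1) card_le_Suc0_iff_eq[of A] by auto
  then show ?case by simp
next
  case (Suc m)
  obtain b where b: "b \<in> B m" using Suc.prems(4) by blast
  have Bm: "B m \<subseteq> A" using Suc.prems(3) by blast
  let ?q = "contract (B m) b"
  have fB: "finite (B l)" if "l < Suc m" for l using Suc.prems(1,3) that finite_subset by blast
  have le: "card A - card (B m) \<le> (\<Sum>l<m. card (B l) - 1)"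
  proof -
    have "card (?q ` A) \<le> Suc (\<Sum>l<m. card (?q ` B l) - 1)"
    proof (rule Suc.IH)
      show "linked m (\<lambda>l. ?q ` B l) (?q ` A)" using Suc.prems(2) b Bm by (rule linked_contract)
    qed (use Suc.prems less_SucI in blast)+
    also have "\<dots> \<le> Suc (\<Sum>l<m. card (B l) - 1)"
      using fB by (intro Suc_le_mono[THEN iffD2] sum_mono diff_le_mono card_image_le) auto
    finally show ?thesis using card_contract[OF Suc.prems(1) b Bm] by simp
  qed
  have "card (B m) \<noteq> 0" using fB[of m] b by auto
  moreover have "card (B m) \<le> card A" using Suc.prems(1) Bm by (rule card_mono)
  ultimately show ?case using le by simp
qed

text \<open>If \<open>card A\<close> exceeds the sum of the \<open>j l\<close> by 1, these families
  attain equality in \<open>linked_card\<close>: they are hypertrees.\<close>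

definition linked_families :: "nat \<Rightarrow> 'a set \<Rightarrow> (nat \<Rightarrow> nat) \<Rightarrow> (nat \<Rightarrow> 'a set) set" where
  "linked_families m A j = {B \<in> Pi\<^sub>E {..<m} (\<lambda>l. {X. X \<subseteq> A \<and> card X = Suc (j l)}). linked m B A}"

lemma finite_linked_families: "finite A \<Longrightarrow> finite (linked_families m A j)"
  unfolding linked_families_def by (rule finite_subset[OF _ finite_PiE[of "{..<m}" "\<lambda>_. Pow A"]]) auto

text \<open>In the tight case \<open>linked_card\<close> for the contracted family leaves no room
  for an edge to shrink. So every other edge meets the contracted one in at most one vertex, and the
  result is a hypertree again.\<close>

lemma linked_contract_families:
  assumes A: "finite A" "card A = Suc (\<Sum>l<Suc m. j l)" and B: "B \<in> linked_families (Suc m) A j" and b: "b \<in> B m"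
  shows "(\<lambda>l\<in>{..<m}. contract (B m) b ` B l) \<in> linked_families m (contract (B m) b ` A) j"
    and "\<And>l. l < m \<Longrightarrow> inj_on (contract (B m) b) (B l)"
proof -
  let ?q = "contract (B m) b"
  have BA: "B l \<subseteq> A" "card (B l) = Suc (j l)" if "l < Suc m" for l
    using B that by (auto simp: linked_families_def PiE_iff)
  have fB: "finite (B l)" if "l < Suc m" for l using BA(1)[OF that] A(1) finite_subset by blast
  have lk: "linked m (\<lambda>l. ?q ` B l) (?q ` A)"
    using B b BA(1)[of m] by (intro linked_contract) (auto simp: linked_families_def)
  have le: "card (?q ` B l) \<le> Suc (j l)" if "l < m" for l
    using card_image_le[OF fB[of l], of ?q] BA(2)[of l] that by simp
  have ne: "B l \<noteq> {}" if "l < m" for l using BA(2)[of l] that by auto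
  have "card (?q ` A) \<le> Suc (\<Sum>l<m. card (?q ` B l) - 1)"
  proof (rule linked_card[OF _ lk])
    show "?q ` B l \<subseteq> ?q ` A" if "l < m" for l using BA(1)[of l] that by (intro image_mono) simp
  qed (use A ne in auto)
  moreover have "card (?q ` A) = Suc (\<Sum>l<m. j l)"
    using card_contract[OF A(1) b BA(1)] A(2) BA(2)[of m] by simp
  ultimately have sum: "(\<Sum>l<m. j l) \<le> (\<Sum>l<m. card (?q ` B l) - 1)" by simp
  have eq: "card (?q ` B l) = Suc (j l)" if l: "l < m" for l
  proof (rule ccontr)
    assume "card (?q ` B l) \<noteq> Suc (j l)"
    moreover have "card (?q ` B l) \<noteq> 0" using ne[OF l] fB[of l] l by simp
    ultimately have "card (?q ` B l) - 1 < j l" using le[OF l] by simp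
    moreover have "card (?q ` B l) - 1 \<le> j l" if "l < m" for l using le[OF that] by simp
    ultimately have "(\<Sum>l<m. card (?q ` B l) - 1) < (\<Sum>l<m. j l)"
      using l by (intro sum_strict_mono_ex1) auto
    then show False using sum by simp
  qed
  show "inj_on ?q (B l)" if "l < m" for l
    using eq[OF that] BA(2)[of l] that fB[of l] by (intro eq_card_imp_inj_on) auto
  have "(\<lambda>l\<in>{..<m}. ?q ` B l) \<in> Pi\<^sub>E {..<m} (\<lambda>l. {X. X \<subseteq> ?q ` A \<and> card X = Suc (j l)})"
    unfolding restrict_PiE_iff
  proof
    fix l assume "l \<in> {..<m}"
    then show "?q ` B l \<in> {X. X \<subseteq> ?q ` A \<and> card X = Suc (j l)}"
      using eq[of l] image_mono[OF BA(1)[of l], of ?q] by simp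
  qed
  moreover have "linked m (\<lambda>l\<in>{..<m}. ?q ` B l) (?q ` A)"
    by (rule linked_cong[OF _ lk]) simp
  ultimately show "(\<lambda>l\<in>{..<m}. ?q ` B l) \<in> linked_families m (?q ` A) j"
    by (simp add: linked_families_def)
qed

text \<open>If \<open>Z\<close> avoids \<open>b\<close>, its only possible preimage is
  \<open>Z\<close> itself; otherwise a preimage replaces \<open>b\<close> by a single
  \<open>x\<close> in \<open>X\<close>. Giving \<open>b\<close> the weight of all of
  \<open>X\<close> accounts for these choices.\<close>

lemma contract_fiber_sum:
  fixes w :: "'a \<Rightarrow> real"
  assumes A: "finite A" and X: "b \<in> X" "X \<subseteq> A" and Z: "Z \<subseteq> insert b (A - X)" and w: "\<And>v. 0 \<le> w v"
  shows "(\<Sum>Y | Y \<subseteq> A \<and> contract X b ` Y = Z \<and> inj_on (contract X b) Y. \<Prod>v\<in>Y. w v) \<le> (\<Prod>v\<in>Z. (w(b := sum w X)) v)"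
proof -
  let ?q = "contract X b"
  let ?S = "{Y. Y \<subseteq> A \<and> ?q ` Y = Z \<and> inj_on ?q Y}"
  have fZ: "finite Z" using A Z X finite_subset by (metis finite_Diff finite_insert)
  have fX: "finite X" using A X finite_subset by blast
  show ?thesis
  proof (cases "b \<in> Z")
    case False
    have "?S \<subseteq> {Z}"
    proof
      fix Y assume Y: "Y \<in> ?S"
      then have "v \<notin> X" if "v \<in> Y" for v using that False by (force simp: contract_def)
      then have "?q ` Y = Y" by (force simp: contract_def)
      then show "Y \<in> {Z}" using Y by simp
    qed
    then have "(\<Sum>Y\<in>?S. \<Prod>v\<in>Y. w v) \<le> (\<Sum>Y\<in>{Z}. \<Prod>v\<in>Y. w v)"
      using w by (intro sum_mono2) (auto intro: prod_nonneg)
    also have "\<dots> = (\<Prod>v\<in>Z. (w(b := sum w X)) v)" using False by (auto intro!: prod.cong)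
    finally show ?thesis .
  next
    case True
    have "?S \<subseteq> (\<lambda>x. insert x (Z - {b})) ` X"
    proof
      fix Y assume "Y \<in> ?S"
      then have Y: "?q ` Y = Z" "inj_on ?q Y" by auto
      obtain x where x: "x \<in> Y" "?q x = b" using True Y(1) by (metis imageE)
      have xX: "x \<in> X" using x(2) X(1) by (auto simp: contract_def split: if_splits)
      have other: "v \<notin> X" if "v \<in> Y" "v \<noteq> x" for v
        using inj_onD[OF Y(2), of v x] that x by (auto simp: contract_def)
      have "Y = insert x (Z - {b})"
      proof (intro equalityI subsetI)
        fix v assume v: "v \<in> Y"
        show "v \<in> insert x (Z - {b})"
        proof (cases "v = x")
          case False
          then have "v \<notin> X" using other v by blast
          then have "?q v = v" "v \<noteq> b" using X(1) by (auto simp: contract_def)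
          then show ?thesis using v Y(1) by (metis DiffI image_eqI insertCI singletonD)
        qed simp
      next
        fix v assume v: "v \<in> insert x (Z - {b})"
        show "v \<in> Y"
        proof (cases "v = x")
          case False
          then obtain y where "y \<in> Y" "v = ?q y" "v \<noteq> b" using v Y(1) by auto
          then show ?thesis by (auto simp: contract_def split: if_splits)
        qed (use x in simp)
      qed
      then show "Y \<in> (\<lambda>x. insert x (Z - {b})) ` X" using xX by blast
    qed
    then have "(\<Sum>Y\<in>?S. \<Prod>v\<in>Y. w v) \<le> (\<Sum>Y\<in>(\<lambda>x. insert x (Z - {b})) ` X. \<Prod>v\<in>Y. w v)"
      using w fX by (intro sum_mono2) (auto intro: prod_nonneg)
    also have "\<dots> \<le> (\<Sum>x\<in>X. \<Prod>v\<in>insert x (Z - {b}). w v)"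
      using fX w sum_image_le[of X "\<lambda>Y. \<Prod>v\<in>Y. w v" "\<lambda>x. insert x (Z - {b})"] by (simp add: prod_nonneg)
    also have "\<dots> = (\<Sum>x\<in>X. w x * (\<Prod>v\<in>Z - {b}. w v))"
    proof (rule sum.cong[OF refl])
      fix x assume "x \<in> X"
      then have "x \<notin> Z - {b}" using Z by blast
      then show "(\<Prod>v\<in>insert x (Z - {b}). w v) = w x * (\<Prod>v\<in>Z - {b}. w v)" using fZ by simp
    qed
    also have "\<dots> = (w(b := sum w X)) b * (\<Prod>v\<in>Z - {b}. (w(b := sum w X)) v)"
      by (simp add: sum_distrib_right)
    also have "\<dots> = (\<Prod>v\<in>Z. (w(b := sum w X)) v)" using fZ True by (rule prod.remove[symmetric])
    finally show ?thesis .
  qed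
qed

text \<open>Double counting: each point of \<open>A\<close> lies in \<open>card A - 1\<close> choose
  \<open>k\<close> of the subsets.\<close>

lemma sum_subsets_card:
  fixes w :: "'a \<Rightarrow> real"
  assumes A: "finite A"
  shows "(\<Sum>X | X \<subseteq> A \<and> card X = Suc k. sum w X) = real ((card A - 1) choose k) * sum w A"
proof -
  let ?S = "{X. X \<subseteq> A \<and> card X = Suc k}"
  have fS: "finite ?S" using A by simp
  have "(\<Sum>X\<in>?S. sum w X) = (\<Sum>X\<in>?S. \<Sum>v\<in>A. if v \<in> X then w v else 0)"
    using A by (intro sum.cong[OF refl]) (auto simp: sum.If_cases Int_absorb1 Int_absorb2)
  also have "\<dots> = (\<Sum>v\<in>A. \<Sum>X\<in>?S. if v \<in> X then w v else 0)" by (rule sum.swap)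
  also have "\<dots> = (\<Sum>v\<in>A. real ((card A - 1) choose k) * w v)"
  proof (rule sum.cong[OF refl])
    fix v assume v: "v \<in> A"
    have "card {X \<in> ?S. v \<in> X} = card {Y. Y \<subseteq> A - {v} \<and> card Y = k}"
    proof (rule bij_betw_same_card[of "\<lambda>X. X - {v}"], rule bij_betwI[where g="insert v"])
      show "(\<lambda>X. X - {v}) \<in> {X \<in> ?S. v \<in> X} \<rightarrow> {Y. Y \<subseteq> A - {v} \<and> card Y = k}"
        using A by (auto simp: card_Diff_singleton)
      show "insert v \<in> {Y. Y \<subseteq> A - {v} \<and> card Y = k} \<rightarrow> {X \<in> ?S. v \<in> X}"
      proof (intro funcsetI)
        fix Y assume "Y \<in> {Y. Y \<subseteq> A - {v} \<and> card Y = k}"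
        then have Y: "Y \<subseteq> A - {v}" "card Y = k" "finite Y" using A finite_subset by auto
        then have "card (insert v Y) = Suc k" by (subst card_insert_disjoint) auto
        then show "insert v Y \<in> {X \<in> ?S. v \<in> X}" using Y v by auto
      qed
    qed auto
    also have "\<dots> = (card A - 1) choose k"
      using n_subsets[of "A - {v}" k] A v by simp
    finally show "(\<Sum>X\<in>?S. if v \<in> X then w v else 0) = real ((card A - 1) choose k) * w v"
      using fS by (simp add: sum.If_cases Int_def)
  qed
  finally show ?thesis by (simp add: sum_distrib_left)
qed

text \<open>
  The weighted number of spanning trees of a complete bipartite graph with prescribed degrees on one
  side. The last block is contracted to a single point that carries the weight of the block.
\<close>

lemma linked_families_weight:
  fixes w :: "'a \<Rightarrow> real"
  assumes "finite A" "card A = Suc (\<Sum>l<Suc m. j l)" "\<And>v. 0 \<le> w v"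
  shows "(\<Sum>B\<in>linked_families (Suc m) A j. \<Prod>l<Suc m. \<Prod>v\<in>B l. w v) \<le>
    prod w A * sum w A ^ m * (fact (\<Sum>l<Suc m. j l) / (\<Prod>l<Suc m. fact (j l)))"
  using assms
proof (induction m arbitrary: A w)
  case 0
  have "linked_families (Suc 0) A j \<subseteq> {\<lambda>l\<in>{..<Suc 0}. A}"
  proof
    fix B assume B: "B \<in> linked_families (Suc 0) A j"
    then have "B 0 \<subseteq> A" "card (B 0) = card A" using 0(2) by (auto simp: linked_families_def PiE_iff)
    then have "B 0 = A" using 0(1) by (simp add: card_subset_eq)
    then show "B \<in> {\<lambda>l\<in>{..<Suc 0}. A}"
      using B by (auto simp: linked_families_def PiE_iff extensional_def fun_eq_iff)
  qed
  then have "(\<Sum>B\<in>linked_families (Suc 0) A j. \<Prod>l<Suc 0. \<Prod>v\<in>B l. w v) \<le> (\<Sum>B\<in>{\<lambda>l\<in>{..<Suc 0}. A}. \<Prod>l<Suc 0. \<Prod>v\<in>B l. w v)"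
    using 0(3) by (intro sum_mono2) (auto intro!: prod_nonneg)
  then show ?case by simp
next
  case (Suc m)
  define M where "M = Suc m"
  let ?F = "linked_families (Suc M) A j"
  let ?S = "{X. X \<subseteq> A \<and> card X = Suc (j M)}"
  have cA: "card A = Suc (\<Sum>l<Suc M. j l)" using Suc.prems(2) by (simp add: M_def)
  have fF: "finite ?F" by (rule finite_linked_families[OF Suc.prems(1)])
  define D where "D = fact (\<Sum>l<M. j l) / (\<Prod>l<M. fact (j l) :: real)"
  \<comment> \<open>The families with last block \<open>X\<close> are grouped by their contraction.
    In the contracted set the total weight is unchanged and the product of the weights is
    \<open>prod w (A - X) * sum w X\<close>, so the induction hypothesis evaluates.\<close>
  have step: "(\<Sum>B | B \<in> ?F \<and> B M = X. \<Prod>l<M. \<Prod>v\<in>B l. w v) \<le> prod w (A - X) * sum w X * sum w A ^ m * D"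
    if X: "X \<in> ?S" for X
  proof -
    have XA: "X \<subseteq> A" "card X = Suc (j M)" using X by auto
    then obtain b where b: "b \<in> X" by (metis card.empty ex_in_conv nat.distinct(1))
    have fX: "finite X" using XA Suc.prems(1) finite_subset by blast
    let ?q = "contract X b"
    define w' where "w' = w(b := sum w X)"
    let ?A = "?q ` A"
    have qA: "?A = insert b (A - X)" by (rule contract_image[OF b XA(1)])
    have w': "0 \<le> w' v" for v using Suc.prems(3) by (simp add: w'_def sum_nonneg)
    let ?T = "linked_families M ?A j"
    let ?G = "{B \<in> ?F. B M = X}"
    define h where "h B = (\<lambda>l\<in>{..<M}. ?q ` B l)" for B :: "nat \<Rightarrow> 'a set"
    have hT: "h B \<in> ?T" "\<And>l. l < M \<Longrightarrow> inj_on ?q (B l)" if "B \<in> ?G" for B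
      using linked_contract_families[OF Suc.prems(1) cA, of B b] that b by (auto simp: h_def)
    have "(\<Sum>B\<in>?G. \<Prod>l<M. \<Prod>v\<in>B l. w v) = (\<Sum>C\<in>?T. \<Sum>B | B \<in> ?G \<and> h B = C. \<Prod>l<M. \<Prod>v\<in>B l. w v)"
      using fF Suc.prems(1) hT(1) by (intro sum.group[symmetric] finite_linked_families) auto
    also have "\<dots> \<le> (\<Sum>C\<in>?T. \<Prod>l<M. \<Prod>v\<in>C l. w' v)"
    proof (rule sum_mono)
      fix C assume C: "C \<in> ?T"
      let ?Y = "\<lambda>l. {Y. Y \<subseteq> A \<and> ?q ` Y = C l \<and> inj_on ?q Y}"
      let ?R = "{B \<in> ?G. h B = C}"
      have "(\<Sum>B\<in>?R. \<Prod>l<M. \<Prod>v\<in>B l. w v) = (\<Sum>B\<in>(\<lambda>B. restrict B {..<M}) ` ?R. \<Prod>l<M. \<Prod>v\<in>B l. w v)"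
      proof (subst sum.reindex)
        show "inj_on (\<lambda>B. restrict B {..<M}) ?R"
        proof (rule inj_onI)
          fix B B' assume B: "B \<in> ?R" "B' \<in> ?R" "restrict B {..<M} = restrict B' {..<M}"
          show "B = B'"
          proof
            fix l
            consider "l < M" | "l = M" | "\<not> l < Suc M" by linarith
            then show "B l = B' l"
            proof cases
              case 1
              then show ?thesis using fun_cong[OF B(3), of l] by simp
            next
              case 2
              then show ?thesis using B(1,2) by simp
            next
              case 3
              then show ?thesis using B(1,2) by (simp add: linked_families_def PiE_iff extensional_def)
            qed
          qed
        qed
      qed simp
      also have "\<dots> \<le> (\<Sum>B\<in>Pi\<^sub>E {..<M} ?Y. \<Prod>l<M. \<Prod>v\<in>B l. w v)"
      proof (rule sum_mono2)
        show "finite (Pi\<^sub>E {..<M} ?Y)" using Suc.prems(1) by (intro finite_PiE) auto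
        show "(\<lambda>B. restrict B {..<M}) ` ?R \<subseteq> Pi\<^sub>E {..<M} ?Y"
        proof (rule image_subsetI)
          fix B assume B: "B \<in> ?R"
          have "?q ` B l = C l" if "l < M" for l using B that by (auto simp: h_def)
          moreover have "B l \<subseteq> A" if "l < M" for l using B that by (auto simp: linked_families_def PiE_iff)
          ultimately show "restrict B {..<M} \<in> Pi\<^sub>E {..<M} ?Y"
            unfolding restrict_PiE_iff using hT(2) B by auto
        qed
      qed (use Suc.prems(3) in \<open>auto intro!: prod_nonneg\<close>)
      also have "\<dots> = (\<Prod>l<M. \<Sum>Y\<in>?Y l. \<Prod>v\<in>Y. w v)"
        using Suc.prems(1) by (intro prod_sum_PiE[symmetric]) auto
      also have "\<dots> \<le> (\<Prod>l<M. \<Prod>v\<in>C l. w' v)"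
      proof (intro prod_mono conjI)
        fix l assume "l \<in> {..<M}"
        then have "C l \<subseteq> insert b (A - X)" using C by (auto simp: linked_families_def PiE_iff qA)
        then show "(\<Sum>Y\<in>?Y l. \<Prod>v\<in>Y. w v) \<le> (\<Prod>v\<in>C l. w' v)"
          unfolding w'_def using Suc.prems(1,3) b XA(1) by (intro contract_fiber_sum)
      qed (use Suc.prems(3) in \<open>auto intro!: sum_nonneg prod_nonneg\<close>)
      finally show "(\<Sum>B\<in>?R. \<Prod>l<M. \<Prod>v\<in>B l. w v) \<le> (\<Prod>l<M. \<Prod>v\<in>C l. w' v)" .
    qed
    also have "\<dots> \<le> prod w' ?A * sum w' ?A ^ m * (fact (\<Sum>l<Suc m. j l) / (\<Prod>l<Suc m. fact (j l)))"
      unfolding M_def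
    proof (rule Suc.IH)
      show "card ?A = Suc (\<Sum>l<Suc m. j l)"
        using card_contract[OF Suc.prems(1) b XA(1)] cA XA(2) by (simp add: M_def)
    qed (use Suc.prems(1) w' in auto)
    also have "prod w' ?A = prod w (A - X) * sum w X"
    proof -
      have "prod w' (insert b (A - X)) = w' b * prod w' (A - X)"
        using Suc.prems(1) b by (intro prod.insert) auto
      also have "prod w' (A - X) = prod w (A - X)" using b by (intro prod.cong) (auto simp: w'_def)
      finally show ?thesis by (simp add: qA w'_def)
    qed
    also have "sum w' ?A = sum w A"
    proof -
      have "sum w' (insert b (A - X)) = w' b + sum w' (A - X)"
        using Suc.prems(1) b by (intro sum.insert) auto
      also have "sum w' (A - X) = sum w (A - X)" using b by (intro sum.cong) (auto simp: w'_def)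
      also have "w' b + sum w (A - X) = sum w A"
        using sum.subset_diff[OF XA(1) Suc.prems(1), of w] by (simp add: w'_def)
      finally show ?thesis by (simp add: qA)
    qed
    finally show ?thesis by (simp only: D_def M_def)
  qed
  have "(\<Sum>B\<in>?F. \<Prod>l<Suc M. \<Prod>v\<in>B l. w v) = (\<Sum>X\<in>?S. \<Sum>B | B \<in> ?F \<and> B M = X. \<Prod>l<Suc M. \<Prod>v\<in>B l. w v)"
    using fF Suc.prems(1) by (intro sum.group[symmetric]) (auto simp: linked_families_def PiE_iff)
  also have "\<dots> = (\<Sum>X\<in>?S. prod w X * (\<Sum>B | B \<in> ?F \<and> B M = X. \<Prod>l<M. \<Prod>v\<in>B l. w v))"
    by (intro sum.cong refl) (auto simp: sum_distrib_left mult.commute intro!: sum.cong)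
  also have "\<dots> \<le> (\<Sum>X\<in>?S. prod w X * (prod w (A - X) * sum w X * sum w A ^ m * D))"
    using step Suc.prems(3) by (intro sum_mono mult_left_mono prod_nonneg) auto
  also have "\<dots> = (\<Sum>X\<in>?S. prod w A * sum w A ^ m * D * sum w X)"
  proof (rule sum.cong[OF refl])
    fix X assume "X \<in> ?S"
    then have "prod w A = prod w (A - X) * prod w X"
      using Suc.prems(1) by (intro prod.subset_diff) auto
    then show "prod w X * (prod w (A - X) * sum w X * sum w A ^ m * D) = prod w A * sum w A ^ m * D * sum w X"
      by simp
  qed
  also have "\<dots> = prod w A * sum w A ^ m * D * (real ((card A - 1) choose (j M)) * sum w A)"
    using sum_subsets_card[OF Suc.prems(1), where k="j M" and w=w] by (simp flip: sum_distrib_left)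
  also have "\<dots> = prod w A * sum w A ^ M * (D * real ((card A - 1) choose (j M)))"
    by (simp add: M_def mult_ac)
  \<comment> \<open>As \<open>card A - 1\<close> is the sum of all \<open>j l\<close>, the binomial
    coefficient extends the multinomial coefficient by the last block.\<close>
  also have "D * real ((card A - 1) choose (j M)) = fact (\<Sum>l<Suc M. j l) / (\<Prod>l<Suc M. fact (j l))"
  proof -
    have "card A - 1 = (\<Sum>l<M. j l) + j M" using cA by simp
    then show ?thesis by (simp add: D_def binomial_fact add.commute)
  qed
  finally show ?case by (simp only: M_def)
qed

corollary card_linked_families:
  assumes "finite A" "card A = Suc (\<Sum>l<Suc m. j l)"
  shows "real (card (linked_families (Suc m) A j)) \<le>
    real (card A) ^ m * (fact (\<Sum>l<Suc m. j l) / (\<Prod>l<Suc m. fact (j l)))"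
  using linked_families_weight[OF assms, of "\<lambda>_. 1"] by simp

section \<open>Parallelotopes and simplices\<close>

text \<open>Indexed, so that coinciding vectors count as dependent and coefficients belong to
  indices.\<close>

definition independent_family :: "'j set \<Rightarrow> ('j \<Rightarrow> 'v::real_vector) \<Rightarrow> bool" where
  "independent_family I f \<longleftrightarrow> finite I \<and> (\<forall>c. (\<Sum>j\<in>I. c j *\<^sub>R f j) = 0 \<longrightarrow> (\<forall>j\<in>I. c j = 0))"

definition family_set :: "'j set \<Rightarrow> ('j \<Rightarrow> 'v::real_vector) \<Rightarrow> ('j \<Rightarrow> real set) \<Rightarrow> 'v set" where
  "family_set I f A = {\<Sum>j\<in>I. c j *\<^sub>R f j | c. \<forall>j\<in>I. c j \<in> A j}"

definition family_simplex :: "'j set \<Rightarrow> ('j \<Rightarrow> 'v::real_vector) \<Rightarrow> 'v set" where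
  "family_simplex I f = {\<Sum>j\<in>I. c j *\<^sub>R f j | c. (\<forall>j\<in>I. 0 \<le> c j) \<and> (\<Sum>j\<in>I. c j) \<le> 1}"

lemma independent_familyD:
  "independent_family I f \<Longrightarrow> (\<Sum>j\<in>I. c j *\<^sub>R f j) = 0 \<Longrightarrow> j \<in> I \<Longrightarrow> c j = 0"
  unfolding independent_family_def by blast

lemma enn2real_prod: "enn2real (\<Prod>j\<in>A. g j) = (\<Prod>j\<in>A. enn2real (g j))"
  by (induction A rule: infinite_finite_induct) (simp_all add: enn2real_mult)

lemma independent_family_image:
  assumes "independent_family I f"
  shows "inj_on f I" "finite (f ` I)" "independent (f ` I)"
  using assms family_independent[of I f] by (auto simp: independent_family_def)

lemma comb_family:
  assumes "independent_family I f"
  shows "comb (f ` I) l = (\<Sum>j\<in>I. l (f j) *\<^sub>R f j)"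
  using independent_family_image(1)[OF assms] by (simp add: comb_def sum.reindex)

lemma family_cases:
  assumes "independent_family I f"
  obtains g where "g = the_inv_into I f" "\<And>j. j \<in> I \<Longrightarrow> g (f j) = j"
  using the_inv_into_f_f[OF independent_family_image(1)[OF assms]] by blast

lemma para_family:
  assumes I: "independent_family I f"
  shows "para (f ` I) = family_set I f (\<lambda>_. {0..<1})"
proof (intro equalityI subsetI)
  fix z assume "z \<in> para (f ` I)"
  then obtain l where "l \<in> Pi\<^sub>E (f ` I) (\<lambda>_. {0..<1})" "z = (\<Sum>j\<in>I. l (f j) *\<^sub>R f j)"
    by (auto simp: para_def comb_family[OF I])
  then show "z \<in> family_set I f (\<lambda>_. {0..<1})"
    unfolding family_set_def by (intro CollectI exI[of _ "\<lambda>j. l (f j)"]) (auto simp: PiE_iff)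
next
  fix z assume "z \<in> family_set I f (\<lambda>_. {0..<1})"
  then obtain c where c: "\<forall>j\<in>I. c j \<in> {0..<1}" "z = (\<Sum>j\<in>I. c j *\<^sub>R f j)" by (auto simp: family_set_def)
  obtain g where g: "\<And>j. j \<in> I \<Longrightarrow> g (f j) = j" using family_cases[OF I] by metis
  let ?l = "restrict (\<lambda>v. c (g v)) (f ` I)"
  have "comb (f ` I) ?l = z" using g by (simp add: comb_family[OF I] c(2))
  moreover have "?l \<in> Pi\<^sub>E (f ` I) (\<lambda>_. {0..<1})" unfolding restrict_PiE_iff using c(1) g by auto
  ultimately show "z \<in> para (f ` I)" unfolding para_def by blast
qed

context translation_invariant
begin

lemma
  assumes I: "independent_family I f" "f ` I \<subseteq> W" and A: "\<And>j. j \<in> I \<Longrightarrow> A j \<in> sets borel"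
  shows family_set_measurable: "family_set I f A \<in> sets M"
    and measure_family_set: "measure M (family_set I f A) = measure M (para (f ` I)) * (\<Prod>j\<in>I. measure lborel (A j))"
proof -
  note fi = independent_family_image[OF I(1)]
  obtain g where g: "\<And>j. j \<in> I \<Longrightarrow> g (f j) = j" using family_cases[OF I(1)] by metis
  let ?X = "Pi\<^sub>E (f ` I) (\<lambda>v. A (g v))"
  have gA: "A (g v) \<in> sets borel" if "v \<in> f ` I" for v using that g A by auto
  have X: "?X \<in> sets (\<Pi>\<^sub>M v\<in>f ` I. lborel)" using fi(2) gA by (intro sets_PiM_I_finite) auto
  have eq: "comb (f ` I) ` ?X = family_set I f A"
  proof (intro equalityI subsetI)
    fix z assume "z \<in> comb (f ` I) ` ?X"
    then obtain l where "l \<in> ?X" "z = (\<Sum>j\<in>I. l (f j) *\<^sub>R f j)" by (auto simp: comb_family[OF I(1)])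
    then show "z \<in> family_set I f A"
      unfolding family_set_def using g by (intro CollectI exI[of _ "\<lambda>j. l (f j)"]) (auto simp: PiE_iff)
  next
    fix z assume "z \<in> family_set I f A"
    then obtain c where c: "\<forall>j\<in>I. c j \<in> A j" "z = (\<Sum>j\<in>I. c j *\<^sub>R f j)" by (auto simp: family_set_def)
    let ?l = "restrict (\<lambda>v. c (g v)) (f ` I)"
    have "comb (f ` I) ?l = z" using g by (simp add: comb_family[OF I(1)] c(2))
    moreover have "?l \<in> ?X" unfolding restrict_PiE_iff using c(1) g by auto
    ultimately show "z \<in> comb (f ` I) ` ?X" by blast
  qed
  show "family_set I f A \<in> sets M"
    using comb_image_measurable[OF fi(2,3) I(2) X] by (simp only: eq)
  interpret product_sigma_finite "\<lambda>_::'v. lborel :: real measure" ..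
  have "emeasure (\<Pi>\<^sub>M v\<in>f ` I. lborel) ?X = (\<Prod>v\<in>f ` I. emeasure lborel (A (g v)))"
    using fi(2) gA by (intro emeasure_PiM) auto
  also have "\<dots> = (\<Prod>j\<in>I. emeasure lborel (A j))"
    using g by (simp add: prod.reindex[OF fi(1)])
  finally have "measure (\<Pi>\<^sub>M v\<in>f ` I. lborel) ?X = (\<Prod>j\<in>I. measure lborel (A j))"
    by (simp add: measure_def enn2real_prod)
  then show "measure M (family_set I f A) = measure M (para (f ` I)) * (\<Prod>j\<in>I. measure lborel (A j))"
    using measure_comb_image[OF fi(2,3) I(2) X] by (simp only: eq)
qed

lemma measure_para_scale:
  assumes I: "independent_family I f" "f ` I \<subseteq> W" and t: "\<And>j. j \<in> I \<Longrightarrow> 0 < t j"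
  shows "independent_family I (\<lambda>j. t j *\<^sub>R f j)"
    "measure M (para ((\<lambda>j. t j *\<^sub>R f j) ` I)) = (\<Prod>j\<in>I. t j) * measure M (para (f ` I))"
proof -
  show 1: "independent_family I (\<lambda>j. t j *\<^sub>R f j)"
    unfolding independent_family_def
  proof (intro conjI allI impI)
    show "finite I" using I(1) by (simp add: independent_family_def)
    fix c assume "(\<Sum>j\<in>I. c j *\<^sub>R t j *\<^sub>R f j) = 0"
    then have "(\<Sum>j\<in>I. (c j * t j) *\<^sub>R f j) = 0" by simp
    then have "c j * t j = 0" if "j \<in> I" for j
      using that by (rule independent_familyD[OF I(1), where c="\<lambda>j. c j * t j"])
    then show "\<forall>j\<in>I. c j = 0" using t by force
  qed
  have "para ((\<lambda>j. t j *\<^sub>R f j) ` I) = family_set I f (\<lambda>j. {0..<t j})"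
    unfolding para_family[OF 1]
  proof (intro equalityI subsetI)
    fix z assume "z \<in> family_set I (\<lambda>j. t j *\<^sub>R f j) (\<lambda>_. {0..<1})"
    then obtain c where "\<forall>j\<in>I. c j \<in> {0..<1}" "z = (\<Sum>j\<in>I. (c j * t j) *\<^sub>R f j)" by (auto simp: family_set_def)
    then show "z \<in> family_set I f (\<lambda>j. {0..<t j})"
      unfolding family_set_def using t by (intro CollectI exI[of _ "\<lambda>j. c j * t j"]) (auto simp: less_imp_le)
  next
    fix z assume "z \<in> family_set I f (\<lambda>j. {0..<t j})"
    then obtain c where c: "\<forall>j\<in>I. c j \<in> {0..<t j}" "z = (\<Sum>j\<in>I. c j *\<^sub>R f j)" by (auto simp: family_set_def)
    have "z = (\<Sum>j\<in>I. (c j / t j) *\<^sub>R t j *\<^sub>R f j)" unfolding c(2)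
      by (rule sum.cong[OF refl]) (use t in force)
    moreover have "\<forall>j\<in>I. c j / t j \<in> {0..<1}" using c(1) t by auto
    ultimately show "z \<in> family_set I (\<lambda>j. t j *\<^sub>R f j) (\<lambda>_. {0..<1})" unfolding family_set_def by (intro CollectI exI[of _ "\<lambda>j. c j / t j"] conjI)
  qed
  then show "measure M (para ((\<lambda>j. t j *\<^sub>R f j) ` I)) = (\<Prod>j\<in>I. t j) * measure M (para (f ` I))"
    using measure_family_set[OF I, of "\<lambda>j. {0..<t j}"] t by (simp add: less_imp_le mult.commute)
qed

text \<open>In the coordinates given by \<open>f\<close> this is the standard simplex, whose volume
  is the reciprocal of \<open>fact (card I)\<close>.\<close>

lemma
  assumes I: "independent_family I f" "f ` I \<subseteq> W"
  shows family_simplex_measurable: "family_simplex I f \<in> sets M"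
    and measure_family_simplex: "measure M (family_simplex I f) = measure M (para (f ` I)) / fact (card I)"
    and family_simplex_finite: "emeasure M (family_simplex I f) < \<infinity>"
proof -
  note fi = independent_family_image[OF I(1)]
  obtain g where g: "\<And>j. j \<in> I \<Longrightarrow> g (f j) = j" using family_cases[OF I(1)] by metis
  let ?P = "\<Pi>\<^sub>M v\<in>f ` I. lborel :: real measure"
  let ?X = "{x. (\<forall>v\<in>f ` I. 0 \<le> x v) \<and> sum x (f ` I) \<le> 1} \<inter> space ?P"
  have X: "?X \<in> sets ?P"
  proof -
    have "?X = Pi\<^sub>E (f ` I) (\<lambda>_. {0..}) \<inter> ((\<lambda>x. sum x (f ` I)) -` {..1} \<inter> space ?P)"
      by (auto simp: space_PiM)
    also have "\<dots> \<in> sets ?P"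
      using fi(2) by (intro sets.Int sets_PiM_I_finite measurable_sets[of _ _ borel] borel_measurable_sum) measurable
    finally show ?thesis .
  qed
  have eq: "comb (f ` I) ` ?X = family_simplex I f"
  proof (intro equalityI subsetI)
    fix z assume "z \<in> comb (f ` I) ` ?X"
    then obtain l where l: "\<forall>v\<in>f ` I. 0 \<le> l v" "sum l (f ` I) \<le> 1" "z = (\<Sum>j\<in>I. l (f j) *\<^sub>R f j)"
      by (auto simp: comb_family[OF I(1)])
    then show "z \<in> family_simplex I f"
      unfolding family_simplex_def
      by (intro CollectI exI[of _ "\<lambda>j. l (f j)"]) (simp add: sum.reindex[OF fi(1)])
  next
    fix z assume "z \<in> family_simplex I f"
    then obtain c where c: "\<forall>j\<in>I. 0 \<le> c j" "(\<Sum>j\<in>I. c j) \<le> 1" "z = (\<Sum>j\<in>I. c j *\<^sub>R f j)"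
      by (auto simp: family_simplex_def)
    let ?l = "restrict (\<lambda>v. c (g v)) (f ` I)"
    have "comb (f ` I) ?l = z" using g by (simp add: comb_family[OF I(1)] c(3))
    moreover have "?l \<in> ?X" using c(1,2) g by (auto simp: space_PiM sum.reindex[OF fi(1)])
    ultimately show "z \<in> comb (f ` I) ` ?X" by blast
  qed
  show "family_simplex I f \<in> sets M"
    using comb_image_measurable[OF fi(2,3) I(2) X] by (simp only: eq)
  have e: "emeasure ?P ?X = ennreal (1 / fact (card I))"
    using emeasure_std_simplex_aux[OF fi(2), of 1] card_image[OF fi(1)] by simp
  show "measure M (family_simplex I f) = measure M (para (f ` I)) / fact (card I)"
    using measure_comb_image[OF fi(2,3) I(2) X, unfolded eq] e by (simp add: measure_def)
  show "emeasure M (family_simplex I f) < \<infinity>"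
    using emeasure_comb_image[OF fi(2,3) I(2) X, unfolded eq] emeasure_para_finite[OF fi(2,3) I(2) sets.empty_sets] e
    by (simp add: ennreal_mult_less_top)
qed

text \<open>
  Both parallelotopes are compared with translates by the lattice of the second basis: those of the
  second one cover everything, those of the first one are disjoint.
\<close>

lemma measure_para_le:
  assumes B: "finite B" "independent B" "B \<subseteq> W"
    and B': "finite B'" "independent B'" "span B' = W"
    and int: "\<And>b. b \<in> B' \<Longrightarrow> \<exists>k :: 'v \<Rightarrow> int. b = comb B (\<lambda>v. of_int (k v))"
  shows "measure M (para B) \<le> measure M (para B')"
proof -
  have B'W: "B' \<subseteq> W" using B'(3) span_superset by blast
  define L where "L k = comb B' (\<lambda>v. of_int (k v))" for k :: "'v \<Rightarrow> int"
  define K where "K = Pi\<^sub>E B' (\<lambda>_. UNIV :: int set)"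
  have cK: "countable K" unfolding K_def using B'(1) by (intro countable_PiE) auto
  have LW: "L k \<in> W" "- L k \<in> W" for k
    using comb_in_subspace[OF subspace_W B'W] subspace_neg[OF subspace_W] by (auto simp: L_def)
  have comb_eqD: "\<forall>v\<in>C. l v = m v" if C: "finite C" "independent C" "comb C l = comb C m" for C :: "'v set" and l m
  proof -
    obtain \<psi> where "\<And>l v. v \<in> C \<Longrightarrow> \<psi> v (comb C l) = l v"
      using dual_coordinates[OF C(1,2)] by metis
    then show ?thesis using C(3) by metis
  qed
  have inj: "k = k'" if "k \<in> K" "k' \<in> K" "L k = L k'" for k k'
    using comb_eqD[OF B'(1,2) that(3)[unfolded L_def]] that(1,2)
    by (auto simp: K_def PiE_iff extensional_def fun_eq_iff)
  \<comment> \<open>An integer that is the difference of two numbers in the half-open unit interval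
    is 0, so no nonzero lattice vector keeps a point inside the parallelotope.\<close>
  have int_para: "comb C (\<lambda>v. of_int (k v)) = 0"
    if C: "finite C" "independent C" and x: "x \<in> para C" "x + comb C (\<lambda>v. of_int (k v)) \<in> para C"
    for C :: "'v set" and k :: "'v \<Rightarrow> int" and x
  proof -
    obtain l m where l: "\<forall>v\<in>C. 0 \<le> l v \<and> l v < 1" "x = comb C l"
      and m: "\<forall>v\<in>C. 0 \<le> m v \<and> m v < 1" "x + comb C (\<lambda>v. of_int (k v)) = comb C m"
      using x by (auto simp: para_def PiE_iff)
    have "comb C m = comb C (\<lambda>v. l v + of_int (k v))" using l(2) m(2) by (simp add: comb_add)
    then have "\<forall>v\<in>C. m v = l v + of_int (k v)" by (rule comb_eqD[OF C])
    then have "\<forall>v\<in>C. k v = 0" using l(1) m(1) by force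
    then show ?thesis by (simp add: comb_def)
  qed
  \<comment> \<open>The lattice of \<open>B'\<close> is contained in that of \<open>B\<close>; this
    makes the pieces \<open>Y k\<close> disjoint.\<close>
  have Lint: "\<exists>k'. L k = comb B (\<lambda>v. of_int (k' v))" for k
  proof -
    obtain \<kappa> where \<kappa>: "\<And>b. b \<in> B' \<Longrightarrow> b = comb B (\<lambda>v. of_int (\<kappa> b v :: int))" using int by metis
    have "L k = (\<Sum>b\<in>B'. of_int (k b) *\<^sub>R comb B (\<lambda>v. of_int (\<kappa> b v)))"
      unfolding L_def comb_def[of B'] using \<kappa> by (intro sum.cong) auto
    also have "\<dots> = comb B (\<lambda>v. of_int (\<Sum>b\<in>B'. k b * \<kappa> b v))"
      unfolding comb_def by (simp add: scaleR_sum_right scaleR_left.sum sum.swap[of _ B])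
    finally show ?thesis by (rule exI[of _ "\<lambda>v. \<Sum>b\<in>B'. k b * \<kappa> b v"])
  qed
  have diff: "L k - L k' = comb B' (\<lambda>v. of_int (k v - k' v))" for k k'
    by (simp add: L_def comb_def scaleR_diff_left sum_subtractf)
  \<comment> \<open>The parallelotope of \<open>B\<close> is cut along the tiles of the lattice of
    \<open>B'\<close>; \<open>Y k\<close> is the piece moved back into the tile at the
    origin.\<close>
  define X where "X k = para B \<inter> (+) (L k) ` para B'" for k
  define Y where "Y k = (+) (- L k) ` X k" for k
  note pm = para_measurable[OF B] para_measurable[OF B'(1,2) B'W]
  have Xm: "X k \<in> sets M" for k
    unfolding X_def using pm translate(1)[OF pm(2) LW(1)] by blast
  have Ym: "Y k \<in> sets M" "emeasure M (Y k) = emeasure M (X k)" for k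
    unfolding Y_def using translate[OF Xm LW(2)] by auto
  have "para B \<subseteq> (\<Union>k\<in>K. X k)"
  proof
    fix z assume z: "z \<in> para B"
    then have "z \<in> span B'"
      using comb_in_subspace[OF subspace_W B(3)] B'(3) by (auto simp: para_def)
    then obtain l where l: "z = comb B' l" using B'(1) by (auto simp: span_finite comb_def)
    define k where "k = (\<lambda>v\<in>B'. \<lfloor>l v\<rfloor>)"
    have "z = L k + comb B' (\<lambda>v\<in>B'. frac (l v))"
    proof -
      have "comb B' l = comb B' (\<lambda>v. of_int (k v) + frac (l v))"
        unfolding comb_def by (rule sum.cong) (auto simp: k_def frac_def)
      then show ?thesis by (simp add: l L_def comb_add)
    qed
    moreover have "comb B' (\<lambda>v\<in>B'. frac (l v)) \<in> para B'"
      unfolding para_def by (intro imageI) (auto simp: restrict_PiE_iff frac_lt_1)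
    ultimately have "z \<in> X k" unfolding X_def using z by blast
    moreover have "k \<in> K" by (simp add: K_def k_def)
    ultimately show "z \<in> (\<Union>k\<in>K. X k)" by blast
  qed
  then have U: "(\<Union>k\<in>K. X k) = para B" by (auto simp: X_def)
  have Xd: "disjoint_family_on X K"
    unfolding disjoint_family_on_def
  proof (intro ballI impI, rule ccontr)
    fix k k' assume k: "k \<in> K" "k' \<in> K" "k \<noteq> k'" "X k \<inter> X k' \<noteq> {}"
    then obtain x x' where x: "x \<in> para B'" "x' \<in> para B'" "L k + x = L k' + x'"
      by (auto simp: X_def)
    then have "x + comb B' (\<lambda>v. of_int (k v - k' v)) \<in> para B'"
      unfolding diff[symmetric] by (metis add.commute add_diff_eq add_diff_cancel_left' diff_add_eq)
    then have "L k - L k' = 0" unfolding diff by (rule int_para[OF B'(1,2) x(1)])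
    then show False using inj[OF k(1,2)] k(3) by simp
  qed
  have Yd: "disjoint_family_on Y K"
    unfolding disjoint_family_on_def
  proof (intro ballI impI, rule ccontr)
    fix k k' assume k: "k \<in> K" "k' \<in> K" "k \<noteq> k'" "Y k \<inter> Y k' \<noteq> {}"
    then obtain x x' where x: "x \<in> para B" "x' \<in> para B" "- L k + x = - L k' + x'"
      by (auto simp: X_def Y_def)
    obtain m where m: "L (\<lambda>v. k' v - k v) = comb B (\<lambda>v. of_int (m v))" using Lint by blast
    have d: "L (\<lambda>v. k' v - k v) = L k' - L k" unfolding diff by (simp add: L_def)
    have "x + L (\<lambda>v. k' v - k v) = x'" unfolding d using x(3) by (simp add: algebra_simps)
    then have "x + comb B (\<lambda>v. of_int (m v)) \<in> para B" using x(2) m by simp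
    then have "L k' - L k = 0" unfolding d[symmetric] m by (rule int_para[OF B(1,2) x(1)])
    then show False using inj[OF k(1,2)] k(3) by simp
  qed
  have "emeasure M (para B) = (\<integral>\<^sup>+k. emeasure M (X k) \<partial>count_space K)"
    unfolding U[symmetric] using cK Xm Xd by (intro emeasure_UN_countable) auto
  also have "\<dots> = (\<integral>\<^sup>+k. emeasure M (Y k) \<partial>count_space K)" by (simp add: Ym)
  also have "\<dots> = emeasure M (\<Union>k\<in>K. Y k)"
    using cK Ym Yd by (intro emeasure_UN_countable[symmetric]) auto
  also have "\<dots> \<le> emeasure M (para B')"
    using pm by (intro emeasure_mono) (auto simp: Y_def X_def)
  finally show ?thesis
    using emeasure_para_finite[OF B'(1,2) B'W sets.empty_sets]
    unfolding measure_def by (intro enn2real_mono) auto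
qed

end

section \<open>Representations of minimal total weight\<close>

lemma lexle_sym_zero: "lexle js (\<lambda>_. 0) d \<Longrightarrow> lexle js (\<lambda>_. 0) (\<lambda>j. - d j) \<Longrightarrow> j \<in> set js \<Longrightarrow> d j = 0"
  by (induction js) auto

text \<open>Minimal total weight alone does not make the support independent, as there may be
  several minimisers; the lexicographic order breaks ties. Along a relation \<open>d\<close> on the
  support both directions are admissible, so \<open>d\<close> has sum 0, and then neither
  \<open>d\<close> nor \<open>- d\<close> is lexicographically below 0.\<close>

lemma optimal_representation:
  fixes x :: "'j \<Rightarrow> 'v::real_normed_vector"
  assumes J: "finite J" and z: "\<exists>m\<in>weights J. wsum x J m = z \<and> sum m J \<le> 1"
  obtains l where "l \<in> weights J" "wsum x J l = z" "sum l J \<le> 1"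
    "\<And>m. m \<in> weights J \<Longrightarrow> wsum x J m = z \<Longrightarrow> sum l J \<le> sum m J"
    "\<And>d. (\<And>j. l j = 0 \<Longrightarrow> d j = 0) \<Longrightarrow> wsum x J d = 0 \<Longrightarrow> d = (\<lambda>_. 0)"
proof -
  obtain js where js: "set js = J" using finite_list[OF J] by blast
  have cs: "continuous_on A (\<lambda>m :: 'j \<Rightarrow> real. sum m J)" for A
    by (intro continuous_on_sum continuous_on_coordinate)
  let ?X = "{m \<in> weights J. \<forall>j\<in>J. m j \<le> 1} \<inter> ({m. wsum x J m = z} \<inter> {m. sum m J \<le> 1})"
  have cX: "compact ?X"
    by (intro compact_Int_closed compact_weights closed_Int closed_wsum_eq closed_Collect_le cs continuous_on_const)
  have X: "?X = {m \<in> weights J. wsum x J m = z \<and> sum m J \<le> 1}"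
  proof -
    have "m j \<le> 1" if "m \<in> weights J" "sum m J \<le> 1" "j \<in> J" for m j
      using member_le_sum[of j J m] that J by (auto simp: weights_def)
    then show ?thesis by blast
  qed
  have "?X \<noteq> {}" unfolding X using z by blast
  then obtain l0 where l0: "l0 \<in> ?X" "\<And>m. m \<in> ?X \<Longrightarrow> sum l0 J \<le> sum m J"
    using continuous_attains_inf[OF cX _ cs] by blast
  let ?Y = "?X \<inter> {m. sum m J \<le> sum l0 J}"
  have "compact ?Y" by (rule compact_Int_closed[OF cX]) (intro closed_Collect_le cs continuous_on_const)
  moreover have "?Y \<noteq> {}" using l0 by blast
  ultimately obtain l where l: "l \<in> ?Y" "\<And>m. m \<in> ?Y \<Longrightarrow> lexle js l m"
    using compact_lexmin_exists[of ?Y js] by blast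
  have lw: "l \<in> weights J" "wsum x J l = z" "sum l J \<le> 1" "sum l J \<le> sum l0 J" using l(1) X by auto
  have opt: "sum l J \<le> sum m J" if "m \<in> weights J" "wsum x J m = z" for m
  proof (cases "sum m J \<le> 1")
    case True
    then have "m \<in> ?X" unfolding X using that by blast
    then show ?thesis using l0(2) lw(4) by force
  next
    case False
    then show ?thesis using lw(3) by simp
  qed
  have ind: "d = (\<lambda>_. 0)" if d: "\<And>j. l j = 0 \<Longrightarrow> d j = 0" and 0: "wsum x J d = 0" for d
  proof -
    have dJ: "d j = 0" if "j \<notin> J" for j using d[of j] lw(1) that by (simp add: weights_def)
    have shift: "\<exists>e>0. (\<lambda>j. l j + e * h j) \<in> weights J \<and> sum l J \<le> sum l J + e * sum h J \<and>
        (sum h J = 0 \<longrightarrow> lexle js (\<lambda>_. 0) h)"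
      if h: "\<And>j. l j = 0 \<Longrightarrow> h j = 0" and h0: "wsum x J h = 0" for h
    proof -
      have hJ: "h j = 0" if "j \<notin> J" for j using h[of j] lw(1) that by (simp add: weights_def)
      have "\<exists>e>0. (\<lambda>j. l j + e * h j) \<in> weights J"
        by (rule weights_perturb[OF J lw(1)]) (use hJ h in auto)
      then obtain e where e: "0 < e" "(\<lambda>j. l j + e * h j) \<in> weights J" by blast
      have w: "wsum x J (\<lambda>j. l j + e * h j) = z"
        using wsum_perturb[of x J l e h "\<lambda>_. 0"] h0 lw(2) by (simp add: wsum_def)
      have s: "sum (\<lambda>j. l j + e * h j) J = sum l J + e * sum h J"
        by (simp add: sum.distrib sum_distrib_left)
      have "lexle js (\<lambda>_. 0) h" if "sum h J = 0"
      proof -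
        have "(\<lambda>j. l j + e * h j) \<in> ?Y" using e(2) w s that lw X by auto
        then have "lexle js l (\<lambda>j. l j + e * (h j - 0))" using l(2) by simp
        then show ?thesis using lexle_shift[OF e(1), of js l h "\<lambda>_. 0"] by simp
      qed
      then show ?thesis using e opt[OF e(2) w] s by metis
    qed
    have "wsum x J (\<lambda>j. - d j) = 0" using 0 by (simp add: wsum_def sum_negf)
    then obtain e1 e2 where e1: "0 < e1" "0 \<le> e1 * sum d J" "sum d J = 0 \<longrightarrow> lexle js (\<lambda>_. 0) d"
      and e2: "0 < e2" "0 \<le> e2 * sum (\<lambda>j. - d j) J" "sum (\<lambda>j. - d j) J = 0 \<longrightarrow> lexle js (\<lambda>_. 0) (\<lambda>j. - d j)"
      using shift[OF d 0] shift[of "\<lambda>j. - d j"] d by force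
    have "sum d J = 0" using e1(1,2) e2(1,2) by (simp add: sum_negf zero_le_mult_iff mult_le_0_iff)
    then have "d j = 0" if "j \<in> J" for j
      using lexle_sym_zero[of js d j] e1(3) e2(3) that js by (simp add: sum_negf)
    then show ?thesis using dJ by blast
  qed
  show thesis by (rule that[OF lw(1-3) opt ind])
qed

section \<open>Parallelotopes spanned by vertices of a simplex\<close>

text \<open>The spanning vectors before scaling by \<open>t\<close>. Row 0 puts the diagonal on the
  same footing as the \<open>p\<close> inclusions; for a fixed vertex the \<open>p + 1\<close>
  vectors add up to 0.\<close>

definition spike :: "nat \<Rightarrow> nat \<times> (real ^ 'n) \<Rightarrow> (nat \<Rightarrow>\<^sub>0 real ^ 'n)" where
  "spike p j = (if fst j = 0 then - diag p (snd j) else incl (fst j) (snd j))"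

lemma spike_in_families: "l \<le> p \<Longrightarrow> spike p (l, v) \<in> families p"
  by (auto simp: spike_def families_def lookup_incl)

lemma spike_image_families: "\<sigma> \<subseteq> {..p} \<times> A \<Longrightarrow> spike p ` \<sigma> \<subseteq> families p"
proof (rule image_subsetI)
  fix j assume "\<sigma> \<subseteq> {..p} \<times> A" "j \<in> \<sigma>"
  then have "fst j \<le> p" by auto
  then show "spike p j \<in> families p" using spike_in_families[of "fst j" p "snd j"] by simp
qed

lemma lookup_spike: "k \<in> {1..p} \<Longrightarrow>
  Poly_Mapping.lookup (spike p (l, v)) k = (if l = 0 then - v else if l = k then v else 0)"
  by (auto simp: spike_def lookup_incl)

lemma spans_families:
  fixes C :: "(nat \<Rightarrow>\<^sub>0 real ^ 'n) set"
  assumes C: "finite C" "independent C" "C \<subseteq> families p" and card: "card C = CARD('n) * p"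
  shows "span C = families p"
proof (intro equalityI subsetI)
  show "z \<in> families p" if "z \<in> span C" for z :: "nat \<Rightarrow>\<^sub>0 real ^ 'n"
    using that span_minimal[OF C(3) subspace_families] by blast
  obtain B :: "(nat \<Rightarrow>\<^sub>0 real ^ 'n) set" where B: "finite B" "independent B" "span B = families p" "card B = CARD('n) * p"
    by (rule basis_families)
  fix z :: "nat \<Rightarrow>\<^sub>0 real ^ 'n" assume z: "z \<in> families p"
  show "z \<in> span C"
  proof (rule ccontr)
    assume "z \<notin> span C"
    then have "independent (insert z C)" "z \<notin> C" using C(2) span_base by (auto simp: independent_insert)
    moreover have "insert z C \<subseteq> span B" using z C(3) B(3) by blast
    ultimately have "card (insert z C) \<le> card B" using independent_span_bound[OF B(1)] by blast
    then show False using C(1) \<open>z \<notin> C\<close> card B(4) by simp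
  qed
qed

lemma span_neq_families:
  fixes C :: "(nat \<Rightarrow>\<^sub>0 real ^ 'n) set"
  assumes "finite C" "card C < CARD('n) * p"
  shows "span C \<noteq> families p"
proof
  obtain B :: "(nat \<Rightarrow>\<^sub>0 real ^ 'n) set" where B: "finite B" "independent B" "span B = families p" "card B = CARD('n) * p"
    by (rule basis_families)
  assume "span C = families p"
  then have "card B \<le> card C" using independent_span_bound[OF assms(1) B(2)] B(3) span_superset by blast
  then show False using assms(2) B(4) by simp
qed

lemma measure_power_para:
  fixes P :: "(real ^ 'n) set"
  assumes "P \<in> sets lborel"
  shows "measure (volM p) {z \<in> families p. \<forall>l\<in>{1..p}. Poly_Mapping.lookup z l \<in> P} = measure lborel P ^ p"
proof -
  let ?D = "{z \<in> families p. \<forall>l\<in>{1..p}. Poly_Mapping.lookup z l \<in> P}"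
  have eq: "emb p -` ?D \<inter> space (power_lborel p) = Pi\<^sub>E {1..p} (\<lambda>_. P)"
    by (auto simp: space_power_lborel PiE_def)
  have D: "?D \<in> sets (volM p)"
    unfolding sets_volM_iff eq using assms by (intro sets_PiM_I_finite) auto
  interpret product_sigma_finite "\<lambda>_::nat. lborel :: (real ^ 'n) measure" ..
  have "emeasure (volM p) ?D = (\<Prod>l\<in>{1..p}. emeasure lborel P)"
    unfolding emeasure_volM[OF D] eq using assms by (intro emeasure_PiM) auto
  then show ?thesis
    using enn2real_prod[of "\<lambda>_. emeasure lborel P" "{1..p}"] by (simp add: measure_def)
qed

context
  fixes V :: "(real ^ 'n) set"
  assumes V: "\<not> affine_dependent V" "card V = CARD('n) + 1" "\<Sum>V = 0"
begin

lemma finite_vertices: "finite V" using V(2) by (metis Suc_eq_plus1 card.infinite nat.distinct(1))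

text \<open>As the vertices add up to 0, subtracting the mean from the coefficients preserves the
  relation and makes it affine, so affine independence applies.\<close>

lemma affine_relation_const:
  assumes "(\<Sum>v\<in>V. r v *\<^sub>R v) = 0"
  shows "\<exists>k. \<forall>v\<in>V. r v = k"
proof -
  define k where "k = sum r V / real (CARD('n) + 1)"
  have "sum (\<lambda>v. r v - k) V = 0" using V(2) by (simp add: sum_subtractf k_def)
  moreover have "(\<Sum>v\<in>V. (r v - k) *\<^sub>R v) = 0"
    using assms V(3) by (simp add: scaleR_diff_left sum_subtractf flip: scaleR_sum_right)
  ultimately have "\<forall>v\<in>V. r v - k = 0"
    using V(1) unfolding affine_dependent_explicit_finite[OF finite_vertices] by blast
  then show ?thesis by (intro exI[of _ k]) auto
qed

lemma independent_remove: "v0 \<in> V \<Longrightarrow> independent (V - {v0})"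
proof
  assume v0: "v0 \<in> V" and "dependent (V - {v0})"
  then obtain u v where u: "v \<in> V - {v0}" "u v \<noteq> 0" "(\<Sum>v\<in>V - {v0}. u v *\<^sub>R v) = 0"
    using finite_vertices by (auto simp: dependent_finite)
  let ?r = "u(v0 := 0)"
  have "(\<Sum>v\<in>V. ?r v *\<^sub>R v) = ?r v0 *\<^sub>R v0 + (\<Sum>v\<in>V - {v0}. ?r v *\<^sub>R v)" using finite_vertices v0 by (rule sum.remove)
  also have "(\<Sum>v\<in>V - {v0}. ?r v *\<^sub>R v) = 0" unfolding u(3)[symmetric] by (rule sum.cong) auto
  finally have "(\<Sum>v\<in>V. ?r v *\<^sub>R v) = 0" by simp
  then obtain k where "\<forall>v\<in>V. ?r v = k" using affine_relation_const by blast
  then have "?r v0 = ?r v" using v0 u(1) by (metis DiffD1)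
  then show False using u(1,2) by auto
qed

text \<open>The k-th factor sees only the rows 0 and \<open>k\<close>.\<close>

lemma lookup_spike_sum:
  assumes "k \<in> {1..p}"
  shows "Poly_Mapping.lookup (\<Sum>j\<in>{..p} \<times> V. r j *\<^sub>R spike p j) k = (\<Sum>v\<in>V. (r (k, v) - r (0, v)) *\<^sub>R v)"
proof -
  have "Poly_Mapping.lookup (\<Sum>j\<in>{..p} \<times> V. r j *\<^sub>R spike p j) k =
      (\<Sum>l\<in>{..p}. \<Sum>v\<in>V. r (l, v) *\<^sub>R Poly_Mapping.lookup (spike p (l, v)) k)"
    by (simp add: lookup_sum sum.cartesian_product)
  also have "\<dots> = (\<Sum>v\<in>V. \<Sum>l\<in>{..p}. r (l, v) *\<^sub>R Poly_Mapping.lookup (spike p (l, v)) k)" by (rule sum.swap)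
  also have "\<dots> = (\<Sum>v\<in>V. (r (k, v) - r (0, v)) *\<^sub>R v)"
  proof (rule sum.cong[OF refl])
    fix v
    have "(\<Sum>l\<in>{..p}. r (l, v) *\<^sub>R Poly_Mapping.lookup (spike p (l, v)) k) =
        (\<Sum>l\<in>{0, k}. r (l, v) *\<^sub>R Poly_Mapping.lookup (spike p (l, v)) k)"
      using assms by (intro sum.mono_neutral_right) (auto simp: lookup_spike)
    also have "\<dots> = (r (k, v) - r (0, v)) *\<^sub>R v"
      using assms by (auto simp: lookup_spike scaleR_diff_left)
    finally show "(\<Sum>l\<in>{..p}. r (l, v) *\<^sub>R Poly_Mapping.lookup (spike p (l, v)) k) = (r (k, v) - r (0, v)) *\<^sub>R v" .
  qed
  finally show ?thesis .
qed

text \<open>In the l-th factor the relation has the coefficients \<open>r (l, v) - r (0, v)\<close>,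
  which are constant in \<open>v\<close> by \<open>affine_relation_const\<close>; row 0 supplies
  \<open>\<alpha>\<close>.\<close>

lemma spike_relation:
  assumes "(\<Sum>j\<in>{..p} \<times> V. r j *\<^sub>R spike p j) = 0"
  shows "\<exists>\<alpha> \<beta>. \<forall>l\<le>p. \<forall>v\<in>V. r (l, v) = \<beta> l - \<alpha> v"
proof -
  have "\<exists>b. \<forall>v\<in>V. r (l, v) - r (0, v) = b" if "l \<le> p" for l
  proof (cases "l = 0")
    case False
    then have "(\<Sum>v\<in>V. (r (l, v) - r (0, v)) *\<^sub>R v) = 0"
      using lookup_spike_sum[of l p r] assms that by simp
    then show ?thesis by (rule affine_relation_const)
  qed auto
  then obtain \<beta> where \<beta>: "\<And>l v. l \<le> p \<Longrightarrow> v \<in> V \<Longrightarrow> r (l, v) - r (0, v) = \<beta> l" by metis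
  have "r (l, v) = \<beta> l - (- r (0, v))" if "l \<le> p" "v \<in> V" for l v
    using \<beta>[OF that] by simp
  then have "\<forall>l\<le>p. \<forall>v\<in>V. r (l, v) = \<beta> l - (\<lambda>v. - r (0, v)) v" by blast
  then show ?thesis by (intro exI)
qed

text \<open>With the converse, the relations are exactly the potential differences on the complete
  bipartite graph between rows and vertices. So the vectors represent the cographic matroid of this
  graph, and their bases are the complements of spanning trees.\<close>

lemma spike_relation_intro: "(\<Sum>j\<in>{..p} \<times> V. (\<beta> (fst j) - \<alpha> (snd j)) *\<^sub>R spike p j) = 0"
proof (rule poly_mapping_eqI)
  fix k
  show "Poly_Mapping.lookup (\<Sum>j\<in>{..p} \<times> V. (\<beta> (fst j) - \<alpha> (snd j)) *\<^sub>R spike p j) k = Poly_Mapping.lookup 0 k"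
  proof (cases "k \<in> {1..p}")
    case True
    have "(\<Sum>v\<in>V. (\<beta> k - \<alpha> v - (\<beta> 0 - \<alpha> v)) *\<^sub>R v) = (\<beta> k - \<beta> 0) *\<^sub>R \<Sum>V"
      by (simp add: scaleR_sum_right)
    then show ?thesis using lookup_spike_sum[OF True, of "\<lambda>j. \<beta> (fst j) - \<alpha> (snd j)"] V(3) by simp
  next
    case False
    have "(\<Sum>j\<in>{..p} \<times> V. (\<beta> (fst j) - \<alpha> (snd j)) *\<^sub>R spike p j) \<in> families p"
      using subspace_families spike_in_families by (intro subspace_sum subspace_scale) auto
    then show ?thesis using False by (simp add: families_def)
  qed
qed

text \<open>
  Unimodularity: a relation has the shape \<open>\<beta> l - \<alpha> v\<close>, so it can be replaced by the relation
  \<open>[\<beta> l \<ge> \<theta>] - [\<alpha> v \<ge> \<theta>]\<close>, whose coefficients are \<open>0\<close> and \<open>\<plusminus>1\<close>.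
\<close>

lemma spike_integral:
  assumes \<sigma>: "\<sigma> \<subseteq> {..p} \<times> V" "independent_family \<sigma> (spike p)" "card \<sigma> = CARD('n) * p"
    and e: "e \<in> {..p} \<times> V"
  shows "\<exists>k :: nat \<times> (real ^ 'n) \<Rightarrow> int. spike p e = (\<Sum>j\<in>\<sigma>. of_int (k j) *\<^sub>R spike p j)"
proof (cases "e \<in> \<sigma>")
  case True
  have "spike p e = (\<Sum>j\<in>\<sigma>. of_int (if j = e then 1 else 0) *\<^sub>R spike p j)"
    using True \<sigma>(2) by (simp add: independent_family_def if_distrib[of "\<lambda>x. x *\<^sub>R _"] if_distrib[of real_of_int] cong: if_cong)
  then show ?thesis by (rule exI[of _ "\<lambda>j. if j = e then 1 else 0"])
next
  case False
  note fi = independent_family_image[OF \<sigma>(2)]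
  have f\<sigma>: "finite \<sigma>" using \<sigma>(2) by (simp add: independent_family_def)
  have fJ: "finite ({..p} \<times> V)" using finite_vertices by simp
  have sub: "spike p ` \<sigma> \<subseteq> families p" using \<sigma>(1) by (rule spike_image_families)
  have "span (spike p ` \<sigma>) = families p"
    by (rule spans_families[OF fi(2,3) sub]) (simp add: card_image[OF fi(1)] \<sigma>(3))
  moreover have "spike p e \<in> families p" using e spike_in_families by (cases e) auto
  ultimately obtain u where u: "spike p e = (\<Sum>w\<in>spike p ` \<sigma>. u w *\<^sub>R w)"
    using fi(2) by (auto simp: span_finite)
  define r where "r j = (if j = e then 1 else if j \<in> \<sigma> then - u (spike p j) else 0)" for j
  have split: "(\<Sum>j\<in>{..p} \<times> V. r' j *\<^sub>R spike p j) = r' e *\<^sub>R spike p e + (\<Sum>j\<in>\<sigma>. r' j *\<^sub>R spike p j)"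
    if "\<And>j. j \<in> {..p} \<times> V \<Longrightarrow> j \<notin> insert e \<sigma> \<Longrightarrow> r' j = 0" for r' :: "nat \<times> (real ^ 'n) \<Rightarrow> real"
  proof -
    have "(\<Sum>j\<in>{..p} \<times> V. r' j *\<^sub>R spike p j) = (\<Sum>j\<in>insert e \<sigma>. r' j *\<^sub>R spike p j)"
      using fJ \<sigma>(1) e that by (intro sum.mono_neutral_right) auto
    then show ?thesis using f\<sigma> False by simp
  qed
  have "(\<Sum>j\<in>\<sigma>. r j *\<^sub>R spike p j) = (\<Sum>j\<in>\<sigma>. - (u (spike p j) *\<^sub>R spike p j))"
    by (rule sum.cong) (use False in \<open>auto simp: r_def\<close>)
  also have "\<dots> = - spike p e" unfolding u by (simp add: sum.reindex[OF fi(1)] sum_negf)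
  finally have r0: "(\<Sum>j\<in>{..p} \<times> V. r j *\<^sub>R spike p j) = 0"
    using split[of r] by (simp add: r_def)
  obtain \<alpha> \<beta> where "\<forall>l\<le>p. \<forall>v\<in>V. r (l, v) = \<beta> l - \<alpha> v"
    using spike_relation[OF r0] by (elim exE)
  then have ab: "\<And>l v. l \<le> p \<Longrightarrow> v \<in> V \<Longrightarrow> r (l, v) = \<beta> l - \<alpha> v" by simp
  obtain l0 v0 where e': "e = (l0, v0)" "l0 \<le> p" "v0 \<in> V" using e by (cases e) auto
  \<comment> \<open>The threshold is \<open>\<beta> l0\<close>. At \<open>e\<close> the coefficient
    \<open>\<beta> l0 - \<alpha> v0\<close> is 1, so \<open>\<alpha> v0\<close> lies below the
    threshold and the new coefficient is 1 again; at pairs outside \<open>\<sigma>\<close> other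
    than \<open>e\<close> the two labels agree, so it stays 0.\<close>
  define B where "B l = (if \<beta> l0 \<le> \<beta> l then 1 else 0 :: int)" for l
  define A where "A v = (if \<beta> l0 \<le> \<alpha> v then 1 else 0 :: int)" for v
  have "B l0 - A v0 = 1"
    using ab[OF e'(2,3)] by (simp add: A_def B_def r_def e'(1))
  moreover have z: "real_of_int (B (fst j)) - real_of_int (A (snd j)) = 0"
    if "j \<in> {..p} \<times> V" "j \<notin> insert e \<sigma>" for j
    using ab[of "fst j" "snd j"] that by (auto simp: r_def A_def B_def)
  ultimately have "spike p e + (\<Sum>j\<in>\<sigma>. (real_of_int (B (fst j)) - real_of_int (A (snd j))) *\<^sub>R spike p j) = 0"
    using split[of "\<lambda>j. real_of_int (B (fst j)) - real_of_int (A (snd j))", OF z]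
      spike_relation_intro[of "\<lambda>l. real_of_int (B l)" "\<lambda>v. real_of_int (A v)" p]
    by (simp add: e'(1) flip: of_int_diff)
  then have "spike p e = (\<Sum>j\<in>\<sigma>. of_int (A (snd j) - B (fst j)) *\<^sub>R spike p j)"
    by (simp add: add_eq_0_iff2 scaleR_diff_left sum_subtractf)
  then show ?thesis by (rule exI[of _ "\<lambda>j. A (snd j) - B (fst j)"])
qed

text \<open>The reference basis: in each of the \<open>p\<close> factors it is
  \<open>V - {v0}\<close>, so its parallelotope is a product.\<close>

lemma base_family:
  assumes v0: "v0 \<in> V"
  shows "independent_family ({1..p} \<times> (V - {v0})) (spike p)"
    and "card ({1..p} \<times> (V - {v0})) = CARD('n) * p"
    and "measure (volM p) (para (spike p ` ({1..p} \<times> (V - {v0})))) = measure lborel (para (V - {v0})) ^ p"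
proof -
  let ?I = "{1..p} \<times> (V - {v0})"
  have fI: "finite ?I" using finite_vertices by simp
  show "card ?I = CARD('n) * p" using V(2) finite_vertices v0 by (simp add: card_cartesian_product)
  have sum: "(\<Sum>j\<in>?I. c j *\<^sub>R spike p j) = emb p (\<lambda>l. comb (V - {v0}) (\<lambda>v. c (l, v)))" for c
  proof -
    have "(\<Sum>j\<in>?I. c j *\<^sub>R spike p j) = (\<Sum>l\<in>{1..p}. \<Sum>v\<in>V - {v0}. c (l, v) *\<^sub>R incl l v)"
      by (subst sum.cartesian_product) (auto simp: spike_def intro!: sum.cong)
    then show ?thesis
      by (simp add: emb_def comb_def linear_sum[OF linear_incl] linear_scale[OF linear_incl])
  qed
  have ind: "independent (V - {v0})" by (rule independent_remove[OF v0])
  show 1: "independent_family ?I (spike p)"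
    unfolding independent_family_def
  proof (intro conjI allI impI ballI fI)
    fix c j assume 0: "(\<Sum>j\<in>?I. c j *\<^sub>R spike p j) = 0" and jI: "j \<in> ?I"
    obtain l v where j: "j = (l, v)" "l \<in> {1..p}" "v \<in> V - {v0}" using jI by (rule SigmaE)
    have "Poly_Mapping.lookup (emb p (\<lambda>l. comb (V - {v0}) (\<lambda>v. c (l, v)))) l = 0"
      using 0 by (simp add: sum)
    then have "(\<Sum>w\<in>V - {v0}. c (l, w) *\<^sub>R w) = 0" using j(2) by (simp add: comb_def)
    then have "c (l, v) = 0" using ind j(3) finite_vertices
      by (rule_tac independentD[where s="V - {v0}" and t="V - {v0}" and u="\<lambda>w. c (l, w)"]) auto
    then show "c j = 0" by (simp only: j(1))
  qed
  have "para (spike p ` ?I) = {z \<in> families p. \<forall>l\<in>{1..p}. Poly_Mapping.lookup z l \<in> para (V - {v0})}"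
    unfolding para_family[OF 1]
  proof (intro equalityI subsetI)
    fix z assume "z \<in> family_set ?I (spike p) (\<lambda>_. {0..<1})"
    then obtain c where c: "\<forall>j\<in>?I. c j \<in> {0..<1}" "z = emb p (\<lambda>l. comb (V - {v0}) (\<lambda>v. c (l, v)))"
      by (auto simp: family_set_def sum)
    have "comb (V - {v0}) (\<lambda>v. c (l, v)) \<in> para (V - {v0})" if "l \<in> {1..p}" for l
    proof -
      have "comb (V - {v0}) (restrict (\<lambda>v. c (l, v)) (V - {v0})) \<in> para (V - {v0})"
        unfolding para_def
      proof (rule imageI, unfold restrict_PiE_iff, rule ballI)
        fix v assume "v \<in> V - {v0}"
        then show "c (l, v) \<in> {0..<1}" using c(1) that by blast
      qed
      then show ?thesis by (simp only: comb_restrict)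
    qed
    then show "z \<in> {z \<in> families p. \<forall>l\<in>{1..p}. Poly_Mapping.lookup z l \<in> para (V - {v0})}" by (simp add: c(2))
  next
    fix z assume z: "z \<in> {z \<in> families p. \<forall>l\<in>{1..p}. Poly_Mapping.lookup z l \<in> para (V - {v0})}"
    have "\<exists>m. l \<in> {1..p} \<longrightarrow> (\<forall>v\<in>V - {v0}. m v \<in> {0..<1}) \<and> Poly_Mapping.lookup z l = comb (V - {v0}) m" for l
    proof (cases "l \<in> {1..p}")
      case True
      then have "Poly_Mapping.lookup z l \<in> para (V - {v0})" using z by blast
      then obtain m where "m \<in> Pi\<^sub>E (V - {v0}) (\<lambda>_. {0..<1})" "Poly_Mapping.lookup z l = comb (V - {v0}) m"
        unfolding para_def by blast
      then show ?thesis using PiE_mem by (intro exI[of _ m]) blast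
    next
      case False
      then show ?thesis by blast
    qed
    then obtain m where m: "\<And>l. l \<in> {1..p} \<longrightarrow> (\<forall>v\<in>V - {v0}. m l v \<in> {0..<1}) \<and> Poly_Mapping.lookup z l = comb (V - {v0}) (m l)"
      using choice[of "\<lambda>l m. l \<in> {1..p} \<longrightarrow> (\<forall>v\<in>V - {v0}. m v \<in> {0..<1}) \<and> Poly_Mapping.lookup z l = comb (V - {v0}) m"] by blast
    have "z = emb p (Poly_Mapping.lookup z)" using z by (simp add: emb_lookup)
    also have "\<dots> = emb p (\<lambda>l. comb (V - {v0}) (m l))" unfolding emb_def using m by (intro sum.cong) auto
    also have "\<dots> = (\<Sum>j\<in>?I. (\<lambda>j. m (fst j) (snd j)) j *\<^sub>R spike p j)" by (simp only: sum fst_conv snd_conv)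
    finally have "z = (\<Sum>j\<in>?I. (\<lambda>j. m (fst j) (snd j)) j *\<^sub>R spike p j)" .
    moreover have "\<forall>j\<in>?I. (\<lambda>j. m (fst j) (snd j)) j \<in> {0..<1}" using m by force
    ultimately show "z \<in> family_set ?I (spike p) (\<lambda>_. {0..<1})"
      unfolding family_set_def by (intro CollectI exI[of _ "\<lambda>j. m (fst j) (snd j)"] conjI)
  qed
  moreover have "para (V - {v0}) \<in> sets lborel"
    using finite_vertices ind by (intro lborel_inv.para_measurable) auto
  ultimately show "measure (volM p) (para (spike p ` ?I)) = measure lborel (para (V - {v0})) ^ p"
    by (simp add: measure_power_para)
qed

text \<open>The reference basis has integral coordinates with respect to \<open>\<sigma>\<close> by
  \<open>spike_integral\<close>, which is the situation of \<open>measure_para_le\<close>.\<close>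

lemma measure_para_spike_le:
  assumes \<sigma>: "\<sigma> \<subseteq> {..p} \<times> V" "independent_family \<sigma> (spike p)" "card \<sigma> = CARD('n) * p" and v0: "v0 \<in> V"
  shows "measure (volM p) (para (spike p ` \<sigma>)) \<le> measure lborel (para (V - {v0})) ^ p"
proof -
  let ?I = "{1..p} \<times> (V - {v0})"
  note fi = independent_family_image[OF \<sigma>(2)] and fI = independent_family_image[OF base_family(1)[OF v0]]
  have "?I \<subseteq> {..p} \<times> V" by auto
  note sub = spike_image_families[OF \<sigma>(1)] spike_image_families[OF this]
  have "measure (volM p) (para (spike p ` \<sigma>)) \<le> measure (volM p) (para (spike p ` ?I))"
  proof (rule volM.measure_para_le[OF fi(2,3) sub(1) fI(2,3)])
    show "span (spike p ` ?I) = families p"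
      by (rule spans_families[OF fI(2,3) sub(2)]) (simp add: card_image[OF fI(1)] base_family(2)[OF v0])
    fix b assume "b \<in> spike p ` ?I"
    then obtain e where e: "b = spike p e" "e \<in> ?I" by blast
    then have "e \<in> {..p} \<times> V" by auto
    then obtain k :: "nat \<times> (real ^ 'n) \<Rightarrow> int" where k: "spike p e = (\<Sum>j\<in>\<sigma>. of_int (k j) *\<^sub>R spike p j)"
      using spike_integral[OF \<sigma>] by blast
    obtain g where g: "\<And>j. j \<in> \<sigma> \<Longrightarrow> g (spike p j) = j" using family_cases[OF \<sigma>(2)] by metis
    have "b = comb (spike p ` \<sigma>) (\<lambda>w. of_int (k (g w)))"
      unfolding comb_family[OF \<sigma>(2)] e(1) k using g by simp
    then show "\<exists>k :: (nat \<Rightarrow>\<^sub>0 real ^ 'n) \<Rightarrow> int. b = comb (spike p ` \<sigma>) (\<lambda>v. of_int (k v))"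
      by (rule exI[of _ "\<lambda>w. k (g w)"])
  qed
  then show ?thesis by (simp add: base_family(3)[OF v0])
qed

text \<open>The simplices spanned by 0 and \<open>V - {v}\<close> lie in the hull of
  \<open>V\<close> and overlap in a null set, so their volumes add up to at most that of the hull.
  Picking the smallest one spares a comparison among them.\<close>

lemma small_para:
  obtains v0 where "v0 \<in> V"
    "real (CARD('n) + 1) * measure lborel (para (V - {v0})) \<le> fact CARD('n) * measure lborel (convex hull V)"
proof -
  let ?T = "\<lambda>v. family_simplex (V - {v}) (\<lambda>w. w)"
  define Z where "Z = (\<Union>u\<in>V. \<Union>v\<in>V - {u}. span (V - {u, v}))"
  have I: "independent_family (V - {v}) (\<lambda>w. w)" if "v \<in> V" for v
    using independent_remove[OF that] unfolding independent_family_def dependent_finite[OF finite_Diff[OF finite_vertices]]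
    using finite_vertices by blast
  have N: "Z \<in> null_sets lborel"
    unfolding Z_def
  proof (intro null_sets_UN' countable_finite)
    fix u v assume uv: "u \<in> V" "v \<in> V - {u}"
    have ind: "independent (V - {u, v})"
      using independent_remove[OF uv(1)] by (rule independent_mono) auto
    have "card (V - {u, v}) < CARD('n)"
    proof -
      have "card (V - {u, v}) = card V - card {u, v}" using uv finite_vertices by (intro card_Diff_subset) auto
      then show ?thesis using uv V(2) by auto
    qed
    then have "span (V - {u, v}) \<noteq> UNIV"
      using dim_span_eq_card_independent[OF ind] by (metis dim_UNIV DIM_cart DIM_real less_irrefl mult.right_neutral)
    then show "span (V - {u, v}) \<in> null_sets lborel"
      using finite_vertices ind by (intro lborel_inv.emeasure_span_null) auto
  qed (use finite_vertices in auto)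
  have Tm: "?T v \<in> sets lborel" "measure lborel (?T v) = measure lborel (para (V - {v})) / fact CARD('n)"
    "emeasure lborel (?T v) < \<infinity>" if "v \<in> V" for v
    using lborel_inv.family_simplex_measurable[OF I[OF that]] lborel_inv.measure_family_simplex[OF I[OF that]]
      lborel_inv.family_simplex_finite[OF I[OF that]] V(2) finite_vertices that by simp_all
  have disj: "?T u \<inter> ?T v \<subseteq> Z" if uv: "u \<in> V" "v \<in> V" "u \<noteq> v" for u v
  proof
    fix z assume "z \<in> ?T u \<inter> ?T v"
    then obtain c d where c: "\<forall>w\<in>V - {u}. 0 \<le> c w" "z = (\<Sum>w\<in>V - {u}. c w *\<^sub>R w)"
      and d: "\<forall>w\<in>V - {v}. 0 \<le> d w" "z = (\<Sum>w\<in>V - {v}. d w *\<^sub>R w)"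
      by (auto simp: family_simplex_def)
    let ?c = "c(u := 0)" and ?d = "d(v := 0)"
    have ext: "(\<Sum>w\<in>V. (a(x := 0)) w *\<^sub>R w) = (\<Sum>w\<in>V - {x}. a w *\<^sub>R w)" if "x \<in> V" for a x
      using finite_vertices that by (subst sum.remove[of V x]) (auto intro!: sum.cong)
    have "(\<Sum>w\<in>V. (?c w - ?d w) *\<^sub>R w) = 0"
      using ext[OF uv(1), of c] ext[OF uv(2), of d] c(2) d(2) by (simp add: scaleR_diff_left sum_subtractf)
    then have "\<exists>k. \<forall>w\<in>V. ?c w - ?d w = k" by (rule affine_relation_const)
    then obtain k where k: "\<And>w. w \<in> V \<Longrightarrow> ?c w - ?d w = k" by blast
    \<comment> \<open>The difference of the two representations has a constant coefficient, which is
      at most 0 at \<open>u\<close> and at least 0 at \<open>v\<close>; so it is 0 and the point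
      lies in the common face.\<close>
    have "0 - d u = k" "c v - 0 = k" using k[OF uv(1)] k[OF uv(2)] uv(3) by simp_all
    moreover have "0 \<le> d u" "0 \<le> c v" using c(1) d(1) uv by simp_all
    ultimately have cv: "c v = 0" by linarith
    have "z = (\<Sum>w\<in>V - {u, v}. c w *\<^sub>R w)"
    proof -
      have "z = c v *\<^sub>R v + (\<Sum>w\<in>V - {u} - {v}. c w *\<^sub>R w)"
        unfolding c(2) using finite_vertices uv by (intro sum.remove) auto
      also have "V - {u} - {v} = V - {u, v}" by blast
      finally show ?thesis using cv by simp
    qed
    also have "\<dots> \<in> span (V - {u, v})" by (intro span_sum span_scale span_base)
    finally have z: "z \<in> span (V - {u, v})" .
    have "v \<in> V - {u}" using uv by simp
    then show "z \<in> Z" unfolding Z_def using uv(1) z by (intro UN_I)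
  qed
  have sub: "?T v \<subseteq> convex hull V" if "v \<in> V" for v
  proof
    fix z assume "z \<in> ?T v"
    then obtain c where c: "\<forall>w\<in>V - {v}. 0 \<le> c w" "sum c (V - {v}) \<le> 1" "z = (\<Sum>w\<in>V - {v}. c w *\<^sub>R w)"
      by (auto simp: family_simplex_def)
    \<comment> \<open>The missing weight is spread evenly over \<open>V\<close>; this does not move
      the point because the vertices add up to 0.\<close>
    define q where "q = (1 - sum c (V - {v})) / card V"
    define u where "u = (\<lambda>w. (c(v := 0)) w + q)"
    have q: "0 \<le> q" using c(2) by (simp add: q_def)
    have "\<forall>w\<in>V. 0 \<le> u w" using c(1) q by (auto simp: u_def)
    moreover have "sum (c(v := 0)) V = sum c (V - {v})"
      using finite_vertices that by (subst sum.remove[of V v]) (auto intro!: sum.cong)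
    then have "sum u V = 1" using V(2) by (simp add: u_def sum.distrib q_def)
    moreover have "(\<Sum>w\<in>V. (c(v := 0)) w *\<^sub>R w) = z"
      unfolding c(3) using finite_vertices that by (subst sum.remove[of V v]) (auto intro!: sum.cong)
    then have "(\<Sum>w\<in>V. u w *\<^sub>R w) = z"
      using V(3) by (simp add: u_def scaleR_left_distrib sum.distrib flip: scaleR_sum_right)
    ultimately show "z \<in> convex hull V" unfolding convex_hull_finite[OF finite_vertices] by blast
  qed
  have "(\<Sum>v\<in>V. measure lborel (?T v)) = (\<Sum>v\<in>V. measure lborel (?T v - Z))"
    using Tm N by (intro sum.cong refl) (simp add: measure_Diff_null_set)
  also have "\<dots> = measure lborel (\<Union>v\<in>V. ?T v - Z)"
  proof (rule measure_finite_Union[symmetric])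
    show "disjoint_family_on (\<lambda>v. ?T v - Z) V" 
      unfolding disjoint_family_on_def
    proof (intro ballI impI)
      fix u v assume "u \<in> V" "v \<in> V" "u \<noteq> v"
      then show "(?T u - Z) \<inter> (?T v - Z) = {}" using disj[of u v] by blast
    qed
    show "(\<lambda>v. ?T v - Z) ` V \<subseteq> sets lborel" using Tm(1) N by (auto intro!: sets.Diff dest: null_setsD2)
    show "emeasure lborel (?T v - Z) \<noteq> \<infinity>" if "v \<in> V" for v
    proof -
      have "emeasure lborel (?T v - Z) \<le> emeasure lborel (?T v)" using Tm(1)[OF that] by (intro emeasure_mono) auto
      then show ?thesis using Tm(3)[OF that] by (auto simp: top_unique)
    qed
  qed (rule finite_vertices)
  also have "\<dots> \<le> measure lborel (convex hull V)"
  proof (rule measure_mono_fmeasurable)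
    show "(\<Union>v\<in>V. ?T v - Z) \<subseteq> convex hull V"
    proof (rule UN_least)
      fix v assume "v \<in> V"
      then show "?T v - Z \<subseteq> convex hull V" using sub[of v] by blast
    qed
    show "(\<Union>v\<in>V. ?T v - Z) \<in> sets lborel" using Tm(1) N finite_vertices by (intro sets.finite_UN sets.Diff) (auto dest: null_setsD2)
    show "convex hull V \<in> fmeasurable lborel"
      using finite_imp_compact_convex_hull[OF finite_vertices] emeasure_compact_finite by (intro fmeasurableI) (auto dest: compact_imp_closed)
  qed
  finally have "(\<Sum>v\<in>V. measure lborel (?T v)) \<le> measure lborel (convex hull V)" .
  then have sum: "(\<Sum>v\<in>V. measure lborel (para (V - {v}))) \<le> fact CARD('n) * measure lborel (convex hull V)"
    using Tm(2) by (simp add: field_simps flip: sum_divide_distrib)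
  have "V \<noteq> {}" using V(2) by auto
  then obtain v0 where v0: "v0 \<in> V" "\<And>v. v \<in> V \<Longrightarrow> measure lborel (para (V - {v0})) \<le> measure lborel (para (V - {v}))"
    using ex_is_arg_min_if_finite[OF finite_vertices, of "\<lambda>v. measure lborel (para (V - {v}))"] by (auto simp: is_arg_min_linorder)
  have "real (CARD('n) + 1) * measure lborel (para (V - {v0})) = (\<Sum>v\<in>V. measure lborel (para (V - {v0})))"
    using V(2) by simp
  also have "\<dots> \<le> (\<Sum>v\<in>V. measure lborel (para (V - {v})))" using v0(2) by (rule sum_mono)
  finally show thesis using that v0(1) sum by simp
qed

end

section \<open>The body of a simplex\<close>

lemma linear_spike: "linear (\<lambda>v. spike p (l, v))"
proof (cases "l = 0")
  case True
  then show ?thesis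
    using linear_compose_neg[OF linear_diag[of p]] by (simp add: spike_def)
next
  case False
  then show ?thesis using linear_incl[of l] by (simp add: spike_def)
qed

lemma R_body_eq: "R_body p t L = convex hull (\<Union>l\<in>{..p}. (\<lambda>v. t l *\<^sub>R spike p (l, v)) ` L)"
proof -
  have "{..p} = insert 0 {1..p}" by auto
  then have "(\<Union>l\<in>{..p}. (\<lambda>v. t l *\<^sub>R spike p (l, v)) ` L) =
      (\<lambda>v. t 0 *\<^sub>R spike p (0, v)) ` L \<union> (\<Union>l\<in>{1..p}. (\<lambda>v. t l *\<^sub>R spike p (l, v)) ` L)" by simp
  also have "(\<lambda>v. t 0 *\<^sub>R spike p (0, v)) ` L = (\<lambda>v. - (t 0 *\<^sub>R diag p v)) ` L"
    by (simp add: spike_def)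
  also have "(\<Union>l\<in>{1..p}. (\<lambda>v. t l *\<^sub>R spike p (l, v)) ` L) = (\<Union>l\<in>{1..p}. (\<lambda>v. t l *\<^sub>R incl l v) ` L)"
    by (intro SUP_cong refl) (auto simp: spike_def)
  finally show ?thesis by (simp only: R_body_def)
qed

lemma convex_conic_combination: "convex A \<Longrightarrow> x \<in> A \<Longrightarrow> y \<in> A \<Longrightarrow> 0 \<le> a \<Longrightarrow> 0 \<le> b \<Longrightarrow>
  \<exists>w\<in>A. a *\<^sub>R x + b *\<^sub>R y = (a + b) *\<^sub>R w" for A :: "'v::real_vector set"
proof (cases "a + b = 0")
  case True
  assume "x \<in> A" "0 \<le> a" "0 \<le> b"
  then show ?thesis using True by (intro bexI[of _ x]) (auto simp: add_nonneg_eq_0_iff)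
next
  case False
  assume A: "convex A" "x \<in> A" "y \<in> A" "0 \<le> a" "0 \<le> b"
  have "(a / (a + b)) *\<^sub>R x + (b / (a + b)) *\<^sub>R y \<in> A"
    using A False by (intro convexD) (auto simp: add_divide_distrib[symmetric])
  moreover have "a *\<^sub>R x + b *\<^sub>R y = (a + b) *\<^sub>R ((a / (a + b)) *\<^sub>R x + (b / (a + b)) *\<^sub>R y)"
    using False by (simp add: scaleR_add_right)
  ultimately show ?thesis by blast
qed

text \<open>The ambient space has infinite dimension, where hulls of compact sets need not be
  compact. For two nonempty compact convex sets, however, the hull consists of the segments between
  them.\<close>

lemma compact_hull_Un:
  fixes A B :: "'v::real_normed_vector set"
  assumes A: "compact A" "convex A" and B: "compact B" "convex B"
  shows "compact (convex hull (A \<union> B))"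
proof (cases "A = {} \<or> B = {}")
  case True
  then show ?thesis using A B by (auto simp: hull_same)
next
  case False
  define C where "C = {(1 - u) *\<^sub>R x + u *\<^sub>R y | x y u. 0 \<le> u \<and> u \<le> 1 \<and> x \<in> A \<and> y \<in> B}"
  have "convex C"
  proof (rule convexI)
    fix z z' and a b :: real assume "z \<in> C" "z' \<in> C" and ab: "0 \<le> a" "0 \<le> b" "a + b = 1"
    then obtain x y u x' y' u' where z: "z = (1 - u) *\<^sub>R x + u *\<^sub>R y" "0 \<le> u" "u \<le> 1" "x \<in> A" "y \<in> B"
      and z': "z' = (1 - u') *\<^sub>R x' + u' *\<^sub>R y'" "0 \<le> u'" "u' \<le> 1" "x' \<in> A" "y' \<in> B"
      unfolding C_def by blast
    define w where "w = a * u + b * u'"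
    obtain x'' where x'': "x'' \<in> A" "(a * (1 - u)) *\<^sub>R x + (b * (1 - u')) *\<^sub>R x' = (a * (1 - u) + b * (1 - u')) *\<^sub>R x''"
      using convex_conic_combination[OF A(2) z(4) z'(4), of "a * (1 - u)" "b * (1 - u')"] ab z(3) z'(3) by auto
    obtain y'' where y'': "y'' \<in> B" "(a * u) *\<^sub>R y + (b * u') *\<^sub>R y' = w *\<^sub>R y''"
      using convex_conic_combination[OF B(2) z(5) z'(5), of "a * u" "b * u'"] ab z(2) z'(2) by (auto simp: w_def)
    have w1: "a * (1 - u) + b * (1 - u') = 1 - w" using ab(3) by (simp add: w_def algebra_simps)
    have "a *\<^sub>R z + b *\<^sub>R z' = ((a * (1 - u)) *\<^sub>R x + (b * (1 - u')) *\<^sub>R x') + ((a * u) *\<^sub>R y + (b * u') *\<^sub>R y')"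
      by (simp add: z(1) z'(1) scaleR_add_right add_ac)
    also have "\<dots> = (1 - w) *\<^sub>R x'' + w *\<^sub>R y''" by (simp only: x''(2) y''(2) w1)
    finally have "a *\<^sub>R z + b *\<^sub>R z' = (1 - w) *\<^sub>R x'' + w *\<^sub>R y''" .
    moreover have "0 \<le> w" using ab z(2) z'(2) by (simp add: w_def)
    moreover have "0 \<le> 1 - w" unfolding w1[symmetric] using ab z(3) z'(3) by simp
    ultimately show "a *\<^sub>R z + b *\<^sub>R z' \<in> C" unfolding C_def using x''(1) y''(1) by auto
  qed
  moreover have "A \<union> B \<subseteq> C"
  proof
    fix z assume z: "z \<in> A \<union> B"
    obtain a b where ab: "a \<in> A" "b \<in> B" using False by blast
    show "z \<in> C"
    proof (cases "z \<in> A")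
      case True
      then have "z = (1 - 0) *\<^sub>R z + 0 *\<^sub>R b \<and> 0 \<le> (0::real) \<and> (0::real) \<le> 1 \<and> z \<in> A \<and> b \<in> B" using ab by simp
      then show ?thesis unfolding C_def by blast
    next
      case False
      then have "z = (1 - 1) *\<^sub>R a + 1 *\<^sub>R z \<and> 0 \<le> (1::real) \<and> (1::real) \<le> 1 \<and> a \<in> A \<and> z \<in> B" using ab z by simp
      then show ?thesis unfolding C_def by blast
    qed
  qed
  ultimately have "convex hull (A \<union> B) \<subseteq> C" by (intro hull_minimal)
  moreover have "C \<subseteq> convex hull (A \<union> B)"
  proof
    fix z assume "z \<in> C"
    then obtain x y u where z: "z = (1 - u) *\<^sub>R x + u *\<^sub>R y" "0 \<le> u" "u \<le> 1" "x \<in> A" "y \<in> B"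
      unfolding C_def by blast
    show "z \<in> convex hull (A \<union> B)" unfolding z(1)
      using z by (intro convexD[OF convex_convex_hull]) (auto intro: hull_inc)
  qed
  ultimately have "convex hull (A \<union> B) = C" by blast
  then show ?thesis using compact_convex_combinations[OF A(1) B(1)] by (simp add: C_def)
qed

lemma compact_hull_UN:
  fixes A :: "'i \<Rightarrow> 'v::real_normed_vector set"
  assumes "finite I" "\<And>i. i \<in> I \<Longrightarrow> compact (A i)" "\<And>i. i \<in> I \<Longrightarrow> convex (A i)"
  shows "compact (convex hull (\<Union>i\<in>I. A i))"
  using assms
proof (induction I rule: finite_induct)
  case (insert i I)
  let ?U = "\<Union>i\<in>I. A i"
  have "convex hull (A i \<union> ?U) = convex hull (A i \<union> convex hull ?U)"
  proof (intro equalityI hull_minimal)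
    show "A i \<union> ?U \<subseteq> convex hull (A i \<union> convex hull ?U)"
      using hull_subset[of "A i \<union> convex hull ?U" convex] hull_subset[of ?U convex] by blast
    have "convex hull ?U \<subseteq> convex hull (A i \<union> ?U)" by (rule hull_mono) blast
    then show "A i \<union> convex hull ?U \<subseteq> convex hull (A i \<union> ?U)"
      using hull_subset[of "A i \<union> ?U" convex] by blast
  qed (rule convex_convex_hull)+
  moreover have "compact (convex hull (A i \<union> convex hull ?U))"
    using insert by (intro compact_hull_Un convex_convex_hull) auto
  ultimately show ?case by simp
qed simp

lemma continuous_spike: "continuous_on A (\<lambda>v. spike p (l, v))"
proof (cases "l = 0")
  case True
  have "continuous_on A (\<lambda>v. - (\<Sum>i=1..p. incl i v))"
    by (intro continuous_on_minus continuous_on_sum bounded_linear.continuous_on[OF bounded_linear_incl] continuous_on_id)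
  then show ?thesis using True by (simp add: spike_def diag_def)
next
  case False
  have "continuous_on A (\<lambda>v. incl l v)"
    by (intro bounded_linear.continuous_on[OF bounded_linear_incl] continuous_on_id)
  then show ?thesis using False by (simp add: spike_def)
qed

lemma R_body_compact: "compact L \<Longrightarrow> convex L \<Longrightarrow> compact (R_body p t L)"
  unfolding R_body_eq
  by (intro compact_hull_UN compact_continuous_image continuous_on_scaleR continuous_on_const continuous_spike
      convex_linear_image linear_compose_scale_right linear_spike finite_atMost)

lemma R_body_families: "R_body p t (L :: (real ^ 'n) set) \<subseteq> families p"
  unfolding R_body_eq
proof (rule hull_minimal)
  show "(\<Union>l\<in>{..p}. (\<lambda>v. t l *\<^sub>R spike p (l, v)) ` L) \<subseteq> families p"
  proof (intro UN_least image_subsetI)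
    fix l and v :: "real ^ 'n" assume "l \<in> {..p}"
    then show "t l *\<^sub>R spike p (l, v) \<in> families p"
      by (intro subspace_scale[OF subspace_families] spike_in_families) simp
  qed
qed (rule subspace_imp_convex[OF subspace_families])

text \<open>Gives both the number of bodies in the mixed volume and the number of vertices other
  than 0 of a covering simplex.\<close>

lemma sum_codegrees:
  assumes "(\<Sum>l\<le>p. j l) = n" shows "(\<Sum>l\<le>p. n - j l) = n * (p :: nat)"
proof -
  have "j l \<le> n" if "l \<le> p" for l using member_le_sum[of l "{..p}" j] that assms by simp
  then have "(\<Sum>l\<le>p. n - j l) + (\<Sum>l\<le>p. j l) = (\<Sum>l\<le>p. n)"
    unfolding sum.distrib[symmetric] by (intro sum.cong) auto
  then show ?thesis using assms by simp
qed

text \<open>Total weight at most 1, rather than equal to 1, because the weight is going to be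
  minimised.\<close>

lemma hull_weights:
  fixes x :: "'j \<Rightarrow> 'v::real_vector"
  assumes J: "finite J"
  shows "convex hull (x ` J) \<subseteq> {wsum x J m | m. m \<in> weights J \<and> sum m J \<le> 1}"
proof (rule hull_minimal)
  show "x ` J \<subseteq> {wsum x J m | m. m \<in> weights J \<and> sum m J \<le> 1}"
  proof (rule image_subsetI)
    fix j assume j: "j \<in> J"
    let ?m = "\<lambda>i. if i = j then 1 else 0 :: real"
    have "wsum x J ?m = x j" using J j by (simp add: wsum_def if_distrib[of "\<lambda>r. r *\<^sub>R _"] cong: if_cong)
    moreover have "?m \<in> weights J" using j by (auto simp: weights_def)
    moreover have "sum ?m J \<le> 1" using J j by simp
    ultimately show "x j \<in> {wsum x J m | m. m \<in> weights J \<and> sum m J \<le> 1}"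
      by (intro CollectI exI[of _ ?m]) simp
  qed
  show "convex {wsum x J m | m. m \<in> weights J \<and> sum m J \<le> 1}"
  proof (rule convexI)
    fix y z and a b :: real
    assume "y \<in> {wsum x J m | m. m \<in> weights J \<and> sum m J \<le> 1}" "z \<in> {wsum x J m | m. m \<in> weights J \<and> sum m J \<le> 1}"
      and ab: "0 \<le> a" "0 \<le> b" "a + b = 1"
    then obtain m n where m: "y = wsum x J m" "m \<in> weights J" "sum m J \<le> 1"
      and n: "z = wsum x J n" "n \<in> weights J" "sum n J \<le> 1" by blast
    let ?k = "\<lambda>j. a * m j + b * n j"
    have "wsum x J ?k = a *\<^sub>R y + b *\<^sub>R z"
      by (simp add: wsum_def m(1) n(1) scaleR_add_left sum.distrib scaleR_sum_right)
    moreover have "?k \<in> weights J" using m(2) n(2) ab by (simp add: weights_def)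
    moreover have "sum ?k J \<le> 1"
    proof -
      have "sum ?k J = a * sum m J + b * sum n J" by (simp add: sum.distrib sum_distrib_left)
      also have "\<dots> \<le> 1" using m(3) n(3) ab by (intro convex_bound_le)
      finally show ?thesis .
    qed
    ultimately show "a *\<^sub>R y + b *\<^sub>R z \<in> {wsum x J m | m. m \<in> weights J \<and> sum m J \<le> 1}"
      by (intro CollectI exI[of _ ?k]) simp
  qed
qed

section \<open>A cover of the body of a simplex by small simplices\<close>

context
  fixes V :: "(real ^ 'n) set" and p :: nat and j :: "nat \<Rightarrow> nat" and t :: "nat \<Rightarrow> real" and c :: real
  assumes V: "\<not> affine_dependent V" "card V = CARD('n) + 1" "\<Sum>V = 0"
    and j: "(\<Sum>l\<le>p. j l) = CARD('n)"
    and c: "0 < c" and t: "\<And>l. t l = c / (real (j l) + 1 / real (p + 1))"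
begin

lemma finite_V: "finite V" using finite_vertices[OF V] .

lemma t_pos: "0 < t l"
  unfolding t using c by (intro divide_pos_pos add_nonneg_pos) auto

lemma inverse_t: "1 / t l = (real (j l) + 1 / real (p + 1)) / c"
  by (simp add: t)

text \<open>The \<open>p + 1\<close> shares \<open>1 / (p + 1)\<close> raise the sum of the
  \<open>j l\<close> from \<open>n\<close> to the number \<open>n + 1\<close> of vertices.\<close>

lemma sum_inverse_t: "(\<Sum>l\<le>p. 1 / t l) = real (CARD('n) + 1) / c"
proof -
  have "(\<Sum>l\<le>p. real (j l) + 1 / real (p + 1)) = real (\<Sum>l\<le>p. j l) + 1"
    by (simp add: sum.distrib)
  then show ?thesis by (simp add: inverse_t j flip: sum_divide_distrib)
qed

abbreviation vert :: "nat \<times> (real ^ 'n) \<Rightarrow> (nat \<Rightarrow>\<^sub>0 real ^ 'n)" where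
  "vert i \<equiv> t (fst i) *\<^sub>R spike p i"

abbreviation J :: "(nat \<times> (real ^ 'n)) set" where "J \<equiv> {..p} \<times> V"

text \<open>\<open>B l\<close> will be the set of zeros of row \<open>l\<close> of a weight, so this
  is the support of the weight.\<close>

definition cosupport :: "(nat \<Rightarrow> (real ^ 'n) set) \<Rightarrow> (nat \<times> (real ^ 'n)) set" where
  "cosupport B = {i \<in> J. snd i \<notin> B (fst i)}"

text \<open>
  If row \<open>l\<close> of the weight matrix had at most \<open>j l\<close> zeros, then raising all other rows and lowering the
  columns in which row \<open>l\<close> is positive would decrease the total weight.
\<close>

lemma optimal_zeros:
  assumes l: "l \<le> p" and m: "m \<in> weights J" and opt: "\<And>m'. m' \<in> weights J \<Longrightarrow> wsum vert J m' = wsum vert J m \<Longrightarrow> sum m J \<le> sum m' J"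
  shows "j l < card {v \<in> V. m (l, v) = 0}"
proof (rule ccontr)
  let ?Z = "{v \<in> V. m (l, v) = 0}"
  assume "\<not> j l < card ?Z"
  then have le: "card ?Z \<le> j l" by simp
  \<comment> \<open>The direction \<open>h\<close> built from these labels raises each row
    \<open>k\<close> other than \<open>l\<close> by \<open>1 / t k\<close> on \<open>?Z\<close>,
    lowers row \<open>l\<close> by \<open>1 / t l\<close> off \<open>?Z\<close>, and changes nothing
    else.\<close>
  define \<beta> where "\<beta> k = (if k = l then 0 else 1 :: real)" for k
  define \<alpha> where "\<alpha> v = (if v \<in> ?Z then 0 else 1 :: real)" for v
  define h where "h i = (if i \<in> J then (\<beta> (fst i) - \<alpha> (snd i)) / t (fst i) else 0)" for i
  have fJ: "finite J" using finite_V by simp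
  have "wsum vert J h = (\<Sum>i\<in>J. (\<beta> (fst i) - \<alpha> (snd i)) *\<^sub>R spike p i)"
    unfolding wsum_def h_def using t_pos by (intro sum.cong refl) (simp add: less_imp_neq[symmetric])
  then have h0: "wsum vert J h = 0" by (simp add: spike_relation_intro[OF V])
  have hneg: "m i \<noteq> 0" if "h i < 0" for i
  proof
    assume "m i = 0"
    obtain k v where i: "i = (k, v)" by (cases i)
    have kv: "k \<le> p" "v \<in> V" "\<beta> k - \<alpha> v < 0"
      using that t_pos[of k] by (auto simp: h_def i divide_less_0_iff split: if_splits)
    then have "k = l" "v \<notin> ?Z" by (auto simp: \<alpha>_def \<beta>_def split: if_splits)
    then show False using \<open>m i = 0\<close> kv(2) by (simp add: i)
  qed
  have "\<exists>e>0. (\<lambda>i. m i + e * h i) \<in> weights J"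
    by (rule weights_perturb[OF fJ m]) (use hneg in \<open>auto simp: h_def\<close>)
  then obtain e where e: "0 < e" "(\<lambda>i. m i + e * h i) \<in> weights J" by blast
  have "wsum vert J (\<lambda>i. m i + e * h i) = wsum vert J m"
    using wsum_perturb[of vert J m e h "\<lambda>_. 0"] h0 by (simp add: wsum_def)
  then have "sum m J \<le> sum (\<lambda>i. m i + e * h i) J" by (rule opt[OF e(2)])
  also have "\<dots> = sum m J + e * sum h J" by (simp add: sum.distrib sum_distrib_left)
  finally have "0 \<le> sum h J" using e(1) by (simp add: zero_le_mult_iff)
  define d where "d = real (card ?Z)"
  have s\<alpha>: "(\<Sum>v\<in>V. \<alpha> v) = real (CARD('n) + 1) - d"
  proof -
    have "(\<Sum>v\<in>V. \<alpha> v) = (\<Sum>v\<in>V - ?Z. 1)"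
      using finite_V by (intro sum.mono_neutral_cong_right) (auto simp: \<alpha>_def)
    also have "\<dots> = real (card V - card ?Z)" using finite_V by (simp add: card_Diff_subset)
    also have "\<dots> = real (CARD('n) + 1) - d"
      using card_mono[OF finite_V, of ?Z] V(2) by (simp add: d_def of_nat_diff)
    finally show ?thesis .
  qed
  have "sum h J = (\<Sum>k\<in>{..p}. \<Sum>v\<in>V. (\<beta> k - \<alpha> v) / t k)"
    unfolding h_def by (subst sum.cartesian_product) (auto intro!: sum.cong)
  also have "\<dots> = (\<Sum>k\<in>{..p}. (real (CARD('n) + 1) * \<beta> k - (real (CARD('n) + 1) - d)) * (1 / t k))"
    using V(2) by (simp add: sum_subtractf s\<alpha> flip: sum_divide_distrib)
  also have "\<dots> = (\<Sum>k\<in>{..p}. d * (1 / t k) - (if k = l then real (CARD('n) + 1) * (1 / t l) else 0))"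
    by (intro sum.cong refl) (auto simp: \<beta>_def algebra_simps)
  also have "\<dots> = d * (\<Sum>k\<le>p. 1 / t k) - real (CARD('n) + 1) * (1 / t l)"
    using l by (simp add: sum_subtractf sum_distrib_left)
  also have "\<dots> = real (CARD('n) + 1) / c * (d - real (j l) - 1 / real (p + 1))"
  proof -
    have "d * (\<Sum>k\<le>p. 1 / t k) = d * (real (CARD('n) + 1) / c)" by (simp only: sum_inverse_t)
    moreover have "1 / t l = (real (j l) + 1 / real (p + 1)) / c" by (rule inverse_t)
    ultimately have "d * (\<Sum>k\<le>p. 1 / t k) - real (CARD('n) + 1) * (1 / t l) =
        d * (real (CARD('n) + 1) / c) - real (CARD('n) + 1) * ((real (j l) + 1 / real (p + 1)) / c)" by simp
    also have "\<dots> = real (CARD('n) + 1) / c * (d - (real (j l) + 1 / real (p + 1)))"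
      by (simp only: right_diff_distrib times_divide_eq_left times_divide_eq_right mult.commute)
    finally show ?thesis by (simp only: diff_diff_eq)
  qed
  \<comment> \<open>For \<open>d\<close> at most \<open>j l\<close> the share
    \<open>1 / (p + 1)\<close> makes this strict.\<close>
  also have "\<dots> < 0"
  proof -
    have "d - real (j l) - 1 / real (p + 1) < 0" using le by (simp add: d_def add_pos_nonneg le_less_trans[of _ 0])
    then show ?thesis using c by (intro mult_pos_neg) auto
  qed
  finally show False using \<open>0 \<le> sum h J\<close> by simp
qed

text \<open>Receives the points whose optimal weight has fewer than \<open>np\<close> nonzero
  entries; a finite union of proper subspaces.\<close>

definition low_dim_part :: "(nat \<Rightarrow>\<^sub>0 real ^ 'n) set" where
  "low_dim_part = (\<Union>\<sigma>\<in>{\<sigma> \<in> Pow J. independent_family \<sigma> vert \<and> card \<sigma> < CARD('n) * p}. span (vert ` \<sigma>))"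

text \<open>Independence is carried along as a condition; an upper bound for the number follows from
  \<open>linked_families\<close> alone.\<close>

definition simplices :: "(nat \<Rightarrow> (real ^ 'n) set) set" where
  "simplices = {B \<in> linked_families (Suc p) V j. independent_family (cosupport B) vert}"

lemma vert_families: "\<sigma> \<subseteq> J \<Longrightarrow> vert ` \<sigma> \<subseteq> families p"
proof (rule image_subsetI)
  fix i assume "\<sigma> \<subseteq> J" "i \<in> \<sigma>"
  then have "spike p (fst i, snd i) \<in> families p" by (intro spike_in_families) auto
  then show "vert i \<in> families p" by (simp only: prod.collapse) (rule subspace_scale[OF subspace_families])
qed

lemma low_dim_part_null: "low_dim_part \<in> null_sets (volM p)"
  unfolding low_dim_part_def
proof (intro null_sets_UN' countable_finite)
  fix \<sigma> assume \<sigma>: "\<sigma> \<in> {\<sigma> \<in> Pow J. independent_family \<sigma> vert \<and> card \<sigma> < CARD('n) * p}"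
  then have ind: "independent_family \<sigma> vert" by blast
  note fi = independent_family_image[OF ind]
  have "card (vert ` \<sigma>) < CARD('n) * p" using \<sigma> by (simp add: card_image[OF fi(1)])
  then have "span (vert ` \<sigma>) \<noteq> families p" by (rule span_neq_families[OF fi(2)])
  then show "span (vert ` \<sigma>) \<in> null_sets (volM p)"
    using fi \<sigma> vert_families by (intro volM.emeasure_span_null) auto
qed (use finite_V in auto)

lemma R_body_cover: "R_body p t (convex hull V) \<subseteq> low_dim_part \<union> (\<Union>B\<in>simplices. family_simplex (cosupport B) vert)"
proof
  fix z assume z: "z \<in> R_body p t (convex hull V)"
  have fJ: "finite J" using finite_V by simp
  have "R_body p t (convex hull V) \<subseteq> convex hull (vert ` J)"
    unfolding R_body_eq
  proof (intro hull_minimal UN_least convex_convex_hull)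
    fix l assume "l \<in> {..p}"
    have "(\<lambda>v. t l *\<^sub>R spike p (l, v)) ` (convex hull V) = convex hull ((\<lambda>v. t l *\<^sub>R spike p (l, v)) ` V)"
      by (rule convex_hull_linear_image) (intro linear_compose_scale_right linear_spike)
    also have "\<dots> \<subseteq> convex hull (vert ` J)"
      using \<open>l \<in> {..p}\<close> by (intro hull_mono) force
    finally show "(\<lambda>v. t l *\<^sub>R spike p (l, v)) ` (convex hull V) \<subseteq> convex hull (vert ` J)" .
  qed
  then have "\<exists>m\<in>weights J. wsum vert J m = z \<and> sum m J \<le> 1"
  proof -
    assume "R_body p t (convex hull V) \<subseteq> convex hull (vert ` J)"
    then have "z \<in> {wsum vert J m | m. m \<in> weights J \<and> sum m J \<le> 1}"
      using z by (intro subsetD[OF hull_weights[OF fJ, of vert]]) (rule subsetD)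
    then obtain m where "z = wsum vert J m" "m \<in> weights J" "sum m J \<le> 1" by (elim CollectE exE conjE)
    then show ?thesis by (intro bexI[of _ m] conjI) (rule sym)
  qed
  then obtain m where m: "m \<in> weights J" "wsum vert J m = z" "sum m J \<le> 1"
    and opt: "\<And>m'. m' \<in> weights J \<Longrightarrow> wsum vert J m' = z \<Longrightarrow> sum m J \<le> sum m' J"
    and ind: "\<And>d. (\<And>i. m i = 0 \<Longrightarrow> d i = 0) \<Longrightarrow> wsum vert J d = 0 \<Longrightarrow> d = (\<lambda>_. 0)"
  proof (rule optimal_representation[OF fJ], goal_cases)
    case (1 m)
    show ?case by (rule 1(1)) (fact 1)+
  qed
  define \<sigma> where "\<sigma> = {i \<in> J. m i \<noteq> 0}"
  have \<sigma>J: "\<sigma> \<subseteq> J" by (auto simp: \<sigma>_def)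
  have sum_\<sigma>: "wsum vert J d = (\<Sum>i\<in>\<sigma>. d i *\<^sub>R vert i)" if "\<And>i. m i = 0 \<Longrightarrow> d i = 0" for d
    unfolding wsum_def using fJ that by (intro sum.mono_neutral_right) (auto simp: \<sigma>_def)
  have indf: "independent_family \<sigma> vert"
    unfolding independent_family_def
  proof (intro conjI allI impI ballI)
    show "finite \<sigma>" using fJ \<sigma>J by (rule rev_finite_subset)
    fix d i assume d: "(\<Sum>i\<in>\<sigma>. d i *\<^sub>R vert i) = 0" and i: "i \<in> \<sigma>"
    define d' where "d' = (\<lambda>i. if i \<in> \<sigma> then d i else 0)"
    have d'0: "d' i = 0" if "m i = 0" for i using that by (simp add: d'_def \<sigma>_def)
    have "wsum vert J d' = 0"
      using sum_\<sigma>[of d', OF d'0] d by (simp add: d'_def)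
    then have "d' = (\<lambda>_. 0)" using ind[of d'] d'0 by blast
    then show "d i = 0" using i by (metis d'_def)
  qed
  have zs: "z = (\<Sum>i\<in>\<sigma>. m i *\<^sub>R vert i)" using sum_\<sigma>[of m] m(2) by simp
  define Z where "Z l = {v \<in> V. m (l, v) = 0}" for l
  have jZ: "j l < card (Z l)" if "l \<le> p" for l
    unfolding Z_def using that m(1) opt unfolding m(2)[symmetric] by (rule optimal_zeros)
  have card\<sigma>: "card \<sigma> = (\<Sum>l\<le>p. CARD('n) + 1 - card (Z l))"
  proof -
    have "\<sigma> = (SIGMA l:{..p}. V - Z l)" by (auto simp: \<sigma>_def Z_def)
    then have "card \<sigma> = (\<Sum>l\<in>{..p}. card (V - Z l))" using finite_V by simp
    also have "\<dots> = (\<Sum>l\<le>p. CARD('n) + 1 - card (Z l))"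
      using finite_V V(2) by (intro sum.cong refl) (auto simp: card_Diff_subset Z_def)
    finally show ?thesis .
  qed
  have total: "(\<Sum>l\<le>p. CARD('n) - j l) = CARD('n) * p" by (rule sum_codegrees[OF j])
  show "z \<in> low_dim_part \<union> (\<Union>B\<in>simplices. family_simplex (cosupport B) vert)"
  proof (cases "card \<sigma> < CARD('n) * p")
    case True
    have "z \<in> span (vert ` \<sigma>)" unfolding zs by (intro span_sum span_scale span_base) auto
    then have "z \<in> low_dim_part" unfolding low_dim_part_def using True indf \<sigma>J by blast
    then show ?thesis by blast
  next
    case False
    have ZV: "Z l \<subseteq> V" for l by (auto simp: Z_def)
    \<comment> \<open>Row \<open>l\<close> has at most \<open>n - j l\<close> positive weights, and
      these numbers add up to \<open>np\<close>; a surplus zero would leave fewer than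
      \<open>np\<close> in total.\<close>
    have cZ: "card (Z l) = Suc (j l)" if l: "l \<le> p" for l
    proof (rule ccontr)
      assume "card (Z l) \<noteq> Suc (j l)"
      then have "Suc (j l) < card (Z l)" using jZ[OF l] by simp
      moreover have "card (Z l) \<le> CARD('n) + 1" using card_mono[OF finite_V ZV] V(2) by simp
      ultimately have "CARD('n) + 1 - card (Z l) < CARD('n) - j l" by simp
      moreover have "CARD('n) + 1 - card (Z k) \<le> CARD('n) - j k" if "k \<le> p" for k using jZ[OF that] by simp
      ultimately have "card \<sigma> < (\<Sum>l\<le>p. CARD('n) - j l)"
        unfolding card\<sigma> using l by (intro sum_strict_mono_ex1) auto
      then show False using False total by simp
    qed
    define B where "B = (\<lambda>l\<in>{..<Suc p}. Z l)"
    \<comment> \<open>A label constant on every \<open>Z l\<close> yields a relation of the form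
      \<open>\<beta> l - \<alpha> v\<close> that vanishes wherever the weight does. Independence of
      the support makes it 0 throughout, and row 0 then shows that the label is constant.\<close>
    have "linked (Suc p) Z V"
      unfolding linked_def
    proof (intro allI impI ballI)
      fix \<alpha> :: "real ^ 'n \<Rightarrow> real" and u v
      assume \<alpha>: "\<forall>l<Suc p. \<forall>u\<in>Z l. \<forall>v\<in>Z l. \<alpha> u = \<alpha> v" and uv: "u \<in> V" "v \<in> V"
      have "Z l \<noteq> {}" if "l \<le> p" for l using cZ[OF that] by auto
      then have "\<exists>b. \<forall>v\<in>Z l. \<alpha> v = b" if "l \<le> p" for l
        using \<alpha> that by (metis le_imp_less_Suc)
      then obtain \<beta> where \<beta>: "\<And>l v. l \<le> p \<Longrightarrow> v \<in> Z l \<Longrightarrow> \<alpha> v = \<beta> l" by metis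
      define d where "d i = (if i \<in> J then (\<beta> (fst i) - \<alpha> (snd i)) / t (fst i) else 0)" for i
      have "wsum vert J d = (\<Sum>i\<in>J. (\<beta> (fst i) - \<alpha> (snd i)) *\<^sub>R spike p i)"
        unfolding wsum_def d_def using t_pos by (intro sum.cong refl) (simp add: less_imp_neq[symmetric])
      then have "wsum vert J d = 0" by (simp add: spike_relation_intro[OF V])
      moreover have "d i = 0" if "m i = 0" for i
        using \<beta>[of "fst i" "snd i"] that by (auto simp: d_def Z_def)
      ultimately have d0: "d = (\<lambda>_. 0)" using ind by blast
      have "\<beta> 0 = \<alpha> w" if "w \<in> V" for w
        using fun_cong[OF d0, of "(0, w)"] that t_pos[of 0] by (simp add: d_def less_imp_neq[symmetric])
      then show "\<alpha> u = \<alpha> v" using uv by metis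
    qed
    then have "linked (Suc p) B V" by (rule linked_cong[rotated]) (simp add: B_def)
    moreover have "B \<in> Pi\<^sub>E {..<Suc p} (\<lambda>l. {X. X \<subseteq> V \<and> card X = Suc (j l)})"
      unfolding B_def restrict_PiE_iff using ZV cZ by auto
    ultimately have "B \<in> linked_families (Suc p) V j" by (simp add: linked_families_def)
    moreover have co: "cosupport B = \<sigma>"
      by (auto simp: cosupport_def \<sigma>_def B_def Z_def)
    ultimately have "B \<in> simplices" using indf by (simp add: simplices_def)
    moreover have "z \<in> family_simplex (cosupport B) vert"
    proof -
      have "sum m \<sigma> = sum m J" using fJ by (intro sum.mono_neutral_left) (auto simp: \<sigma>_def)
      moreover have "\<forall>i\<in>\<sigma>. 0 \<le> m i" using m(1) by (auto simp: weights_def)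
      ultimately show ?thesis unfolding co family_simplex_def using zs m(3) by (intro CollectI exI[of _ m]) simp
    qed
    ultimately show ?thesis by blast
  qed
qed

text \<open>The factor \<open>t l\<close> occurs once for each of the \<open>n - j l\<close>
  vertices outside \<open>B l\<close>; the unscaled parallelotope is bounded by the reference
  one.\<close>

lemma measure_cosupport_simplex:
  assumes B: "B \<in> simplices" and v0: "v0 \<in> V"
  shows "family_simplex (cosupport B) vert \<in> sets (volM p)"
    and "measure (volM p) (family_simplex (cosupport B) vert) \<le>
      (\<Prod>l\<le>p. t l ^ (CARD('n) - j l)) * measure lborel (para (V - {v0})) ^ p / fact (CARD('n) * p)"
proof -
  let ?\<sigma> = "cosupport B"
  have ind: "independent_family ?\<sigma> vert" and lf: "B \<in> linked_families (Suc p) V j"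
    using B by (auto simp: simplices_def)
  have BV: "B l \<subseteq> V" "card (B l) = Suc (j l)" if "l \<le> p" for l
    using lf that by (auto simp: linked_families_def PiE_iff)
  have \<sigma>: "?\<sigma> = (SIGMA l:{..p}. V - B l)" by (auto simp: cosupport_def)
  have \<sigma>J: "?\<sigma> \<subseteq> J" by (auto simp: cosupport_def)
  have cVB: "card (V - B l) = CARD('n) - j l" if "l \<le> p" for l
    using BV[OF that] finite_V V(2) by (simp add: card_Diff_subset finite_subset)
  have "card ?\<sigma> = (\<Sum>l\<le>p. CARD('n) - j l)" using finite_V cVB by (simp add: \<sigma>)
  then have card: "card ?\<sigma> = CARD('n) * p" by (simp only: sum_codegrees[OF j])
  have inds: "independent_family ?\<sigma> (spike p)"
    unfolding independent_family_def
  proof (intro conjI allI impI ballI)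
    show "finite ?\<sigma>" using ind by (simp add: independent_family_def)
    fix d i assume d: "(\<Sum>i\<in>?\<sigma>. d i *\<^sub>R spike p i) = 0" and i: "i \<in> ?\<sigma>"
    have "(\<Sum>i\<in>?\<sigma>. (d i / t (fst i)) *\<^sub>R vert i) = 0"
      unfolding d[symmetric] using t_pos by (intro sum.cong refl) (simp add: less_imp_neq[symmetric])
    then have "d i / t (fst i) = 0" using i by (rule independent_familyD[OF ind, where c="\<lambda>i. d i / t (fst i)"])
    then show "d i = 0" using t_pos[of "fst i"] by simp
  qed
  have vf: "vert ` ?\<sigma> \<subseteq> families p" by (rule vert_families[OF \<sigma>J])
  have sf: "spike p ` ?\<sigma> \<subseteq> families p" by (rule spike_image_families[OF \<sigma>J])
  show "family_simplex ?\<sigma> vert \<in> sets (volM p)" by (rule volM.family_simplex_measurable[OF ind vf])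
  have "(\<Prod>i\<in>?\<sigma>. t (fst i)) = (\<Prod>l\<le>p. t l ^ (CARD('n) - j l))"
  proof -
    have "(\<Prod>i\<in>?\<sigma>. t (fst i)) = (\<Prod>l\<in>{..p}. \<Prod>v\<in>V - B l. t l)"
      unfolding \<sigma> using finite_V by (subst prod.Sigma) (auto intro!: prod.cong)
    then show ?thesis using cVB by simp
  qed
  then have "measure (volM p) (para (vert ` ?\<sigma>)) =
      (\<Prod>l\<le>p. t l ^ (CARD('n) - j l)) * measure (volM p) (para (spike p ` ?\<sigma>))"
    using volM.measure_para_scale(2)[OF inds sf, of "\<lambda>i. t (fst i)"] t_pos by simp
  also have "\<dots> \<le> (\<Prod>l\<le>p. t l ^ (CARD('n) - j l)) * measure lborel (para (V - {v0})) ^ p"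
    using measure_para_spike_le[OF V \<sigma>J inds card v0] t_pos
    by (intro mult_left_mono prod_nonneg) (auto simp: less_imp_le)
  finally show "measure (volM p) (family_simplex ?\<sigma> vert) \<le>
      (\<Prod>l\<le>p. t l ^ (CARD('n) - j l)) * measure lborel (para (V - {v0})) ^ p / fact (CARD('n) * p)"
    using volM.measure_family_simplex[OF ind vf] by (simp add: card divide_right_mono)
qed

text \<open>The number of simplices is multiplied by the bound for one of them. The
  \<open>(n + 1) ^ p\<close> of the count meets the p-th power of the reference parallelotope, and
  \<open>small_para\<close> bounds the product by the p-th power of \<open>n!\<close> times the
  volume of the simplex.\<close>

lemma R_body_simplex_le:
  "measure (volM p) (R_body p t (convex hull V)) \<le>
    (\<Prod>l\<le>p. t l ^ (CARD('n) - j l)) *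
      (fact CARD('n) ^ p / fact (CARD('n) * p) * multinomial CARD('n) p j) * measure lborel (convex hull V) ^ p"
proof -
  let ?n = "CARD('n)"
  obtain v0 where v0: "v0 \<in> V"
    "real (?n + 1) * measure lborel (para (V - {v0})) \<le> fact ?n * measure lborel (convex hull V)"
    by (rule small_para[OF V])
  let ?k = "measure lborel (para (V - {v0}))"
  let ?A = "\<Prod>l\<le>p. t l ^ (?n - j l)"
  have A: "0 \<le> ?A" using t_pos by (intro prod_nonneg) (auto simp: less_imp_le)
  have fs: "finite simplices"
    unfolding simplices_def using finite_linked_families[OF finite_V] by simp
  have cpt: "compact (R_body p t (convex hull V))"
    by (intro R_body_compact finite_imp_compact_convex_hull finite_V convex_convex_hull)
  have Rm: "R_body p t (convex hull V) \<in> sets (volM p)" by (rule compact_measurable_volM[OF cpt])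
  let ?S = "\<lambda>B. family_simplex (cosupport B) vert"
  have Sm: "?S B \<in> fmeasurable (volM p)" if "B \<in> simplices" for B
  proof -
    have "independent_family (cosupport B) vert" "cosupport B \<subseteq> J"
      using that by (auto simp: simplices_def cosupport_def)
    then show ?thesis
      using volM.family_simplex_finite[OF _ vert_families] volM.family_simplex_measurable[OF _ vert_families]
      by (intro fmeasurableI)
  qed
  have "measure (volM p) (R_body p t (convex hull V)) = measure (volM p) (R_body p t (convex hull V) - low_dim_part)"
    by (rule measure_Diff_null_set[OF Rm low_dim_part_null, symmetric])
  also have "\<dots> \<le> measure (volM p) (\<Union>B\<in>simplices. ?S B)"
  proof (rule measure_mono_fmeasurable)
    show "R_body p t (convex hull V) - low_dim_part \<subseteq> (\<Union>B\<in>simplices. ?S B)" using R_body_cover by blast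
    show "R_body p t (convex hull V) - low_dim_part \<in> sets (volM p)" by (rule sets.Diff[OF Rm null_setsD2[OF low_dim_part_null]])
    show "(\<Union>B\<in>simplices. ?S B) \<in> fmeasurable (volM p)" using fs Sm by (rule fmeasurable.finite_UN)
  qed
  also have "\<dots> \<le> (\<Sum>B\<in>simplices. measure (volM p) (?S B))"
    using fs Sm by (intro measure_UNION_le fmeasurableD)
  also have "\<dots> \<le> (\<Sum>B\<in>simplices. ?A * ?k ^ p / fact (?n * p))"
    using measure_cosupport_simplex(2)[OF _ v0(1)] by (rule sum_mono)
  also have "\<dots> = real (card simplices) * (?A * ?k ^ p / fact (?n * p))" by simp
  also have "\<dots> \<le> (real (?n + 1) ^ p * multinomial ?n p j) * (?A * ?k ^ p / fact (?n * p))"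
  proof (rule mult_right_mono)
    have "card simplices \<le> card (linked_families (Suc p) V j)"
      using finite_linked_families[OF finite_V] by (intro card_mono) (auto simp: simplices_def)
    then have "real (card simplices) \<le> real (card (linked_families (Suc p) V j))" by simp
    also have "\<dots> \<le> real (card V) ^ p * (fact (\<Sum>l<Suc p. j l) / (\<Prod>l<Suc p. fact (j l)))"
      using finite_V by (rule card_linked_families) (simp add: V(2) j lessThan_Suc_atMost)
    also have "\<dots> = real (?n + 1) ^ p * multinomial ?n p j"
      unfolding lessThan_Suc_atMost j V(2) multinomial_def ..
    finally show "real (card simplices) \<le> real (?n + 1) ^ p * multinomial ?n p j" .
  qed (use A in simp)
  also have "\<dots> = (real (?n + 1) * ?k) ^ p * (?A * multinomial ?n p j / fact (?n * p))"
    by (simp add: power_mult_distrib)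
  also have "\<dots> \<le> (fact ?n * measure lborel (convex hull V)) ^ p * (?A * multinomial ?n p j / fact (?n * p))"
  proof (rule mult_right_mono)
    show "(real (?n + 1) * ?k) ^ p \<le> (fact ?n * measure lborel (convex hull V)) ^ p"
      using v0(2) by (intro power_mono) auto
    show "0 \<le> ?A * multinomial ?n p j / fact (?n * p)"
      using A by (simp add: multinomial_def prod_nonneg)
  qed
  also have "\<dots> = ?A * (fact ?n ^ p / fact (?n * p) * multinomial ?n p j) * measure lborel (convex hull V) ^ p"
    by (simp add: power_mult_distrib)
  finally show ?thesis .
qed

end

section \<open>Mixed volumes\<close>

lemma proper_subspace_null:
  fixes U :: "(nat \<Rightarrow>\<^sub>0 real ^ 'n) set"
  assumes U: "subspace U" "U \<subseteq> families p" "U \<noteq> families p"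
  shows "U \<in> null_sets (volM p)"
proof -
  obtain B0 :: "(nat \<Rightarrow>\<^sub>0 real ^ 'n) set" where B0: "finite B0" "independent B0" "span B0 = families p" "card B0 = CARD('n) * p"
    by (rule basis_families)
  obtain B where B: "B \<subseteq> U" "independent B" "U \<subseteq> span B"
    by (rule maximal_independent_subset)
  have "B \<subseteq> families p" using B(1) U(2) by (rule subset_trans)
  then have "finite B" using independent_span_bound[OF B0(1) B(2)] B0(3) by simp
  have "span B = U" using B(1,3) span_minimal[OF B(1) U(1)] by (intro equalityI)
  then show ?thesis
    using volM.emeasure_span_null[OF \<open>finite B\<close> B(2) \<open>B \<subseteq> families p\<close>] U(3) by simp
qed

text \<open>The row of each of the \<open>np\<close> bodies, in the order of
  \<open>body_list\<close>.\<close>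

definition spike_list :: "nat \<Rightarrow> nat \<Rightarrow> (nat \<Rightarrow> nat) \<Rightarrow> nat list" where
  "spike_list n p j = concat (map (\<lambda>l. replicate (n - j l) l) [0..<Suc p])"

lemma length_spike_list: "length (spike_list n p j) = (\<Sum>l\<le>p. n - j l)"
  by (induction p) (simp_all add: spike_list_def)

lemma prod_spike_list: "(\<Prod>i<length (spike_list n p j). t (spike_list n p j ! i) :: real) = (\<Prod>l\<le>p. t l ^ (n - j l))"
proof -
  have "(\<Prod>i<length xs. t (xs ! i)) = prod_list (map t xs)" for xs :: "nat list"
    using prod.list_conv_set_nth[of "map t xs"] by (simp add: atLeast0LessThan)
  moreover have "prod_list (map t (spike_list n p j)) = (\<Prod>l\<le>p. t l ^ (n - j l))"
    by (induction p) (simp_all add: spike_list_def)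
  ultimately show ?thesis by simp
qed

lemma nth_spike_list: "i < length (spike_list n p j) \<Longrightarrow> spike_list n p j ! i \<le> p"
  using nth_mem[of i "spike_list n p j"] by (auto simp: spike_list_def)

lemma body_list_eq: "body_list p j K = map (\<lambda>l. (\<lambda>x. spike p (l, x)) ` K) (spike_list CARD('n) p j)"
  for K :: "(real ^ 'n) set"
proof -
  have "[0..<Suc p] = 0 # [1..<p + 1]" by (simp add: upt_conv_Cons One_nat_def)
  moreover have "map g (concat (map (\<lambda>l. replicate (m l) l) ls)) = concat (map (\<lambda>l. replicate (m l) (g l)) ls)"
    for g :: "nat \<Rightarrow> (nat \<Rightarrow>\<^sub>0 real ^ 'n) set" and m ls
    by (induction ls) auto
  moreover have "map (\<lambda>l. replicate (CARD('n) - j l) ((\<lambda>x. spike p (l, x)) ` K)) [1..<p + 1] =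
      map (\<lambda>l. replicate (CARD('n) - j l) (incl l ` K)) [1..<p + 1]"
    by (intro map_cong refl) (auto simp: spike_def)
  moreover have "(\<lambda>x. spike p (0, x)) ` K = (\<lambda>x. - diag p x) ` K" by (simp add: spike_def)
  ultimately show ?thesis
    unfolding body_list_def spike_list_def by (simp only: list.map concat.simps map_append map_replicate)
qed

lemma minkowski_sum_eq: "(\<Sum>i<N. (\<lambda>x. s i *\<^sub>R x) ` A i) = msum N A s"
  for A :: "nat \<Rightarrow> 'v::real_vector set"
proof -
  have "(\<Sum>i<N. (\<lambda>x. s i *\<^sub>R x) ` A i) = {\<Sum>i<N. y i | y. \<forall>i\<in>{..<N}. y i \<in> (\<lambda>x. s i *\<^sub>R x) ` A i}"
    by (rule set_sum_alt) simp
  also have "\<dots> = msum N A s"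
  proof (intro equalityI subsetI)
    fix z assume "z \<in> {\<Sum>i<N. y i | y. \<forall>i\<in>{..<N}. y i \<in> (\<lambda>x. s i *\<^sub>R x) ` A i}"
    then obtain y where y: "z = (\<Sum>i<N. y i)" "\<forall>i\<in>{..<N}. \<exists>x. x \<in> A i \<and> y i = s i *\<^sub>R x" by blast
    from bchoice[OF y(2)] obtain x where x: "\<forall>i\<in>{..<N}. x i \<in> A i \<and> y i = s i *\<^sub>R x i" ..
    then have "z = (\<Sum>i<N. s i *\<^sub>R x i)" using y(1) by simp
    then show "z \<in> msum N A s" unfolding msum_def using x by (intro CollectI exI[of _ x]) simp
  next
    fix z assume "z \<in> msum N A s"
    then obtain x where "z = (\<Sum>i<N. s i *\<^sub>R x i)" "\<forall>i<N. x i \<in> A i" by (auto simp: msum_def)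
    then show "z \<in> {\<Sum>i<N. y i | y. \<forall>i\<in>{..<N}. y i \<in> (\<lambda>x. s i *\<^sub>R x) ` A i}"
      by (intro CollectI exI[of _ "\<lambda>i. s i *\<^sub>R x i"]) auto
  qed
  finally show ?thesis .
qed

text \<open>Moved to the origin, \<open>K\<close> is orthogonal to \<open>a\<close>. Then so is the
  component of each of its images in the first factor, and the sum lies in a proper
  subspace.\<close>

lemma msum_flat_null:
  fixes f :: "nat \<Rightarrow> real ^ 'n \<Rightarrow> (nat \<Rightarrow>\<^sub>0 real ^ 'n)"
  assumes N: "N = CARD('n) * p" and p: "1 \<le> p"
    and l: "\<And>i. i < N \<Longrightarrow> l i \<le> p" and f: "f = (\<lambda>i x. spike p (l i, x))"
    and K: "compact K" "K \<subseteq> {x. a \<bullet> x = b}" "a \<noteq> 0" "K \<noteq> {}"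
  shows "measure (volM p) (msum N (\<lambda>i. f i ` K) s) = 0"
proof -
  have N0: "0 < N" using p by (simp add: N)
  have f_lin: "\<And>i. i < N \<Longrightarrow> linear (f i)" and f_fam: "\<And>i x. i < N \<Longrightarrow> f i x \<in> families p"
    using l by (auto simp: f intro: linear_spike spike_in_families)
  obtain x0 where x0: "x0 \<in> K" using K(4) by blast
  let ?L = "(\<lambda>y. y - x0) ` K"
  define U where "U = {z \<in> families p. a \<bullet> Poly_Mapping.lookup z 1 = 0}"
  have "msum N (\<lambda>i. f i ` ?L) s \<subseteq> U"
  proof
    fix z assume "z \<in> msum N (\<lambda>i. f i ` ?L) s"
    then obtain u where u: "\<forall>i<N. u i \<in> f i ` ?L" "z = (\<Sum>i<N. s i *\<^sub>R u i)" by (auto simp: msum_def)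
    have "u i \<in> U" if "i < N" for i
    proof -
      obtain y where y: "y \<in> K" "u i = f i (y - x0)" using u(1) \<open>i < N\<close> by blast
      have "a \<bullet> (y - x0) = 0" "a \<bullet> (x0 - y) = 0" using K(2) x0 y(1) by (auto simp: inner_diff_right)
      moreover have "Poly_Mapping.lookup (u i) 1 = (if l i = 0 then - (y - x0) else if l i = 1 then y - x0 else 0)"
        using p by (simp add: y(2) f lookup_spike)
      ultimately show ?thesis using f_fam[OF \<open>i < N\<close>] y(2) by (simp add: U_def inner_minus_right)
    qed
    moreover have "subspace U"
      using subspace_families[of p] by (auto simp: U_def subspace_def lookup_add lookup_scaleR inner_add_right)
    ultimately show "z \<in> U" unfolding u(2) by (intro subspace_sum subspace_scale) auto
  qed
  moreover have "U \<in> null_sets (volM p)"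
  proof (rule proper_subspace_null)
    show "subspace U"
      using subspace_families[of p] by (auto simp: U_def subspace_def lookup_add lookup_scaleR inner_add_right)
    show "U \<subseteq> families p" by (auto simp: U_def)
    have "spike p (1, a) \<in> families p" using p by (intro spike_in_families)
    moreover have "spike p (1, a) \<notin> U" using p K(3) by (simp add: U_def lookup_spike)
    ultimately show "U \<noteq> families p" by blast
  qed
  moreover have "compact (msum N (\<lambda>i. f i ` ?L) s)"
    unfolding f by (intro compact_msum compact_continuous_image continuous_spike continuous_intros K(1))
  ultimately have "measure (volM p) (msum N (\<lambda>i. f i ` ?L) s) = 0"
    by (intro measure_eq_0_null_sets) (rule null_sets_subset, simp_all add: compact_measurable_volM)
  moreover have "measure (volM p) (msum N (\<lambda>i. f i ` ?L) s) = measure (volM p) (msum N (\<lambda>i. f i ` K) s)"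
    by (rule volsum_translate) (fact N N0 f_lin f_fam K(1))+
  ultimately show ?thesis by simp
qed

lemma mixed_volume_spikes:
  fixes K :: "(real ^ 'n) set"
  assumes K: "compact K" and N: "N = CARD('n) * p" and len: "length (spike_list CARD('n) p j) = N"
  shows "mixed_volume p (body_list p j K) = (1 / fact N) * mixed_partial N
    (\<lambda>s. measure (volM p) (msum N (\<lambda>i. (\<lambda>x. spike p (spike_list CARD('n) p j ! i, x)) ` K) s)) (\<lambda>_. 0)"
proof -
  have "vol p (\<Sum>i<N. (\<lambda>x. s i *\<^sub>R x) ` (body_list p j K ! i)) =
      measure (volM p) (msum N (\<lambda>i. (\<lambda>x. spike p (spike_list CARD('n) p j ! i, x)) ` K) s)" for s
  proof -
    let ?M = "msum N (\<lambda>i. (\<lambda>x. spike p (spike_list CARD('n) p j ! i, x)) ` K) s"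
    have "(\<Sum>i<N. (\<lambda>x. s i *\<^sub>R x) ` (body_list p j K ! i)) =
        (\<Sum>i<N. (\<lambda>x. s i *\<^sub>R x) ` ((\<lambda>x. spike p (spike_list CARD('n) p j ! i, x)) ` K))"
      by (intro sum.cong refl) (simp add: body_list_eq len)
    also have "\<dots> = ?M" by (rule minkowski_sum_eq)
    finally have "(\<Sum>i<N. (\<lambda>x. s i *\<^sub>R x) ` (body_list p j K ! i)) = ?M" .
    moreover have "?M \<subseteq> families p"
      by (intro msum_subset_families image_subsetI spike_in_families nth_spike_list) (simp add: len)
    moreover have "?M \<in> sets (volM p)"
      by (intro compact_measurable_volM compact_msum compact_continuous_image continuous_spike K)
    ultimately show ?thesis by (simp add: vol_eq)
  qed
  then show ?thesis unfolding mixed_volume_def N[symmetric] by (simp only:)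
qed

theorem proposition9p6:
  fixes S :: "(real ^ 'n) set"
  assumes n_ge_2: "CARD('n) \<ge> 2"
    and simplex: "centered_simplex S"
    and hyp: "\<And>p (K :: (real ^ 'n) set) t.
      p \<ge> 1 \<Longrightarrow> convex_body K \<Longrightarrow> aff_dim K = int CARD('n) \<Longrightarrow> t \<in> Theta p \<Longrightarrow>
        \<exists>x\<in>K. vol p (R_body p t ((\<lambda>y. y - x) ` K)) / measure lborel K ^ p
              \<le> vol p (R_body p t S) / measure lborel S ^ p"
  shows "\<forall>p j (K :: (real ^ 'n) set).
      p \<ge> 1 \<longrightarrow> (\<Sum>l\<le>p. j l) = CARD('n) \<longrightarrow> convex_body K \<longrightarrow>
        mixed_volume p (body_list p j K)
          \<le> fact CARD('n) ^ p / fact (CARD('n) * p)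
              * multinomial CARD('n) p j * measure lborel K ^ p"
proof (intro allI impI)
  fix p :: nat and j and K :: "(real ^ 'n) set"
  assume p: "p \<ge> 1" and j: "(\<Sum>l\<le>p. j l) = CARD('n)" and "convex_body K"
  then have K: "K \<noteq> {}" "compact K" "convex K" by (auto simp: convex_body_def)
  define N where "N = CARD('n) * p"
  have N: "0 < N" using p by (simp add: N_def)
  let ?l = "\<lambda>i. spike_list CARD('n) p j ! i"
  define f where "f = (\<lambda>i x :: real ^ 'n. spike p (?l i, x))"
  define F where "F s = measure (volM p) (msum N (\<lambda>i. f i ` K) s)" for s
  define Q where "Q = fact CARD('n) ^ p / fact N * multinomial CARD('n) p j"
  have Q: "0 \<le> Q" by (simp add: Q_def multinomial_def prod_nonneg)
  have len: "length (spike_list CARD('n) p j) = N"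
    by (simp only: length_spike_list sum_codegrees[OF j] N_def)
  have l: "?l i \<le> p" if "i < N" for i using that by (intro nth_spike_list) (simp add: len)
  have mv: "mixed_volume p (body_list p j K) = (1 / fact N) * mixed_partial N F (\<lambda>_. 0)"
    unfolding F_def f_def by (rule mixed_volume_spikes[OF K(2) N_def len])
  \<comment> \<open>The hypothesis speaks of bodies of full dimension only; for a flat body the
    mixed volume is 0.\<close>
  have "mixed_volume p (body_list p j K) \<le> Q * measure lborel K ^ p"
  proof (cases "interior K = {}")
    case True
    obtain a b where ab: "a \<noteq> 0" "K \<subseteq> {x. a \<bullet> x = b}"
      by (rule empty_interior_subset_hyperplane[OF K(3) True])
    have "F s = 0" for s
      unfolding F_def by (rule msum_flat_null[OF N_def p l f_def K(2) ab(2,1) K(1)])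
    \<comment> \<open>The zero function is treated as a polynomial over an empty index set.\<close>
    then have "mixed_partial N F (\<lambda>_. 0) = 0"
      using mixed_partial_poly_0[where K="{}" and F=F and N=N and c="\<lambda>_::unit. 0"] by simp
    then show ?thesis using Q by (simp add: mv)
  next
    case False
    obtain V where V: "\<not> affine_dependent V" "card V = CARD('n) + 1" "\<Sum>V = 0" and S: "S = convex hull V"
      using simplex by (auto simp: centered_simplex_def)
    \<comment> \<open>Normalises \<open>t\<close> to a point of \<open>Theta p\<close>, all of whose
      entries are positive.\<close>
    define c where "c = 1 / (\<Sum>l\<le>p. 1 / (real (j l) + 1 / real (p + 1)))"
    define t where "t l = c / (real (j l) + 1 / real (p + 1))" for l
    have jpos: "0 < real (j l) + 1 / real (p + 1)" for l by (intro add_nonneg_pos) auto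
    have "0 < (\<Sum>l\<le>p. 1 / (real (j l) + 1 / real (p + 1)))"
      using jpos by (intro sum_pos divide_pos_pos) auto
    then have c: "0 < c" and "c * (\<Sum>l\<le>p. 1 / (real (j l) + 1 / real (p + 1))) = 1" by (simp_all add: c_def)
    then have "(\<Sum>l\<le>p. t l) = 1" by (simp add: t_def sum_distrib_left)
    moreover have t: "0 < t l" for l unfolding t_def using c jpos by (rule divide_pos_pos)
    ultimately have "t \<in> Theta p" by (simp add: Theta_def less_imp_le)
    moreover have "aff_dim K = int CARD('n)" using aff_dim_nonempty_interior[OF False] by simp
    ultimately obtain x where x: "x \<in> K" and
      le: "vol p (R_body p t ((\<lambda>y. y - x) ` K)) / measure lborel K ^ p \<le> vol p (R_body p t S) / measure lborel S ^ p"
      using hyp[OF p \<open>convex_body K\<close>] by blast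
    let ?L = "(\<lambda>y. y - x) ` K"
    have L: "compact ?L" "convex ?L"
      using K by (auto intro!: compact_continuous_image continuous_intros simp: convex_translation_subtract_eq)
    have R: "vol p (R_body p t M) = measure (volM p) (R_body p t M)" if "compact M" "convex M" for M :: "(real ^ 'n) set"
      using that by (intro vol_eq compact_measurable_volM R_body_compact R_body_families)
    have cS: "compact S" "convex S"
      using aff_independent_finite[OF V(1)] by (simp_all add: S finite_imp_compact_convex_hull)
    define A where "A = (\<Prod>l\<le>p. t l ^ (CARD('n) - j l))"
    have A: "0 < A" using t by (simp add: A_def prod_pos)
    have "vol p (R_body p t S) \<le> A * Q * measure lborel S ^ p"
      unfolding R[OF cS] unfolding S A_def Q_def N_def by (rule R_body_simplex_le[OF V j c t_def])
    \<comment> \<open>If the measure of \<open>S\<close> is 0, the quotient is 0 by convention, and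
      \<open>A * Q\<close> is nonnegative.\<close>
    then have "vol p (R_body p t S) / measure lborel S ^ p \<le> A * Q"
      using A Q by (cases "measure lborel S = 0") (simp_all add: power_0_left divide_le_eq zero_less_measure_iff)
    then have "vol p (R_body p t ?L) / measure lborel K ^ p \<le> A * Q" using le by simp
    moreover have "0 < measure lborel K"
    proof -
      obtain y r where r: "0 < r" "ball y r \<subseteq> K" using False by (auto simp: mem_interior)
      have "K \<in> fmeasurable lborel"
        using K(2) emeasure_bounded_finite[OF compact_imp_bounded[OF K(2)]]
        by (intro fmeasurableI) (simp_all add: borel_compact)
      then have "measure lborel (ball y r) \<le> measure lborel K"
        using r(2) by (intro measure_mono_fmeasurable) auto
      then show ?thesis by (rule less_le_trans[OF content_ball_pos[OF r(1)]])
    qed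
    ultimately have RL: "measure (volM p) (R_body p t ?L) \<le> A * Q * measure lborel K ^ p"
      unfolding R[OF L] by (simp add: pos_divide_le_eq)
    have "(\<Prod>i<N. t (?l i)) * mixed_partial N F (\<lambda>_. 0) \<le> fact N * measure (volM p) (R_body p t ?L)"
    proof (rule mixed_partial_volsum_le[OF N_def N _ _ K(3,2) False F_def])
      show "linear (f i)" for i unfolding f_def by (rule linear_spike)
      show "f i y \<in> families p" if "i < N" for i y unfolding f_def using l[OF that] by (rule spike_in_families)
      show "R_body p t ?L \<in> fmeasurable (volM p)" by (intro compact_fmeasurable_volM R_body_compact L)
      show "convex (R_body p t ?L)" unfolding R_body_def by (rule convex_convex_hull)
      show "t (?l i) *\<^sub>R f i (y - x) \<in> R_body p t ?L" if "i < N" "y \<in> K" for i y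
        unfolding R_body_eq f_def using l[OF that(1)] that(2) by (intro hull_inc) blast
    qed (rule t)
    also have "\<dots> \<le> fact N * (A * Q * measure lborel K ^ p)" using RL by (intro mult_left_mono) auto
    also have "(\<Prod>i<N. t (?l i)) = A" using prod_spike_list[of t "CARD('n)" p j] by (simp only: len A_def)
    finally have "A * mixed_partial N F (\<lambda>_. 0) \<le> A * (fact N * (Q * measure lborel K ^ p))" by (simp add: mult_ac)
    then have "mixed_partial N F (\<lambda>_. 0) \<le> fact N * (Q * measure lborel K ^ p)"
      using A by (simp only: mult_le_cancel_left_pos)
    then show ?thesis by (simp add: mv divide_le_eq mult.commute)
  qed
  then show "mixed_volume p (body_list p j K)
      \<le> fact CARD('n) ^ p / fact (CARD('n) * p) * multinomial CARD('n) p j * measure lborel K ^ p"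
    by (simp only: Q_def N_def)
qed

end
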